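(* Let $p$ be a prime, let $G$ be a finite $p$-group, let $k$ be a field of characteristic $p$, and let $\alpha$ be a $k$-algebra automorphism of the group algebra $kG$. Then $\alpha$ induces a $k$-linear action on the dimension subquotients of $G$: for each $r\ge 1$, the automorphism of $J^r(kG)/J^{r+1}(kG)$ induced by $\alpha$ maps the subspace $\mathrm{Jen}_r(G)$ onto itself, and so restricts to a $k$-linear automorphism $A_r$ of $\mathrm{Jen}_r(G)$. Moreover, the action of $\alpha$ on the socle of $kG$ is multiplication by the scalar $$\lambda=\Bigl(\prod_{r\ge 1}\det(A_r)\Bigr)^{p-1}.$$ In particular, $\lambda\in(k^\times)^{p-1}$.
   Context: Let $J(kG)$ be the Jacobson radical of $kG$, which is spanned by the elements $g-1$ for $g\in G$; write $J^r(kG)$ for its $r$th power. Any $k$-algebra automorphism $\alpha$ of $kG$ preserves each $J^r(kG)$ and hence induces a $k$-linear automorphism of $J^r(kG)/J^{r+1}(kG)$. For $r\ge 1$ the dimension subgroups of $G$ are $F_r(G)=\{g\in G\mid g-1\in J^r(kG)\}$. The quotients $F_r(G)/F_{r+1}(G)$ are elementary abelian $p$-groups, and we set $\mathrm{Jen}_r(G)=k\otimes_{\mathbb{F}_p}F_r(G)/F_{r+1}(G)$ (the dimension subquotients, with scalars extended to $k$). By the Jennings--Quillen theorem, the map sending the class of $g\in F_r(G)$ to the class of $g-1$ extends to an injective $k$-linear map $\mathrm{Jen}_r(G)\to J^r(kG)/J^{r+1}(kG)$; we use it to regard $\mathrm{Jen}_r(G)$ as a subspace of $J^r(kG)/J^{r+1}(kG)$,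 namely the $k$-span of the classes of the elements $g-1$ with $g\in F_r(G)$. Only finitely many $\mathrm{Jen}_r(G)$ are nonzero, and the determinant of the automorphism of a zero space is $1$. The socle of $kG$ is one dimensional over $k$, spanned by $\sum_{g\in G}g$, so $\alpha$ acts on it by a scalar in $k^\times$. Here $(k^\times)^{p-1}=\{\mu^{p-1}\mid\mu\in k^\times\}$. *)

theory Defs
  imports
    "Jordan_Normal_Form.VS_Connect"
    "Jordan_Normal_Form.Determinant"
    "HOL-Library.Poly_Mapping"
    "HOL-Library.Set_Algebras"
begin

section \<open>The group algebra\<close>

text \<open>
  Groups that need not be abelian are types of class \<^class>\<open>group_add\<close>, so the group operation
  is written \<open>+\<close> and the neutral element \<open>0\<close>.  For such a group \<open>'g\<close> and a field \<open>'k\<close>, the type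
  \<open>'g \<Rightarrow>\<^sub>0 'k\<close> with its convolution product is the group algebra: the group element \<open>g\<close> is
  \<^term>\<open>Poly_Mapping.single g 1\<close>, and the unit is \<^term>\<open>Poly_Mapping.single 0 1\<close>.
\<close>

definition ga_scale :: "'k::field \<Rightarrow> ('g::group_add \<Rightarrow>\<^sub>0 'k) \<Rightarrow> ('g \<Rightarrow>\<^sub>0 'k)"
  where "ga_scale c x = Poly_Mapping.map ((*) c) x"

lemma lookup_ga_scale [simp]:
  "Poly_Mapping.lookup (ga_scale c x) g = c * Poly_Mapping.lookup x g"
  unfolding ga_scale_def by (simp add: Poly_Mapping.map.rep_eq when_def)

definition ga_automorphism :: "(('g::group_add \<Rightarrow>\<^sub>0 'k::field) \<Rightarrow> ('g \<Rightarrow>\<^sub>0 'k)) \<Rightarrow> bool"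
  where "ga_automorphism \<alpha> \<longleftrightarrow>
    bij \<alpha> \<and> \<alpha> 1 = 1 \<and>
    (\<forall>x y. \<alpha> (x + y) = \<alpha> x + \<alpha> y) \<and>
    (\<forall>x y. \<alpha> (x * y) = \<alpha> x * \<alpha> y) \<and>
    (\<forall>c x. \<alpha> (ga_scale c x) = ga_scale c (\<alpha> x))"


section \<open>Jacobson radical and socle of a ring\<close>

definition add_subgroup :: "'a::ring_1 set \<Rightarrow> bool"
  where "add_subgroup S \<longleftrightarrow> 0 \<in> S \<and> (\<forall>x\<in>S. \<forall>y\<in>S. x - y \<in> S)"

definition left_ideal :: "'a::ring_1 set \<Rightarrow> bool"
  where "left_ideal I \<longleftrightarrow> add_subgroup I \<and> (\<forall>a. \<forall>x\<in>I. a * x \<in> I)"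

definition maximal_left_ideal :: "'a::ring_1 set \<Rightarrow> bool"
  where "maximal_left_ideal M \<longleftrightarrow>
    left_ideal M \<and> M \<noteq> UNIV \<and> (\<forall>L. left_ideal L \<and> M \<subseteq> L \<longrightarrow> L = M \<or> L = UNIV)"

definition minimal_left_ideal :: "'a::ring_1 set \<Rightarrow> bool"
  where "minimal_left_ideal I \<longleftrightarrow>
    left_ideal I \<and> I \<noteq> {0} \<and> (\<forall>L. left_ideal L \<and> L \<subseteq> I \<longrightarrow> L = {0} \<or> L = I)"

definition jacobson_radical :: "'a::ring_1 set"
  where "jacobson_radical = \<Inter>{M. maximal_left_ideal M}"

fun jacobson_power :: "nat \<Rightarrow> 'a::ring_1 set"
  where
    "jacobson_power 0 = UNIV"
  | "jacobson_power (Suc r) =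
      add_subgroup hull {x * y | x y. x \<in> jacobson_power r \<and> y \<in> jacobson_radical}"

text \<open>The sum of all minimal left ideals, that is, the socle of the left regular module.\<close>

definition socle :: "'a::ring_1 set"
  where "socle = left_ideal hull \<Union>{I. minimal_left_ideal I}"


section \<open>The determinant of an endomorphism of a finite-dimensional vector space\<close>

definition represents_endo ::
    "('k::field, 'v, 'm) module_scheme \<Rightarrow> 'v list \<Rightarrow> ('v \<Rightarrow> 'v) \<Rightarrow> 'k mat \<Rightarrow> bool"
  where "represents_endo V bs T A \<longleftrightarrow>
    A \<in> carrier_mat (length bs) (length bs) \<and>
    (\<forall>j < length bs. T (bs ! j) =
      (\<Oplus>\<^bsub>V\<^esub> i \<in> {..<length bs}. (A $$ (i, j)) \<odot>\<^bsub>V\<^esub> (bs ! i)))"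

text \<open>
  The determinant does not depend on the basis \<open>bs\<close>; on the zero space it is that of the
  empty matrix, namely 1.
\<close>

definition endo_det :: "('k::field, 'v, 'm) module_scheme \<Rightarrow> ('v \<Rightarrow> 'v) \<Rightarrow> 'k"
  where "endo_det V T =
    (SOME d. \<exists>bs A. distinct bs \<and> vectorspace.basis class_ring V (set bs) \<and>
      represents_endo V bs T A \<and> d = det A)"


section \<open>Dimension subquotients\<close>

text \<open>
  The vector space \<open>J\<^sup>r / J\<^sup>r\<^sup>+\<^sup>1\<close>, whose elements are the cosets \<open>x + J\<^sup>r\<^sup>+\<^sup>1\<close>.  The sum of two cosets
  is their elementwise sum; in the scalar multiplication, adding \<open>J\<^sup>r\<^sup>+\<^sup>1\<close> matters for the scalar 0
  only.  The fields \<open>mult\<close> and \<open>one\<close> of the record are not used by vector spaces.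
\<close>

definition jac_quot :: "nat \<Rightarrow> ('k::field, ('g::group_add \<Rightarrow>\<^sub>0 'k) set) module"
  where "jac_quot r =
    \<lparr>carrier = {x +o jacobson_power (Suc r) | x. x \<in> jacobson_power r},
     mult = undefined,
     one = undefined,
     zero = jacobson_power (Suc r),
     add = (+),
     smult = (\<lambda>c C. ga_scale c ` C + jacobson_power (Suc r))\<rparr>"

definition dim_subgroup :: "'k::field itself \<Rightarrow> nat \<Rightarrow> 'g::group_add set"
  where "dim_subgroup _ r =
    {g. Poly_Mapping.single g (1::'k) - 1 \<in> jacobson_power r}"

definition jen_set :: "nat \<Rightarrow> ('g::group_add \<Rightarrow>\<^sub>0 'k::field) set set"
  where "jen_set r = LinearCombinations.module.span class_ring (jac_quot r)
    {(Poly_Mapping.single g 1 - 1) +o jacobson_power (Suc r) | g. g \<in> dim_subgroup TYPE('k) r}"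

definition Jen :: "nat \<Rightarrow> ('k::field, ('g::group_add \<Rightarrow>\<^sub>0 'k) set) module"
  where "Jen r = (jac_quot r)\<lparr>carrier := jen_set r\<rparr>"

text \<open>
  The map induced by \<open>\<alpha>\<close> sends the coset of \<open>x\<close> to the coset of \<open>\<alpha> x\<close>.  For an algebra
  automorphism \<open>\<alpha>\<close>, which preserves \<open>J\<^sup>r\<^sup>+\<^sup>1\<close>, the latter coset is the image under \<open>\<alpha>\<close> of the former.
\<close>

definition jac_quot_map ::
    "(('g::group_add \<Rightarrow>\<^sub>0 'k::field) \<Rightarrow> ('g \<Rightarrow>\<^sub>0 'k)) \<Rightarrow> nat \<Rightarrow>
      ('g \<Rightarrow>\<^sub>0 'k) set \<Rightarrow> ('g \<Rightarrow>\<^sub>0 'k) set"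
  where "jac_quot_map \<alpha> r =
    restrict (\<lambda>C. \<alpha> ` C) (carrier (jac_quot r :: ('k, ('g \<Rightarrow>\<^sub>0 'k) set) module))"

definition Jen_map ::
    "(('g::group_add \<Rightarrow>\<^sub>0 'k::field) \<Rightarrow> ('g \<Rightarrow>\<^sub>0 'k)) \<Rightarrow> nat \<Rightarrow>
      ('g \<Rightarrow>\<^sub>0 'k) set \<Rightarrow> ('g \<Rightarrow>\<^sub>0 'k) set"
  where "Jen_map \<alpha> r =
    restrict (jac_quot_map \<alpha> r) (carrier (Jen r :: ('k, ('g \<Rightarrow>\<^sub>0 'k) set) module))"

text \<open>Only finitely many of the spaces \<open>Jen\<^sub>r\<close> are nonzero, so this is a finite product.\<close>

definition Jen_det_prod :: "(('g::group_add \<Rightarrow>\<^sub>0 'k::field) \<Rightarrow> ('g \<Rightarrow>\<^sub>0 'k)) \<Rightarrow> 'k"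
  where "Jen_det_prod \<alpha> =
    (\<Prod>r | 1 \<le> r \<and> carrier (Jen r :: ('k, ('g \<Rightarrow>\<^sub>0 'k) set) module) \<noteq> {\<zero>\<^bsub>Jen r\<^esub>}.
      endo_det (Jen r) (Jen_map \<alpha> r))"

end

theory Submission
  imports Defs "HOL-Number_Theory.Cong"
begin

text \<open>
  Write \<open>J\<close> for the augmentation ideal of \<open>kG\<close>.  Because a \<open>p\<close>-group fixes a nonzero vector in every
  nonzero finite representation in characteristic \<open>p\<close>, the ideal \<open>J\<close> is nilpotent
  (\<open>gprod_eventually_0\<close>); hence \<open>kG\<close> is local, \<open>J\<close> is its Jacobson radical, and its socle is spanned by
  the sum over the group.

  The spaces \<open>Jen\<^sub>r(G)\<close> form a restricted Lie subalgebra \<open>L\<close> of the graded algebra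
  \<open>gr kG = \<Oplus> J\<^sup>r / J\<^sup>r\<^sup>+\<^sup>1\<close>.  Commutators of group elements give the bracket (\<open>Jen_lift_commutator\<close>), and
  \<open>p\<close>-th powers of group elements together with Jacobson's formula for \<open>(x + y)\<^sup>p\<close> give the \<open>p\<close>-power map
  (\<open>jacobson_formula\<close>, \<open>Jen_lift_power\<close>).  Let \<open>L'\<close> be any restricted Lie subalgebra of \<open>gr kG\<close> that
  contains the degree-1 part \<open>J / J\<^sup>2\<close>.  Since \<open>J / J\<^sup>2\<close> generates \<open>gr kG\<close>, collecting words in a basis of
  \<open>L'\<close> shows that the ordered monomials with all exponents below \<open>p\<close> span \<open>kG\<close> (\<open>V_subset_M\<close>,
  \<open>JP_span_mon\<close>), so that \<open>|G| \<le> p\<^bsup>dim L'\<^esup>\<close> (\<open>card_le_codim\<close>).  Conversely \<open>p\<^bsup>dim L\<^esup> \<le> |G|\<close>, as elements of the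
  dimension subgroups that are independent over \<open>k\<close> are so over the prime field (\<open>codim_le_card\<close>).
  Therefore no such \<open>L'\<close> is properly contained in \<open>L\<close> (\<open>lie_subsystem_eq\<close>).  An algebra automorphism
  \<open>\<alpha>\<close> preserves all powers of \<open>J\<close>, so \<open>L \<inter> \<alpha>(L)\<close> is such a subalgebra, and \<open>\<alpha>(L) = L\<close> follows
  (\<open>aut_Jen_lift\<close>).  This is the first half of the theorem.

  For the second half, the equality \<open>|G| = p\<^bsup>dim L\<^esup>\<close> forces the longest monomial
  \<open>T = \<Prod> b\<^sub>i\<^sup>p\<^sup>-\<^sup>1\<close> in a homogeneous basis of \<open>L\<close> to be nonzero (\<open>top_mon_neq_0\<close>).  It is the only monomial
  of maximal weight and so spans the socle.  Any shorter word of the same weight vanishes (\<open>V_top\<close>), so the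
  factors of \<open>T\<close> may be permuted, and \<open>T\<close> does not change when a multiple of \<open>b\<^sub>j\<close> is added to a \<open>b\<^sub>i\<close> of the same
  weight: the additional terms contain \<open>b\<^sub>j\<^sup>p\<close>, which is a single element of \<open>L\<close> and makes the word shorter
  (\<open>top_prod_add\<close>).  A function of the basis that is invariant under transvections and homogeneous of
  degree \<open>p - 1\<close> in each vector is multiplied by \<open>det\<^sup>p\<^sup>-\<^sup>1\<close> under a linear substitution (\<open>F_comb\<close>).  Applied to
  one weight after the other (\<open>top_prod_blocks\<close>), this gives \<open>\<alpha>(T) = (\<Prod> det A\<^sub>r)\<^sup>p\<^sup>-\<^sup>1 T\<close>
  (\<open>socle_action\<close>).
\<close>

section \<open>The group algebra as a vector space\<close>

abbreviation gel :: "'g::group_add \<Rightarrow> ('g \<Rightarrow>\<^sub>0 'k::field)"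
  where "gel g \<equiv> Poly_Mapping.single g 1"

lemma ga_scale_eq_mult: "ga_scale c x = Poly_Mapping.single 0 c * x"
  unfolding ga_scale_def by (rule mult_map_scale_conv_mult)

lemma ga_scale_single [simp]: "ga_scale c (Poly_Mapping.single g d) = Poly_Mapping.single g (c * d)"
  by (simp add: ga_scale_eq_mult mult_single)

lemma ga_scale_0_right [simp]: "ga_scale c 0 = 0"
  by (simp add: ga_scale_eq_mult)

lemma ga_expand:
  fixes x :: "'g::{finite,group_add} \<Rightarrow>\<^sub>0 'k::field"
  shows "x = (\<Sum>g\<in>UNIV. ga_scale (Poly_Mapping.lookup x g) (gel g))"
  by (rule poly_mapping_eqI) (simp add: lookup_sum lookup_single when_def)

lemma lookup_gel_mult:
  fixes x :: "'g::{finite,group_add} \<Rightarrow>\<^sub>0 'k::field"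
  shows "Poly_Mapping.lookup (gel g * x) h = Poly_Mapping.lookup x (- g + h)"
proof -
  have "g + i = h \<longleftrightarrow> i = - g + h" for i by (auto simp: add.assoc[symmetric])
  then show ?thesis
    by (subst ga_expand[of x])
      (simp add: sum_distrib_left mult_single lookup_sum lookup_single when_def)
qed

lemma ga_scale_mult_left: "ga_scale c x * y = ga_scale c (x * y)"
  by (simp add: ga_scale_eq_mult mult.assoc)

text \<open>Scalars are central because a coefficient at the neutral element commutes with every group
  element.\<close>

lemma ga_scale_mult_right:
  fixes x :: "'g::{finite,group_add} \<Rightarrow>\<^sub>0 'k::field"
  shows "x * ga_scale c y = ga_scale c (x * y)"
proof -
  have "x * Poly_Mapping.single 0 c = Poly_Mapping.single 0 c * x"
    by (subst (1 2) ga_expand[of x])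
       (simp add: sum_distrib_left sum_distrib_right mult_single mult.commute)
  then show ?thesis by (simp add: ga_scale_eq_mult mult.assoc[symmetric])
qed

global_interpretation ga: finite_dimensional_vector_space
  "ga_scale :: 'k::field \<Rightarrow> ('g::{finite,group_add} \<Rightarrow>\<^sub>0 'k) \<Rightarrow> _" "range gel"
proof
  fix a b :: 'k and x y :: "'g \<Rightarrow>\<^sub>0 'k"
  show "ga_scale a (x + y) = ga_scale a x + ga_scale a y"
    by (simp add: ga_scale_eq_mult distrib_left)
  show "ga_scale (a + b) x = ga_scale a x + ga_scale b x"
    by (simp add: ga_scale_eq_mult single_add distrib_right)
  show "ga_scale a (ga_scale b x) = ga_scale (a * b) x"
    by (simp add: ga_scale_eq_mult mult.assoc[symmetric] mult_single)
  show "ga_scale 1 x = x"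
    by (simp add: ga_scale_eq_mult)
next
  interpret vs: vector_space "ga_scale :: 'k::field \<Rightarrow> ('g::{finite,group_add} \<Rightarrow>\<^sub>0 'k) \<Rightarrow> _"
    by standard
      (simp_all add: ga_scale_eq_mult distrib_left distrib_right single_add
        mult.assoc[symmetric] mult_single)
  show "finite (range gel :: ('g \<Rightarrow>\<^sub>0 'k) set)" by simp
  show "\<not> vs.dependent (range gel :: ('g \<Rightarrow>\<^sub>0 'k) set)"
  proof
    assume "vs.dependent (range gel :: ('g \<Rightarrow>\<^sub>0 'k) set)"
    then obtain u v where v: "v \<in> range gel" "u v \<noteq> 0"
      and s: "(\<Sum>v\<in>(range gel :: ('g \<Rightarrow>\<^sub>0 'k) set). ga_scale (u v) v) = 0"
      by (auto simp: vs.dependent_finite)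
    then obtain h where h: "v = gel h" by auto
    have "inj (gel :: 'g \<Rightarrow> ('g \<Rightarrow>\<^sub>0 'k))"
      by (rule injI) (metis lookup_single_eq lookup_single_not_eq zero_neq_one)
    then have "(\<Sum>g\<in>UNIV. ga_scale (u (gel g)) (gel g)) = (0 :: 'g \<Rightarrow>\<^sub>0 'k)"
      using s by (simp add: sum.reindex del: ga_scale_single)
    then have "Poly_Mapping.lookup (\<Sum>g\<in>UNIV. ga_scale (u (gel g)) (gel g)) h = 0"
      by simp
    then show False using v h by (simp add: lookup_sum lookup_single when_def)
  qed
  show "vs.span (range gel :: ('g \<Rightarrow>\<^sub>0 'k) set) = UNIV"
  proof -
    have "x \<in> vs.span (range gel)" for x :: "'g \<Rightarrow>\<^sub>0 'k"
      by (subst ga_expand) (intro vs.span_sum vs.span_scale vs.span_base, simp)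
    then show ?thesis by auto
  qed
qed

lemma inj_gel: "inj (gel :: 'g::group_add \<Rightarrow> ('g \<Rightarrow>\<^sub>0 'k::field))"
  by (rule injI) (metis lookup_single_eq lookup_single_not_eq zero_neq_one)

lemma ga_dim_UNIV:
  "ga.dim (UNIV :: ('g::{finite,group_add} \<Rightarrow>\<^sub>0 'k::field) set) = card (UNIV :: 'g set)"
  using ga.dim_UNIV inj_gel[where 'g='g and 'k='k] by (simp add: ga.dimension_def card_image)

lemma span_mult:
  fixes S T :: "('g::{finite,group_add} \<Rightarrow>\<^sub>0 'k::field) set"
  assumes "x \<in> ga.span S" "y \<in> ga.span T"
    and ST: "\<And>s t. s \<in> S \<Longrightarrow> t \<in> T \<Longrightarrow> s * t \<in> W" and W: "ga.subspace W"
  shows "x * y \<in> W"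
proof -
  have 1: "s * y \<in> W" if "s \<in> S" for s
    using assms(2)
    by (induction rule: ga.span_induct_alt)
      (use ST[OF that] W in \<open>auto simp: distrib_left ga_scale_mult_right ga.subspace_def\<close>)
  show ?thesis
    using assms(1)
    by (induction rule: ga.span_induct_alt)
      (use 1 W in \<open>auto simp: distrib_right ga_scale_mult_left ga.subspace_def\<close>)
qed

lemma span_commutator:
  fixes S T :: "('g::{finite,group_add} \<Rightarrow>\<^sub>0 'k::field) set"
  assumes "x \<in> ga.span S" "y \<in> ga.span T"
    and ST: "\<And>s t. s \<in> S \<Longrightarrow> t \<in> T \<Longrightarrow> s * t - t * s \<in> W" and W: "ga.subspace W"
  shows "x * y - y * x \<in> W"
proof -
  have 1: "s * y - y * s \<in> W" if "s \<in> S" for s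
    using assms(2)
  proof (induction rule: ga.span_induct_alt)
    case base then show ?case using W by (simp add: ga.subspace_0)
  next
    case (step c t y)
    have "s * (ga_scale c t + y) - (ga_scale c t + y) * s
        = ga_scale c (s * t - t * s) + (s * y - y * s)"
      by (simp add: algebra_simps ga_scale_mult_right ga_scale_mult_left ga.scale_right_diff_distrib)
    then show ?case using step ST[OF that] W by (simp add: ga.subspace_add ga.subspace_scale)
  qed
  show ?thesis
    using assms(1)
  proof (induction rule: ga.span_induct_alt)
    case base then show ?case using W by (simp add: ga.subspace_0)
  next
    case (step c s x)
    have "(ga_scale c s + x) * y - y * (ga_scale c s + x)
        = ga_scale c (s * y - y * s) + (x * y - y * x)"
      by (simp add: algebra_simps ga_scale_mult_right ga_scale_mult_left ga.scale_right_diff_distrib)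
    then show ?case using step 1 W by (simp add: ga.subspace_add ga.subspace_scale)
  qed
qed


section \<open>The augmentation ideal of a modular group algebra\<close>

definition aug :: "('g::{finite,group_add} \<Rightarrow>\<^sub>0 'k::field) \<Rightarrow> 'k"
  where "aug x = (\<Sum>g\<in>UNIV. Poly_Mapping.lookup x g)"

definition aug_ideal :: "('g::{finite,group_add} \<Rightarrow>\<^sub>0 'k::field) set"
  where "aug_ideal = {x. aug x = 0}"

lemma aug_add: "aug (x + y) = aug x + aug y"
  by (simp add: aug_def lookup_add sum.distrib)

lemma aug_scale: "aug (ga_scale c x) = c * aug x"
  by (simp add: aug_def sum_distrib_left)

lemma aug_0 [simp]: "aug 0 = 0"
  by (simp add: aug_def)

lemma aug_gel [simp]: "aug (gel g) = 1"
  by (simp add: aug_def lookup_single when_def)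

lemma aug_1 [simp]: "aug 1 = 1"
  by (simp flip: single_one)

lemma aug_sum: "aug (\<Sum>i\<in>A. f i) = (\<Sum>i\<in>A. aug (f i))"
  by (induction A rule: infinite_finite_induct) (auto simp: aug_add)

lemma aug_diff: "aug (x - y) = aug x - aug y"
  by (simp add: aug_def lookup_minus sum_subtractf)

lemma aug_mult: "aug (x * y) = aug x * aug y"
proof -
  have "aug (x * y) = (\<Sum>g\<in>UNIV. \<Sum>h\<in>UNIV. Poly_Mapping.lookup x g * Poly_Mapping.lookup y h)"
    by (subst ga_expand[of x], subst ga_expand[of y])
       (simp add: sum_distrib_left sum_distrib_right mult_single aug_sum del: ga_scale_single,
        simp add: ga_scale_mult_left ga_scale_mult_right mult_single aug_scale
          sum_distrib_left sum_distrib_right ac_simps del: ga_scale_single,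
        rule sum.swap)
  then show ?thesis by (simp add: aug_def sum_product)
qed

lemma aug_ideal_subspace: "ga.subspace aug_ideal"
  by (auto simp: ga.subspace_def aug_ideal_def aug_add aug_scale)

lemma aug_ideal_mult_left: "x \<in> aug_ideal \<Longrightarrow> a * x \<in> aug_ideal"
  and aug_ideal_mult_right: "x \<in> aug_ideal \<Longrightarrow> x * a \<in> aug_ideal"
  by (auto simp: aug_ideal_def aug_mult)

lemma gel_minus_1_aug: "gel g - 1 \<in> aug_ideal"
  by (simp add: aug_ideal_def aug_diff)

lemma aug_ideal_span:
  "(aug_ideal :: ('g::{finite,group_add} \<Rightarrow>\<^sub>0 'k::field) set) = ga.span (range (\<lambda>g. gel g - 1))"
proof
  show "ga.span (range (\<lambda>g. gel g - 1)) \<subseteq> (aug_ideal :: ('g \<Rightarrow>\<^sub>0 'k) set)"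
    by (rule ga.span_minimal) (auto simp: gel_minus_1_aug aug_ideal_subspace)
  show "(aug_ideal :: ('g \<Rightarrow>\<^sub>0 'k) set) \<subseteq> ga.span (range (\<lambda>g. gel g - 1))"
  proof
    fix x :: "'g \<Rightarrow>\<^sub>0 'k" assume x: "x \<in> aug_ideal"
    have "x = (\<Sum>g\<in>UNIV. ga_scale (Poly_Mapping.lookup x g) (gel g)) - ga_scale (aug x) 1"
      using x ga_expand[of x] by (simp add: aug_ideal_def)
    also have "ga_scale (aug x) (1 :: 'g \<Rightarrow>\<^sub>0 'k) = (\<Sum>g\<in>UNIV. ga_scale (Poly_Mapping.lookup x g) 1)"
      unfolding aug_def by (rule ga.scale_sum_left)
    also have "(\<Sum>g\<in>UNIV. ga_scale (Poly_Mapping.lookup x g) (gel g)) - \<dots>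
        = (\<Sum>g\<in>UNIV. ga_scale (Poly_Mapping.lookup x g) (gel g - 1))"
      by (simp only: sum_subtractf ga.scale_right_diff_distrib)
    finally show "x \<in> ga.span (range (\<lambda>g. gel g - 1))"
      by (metis (no_types, lifting) ga.span_base ga.span_scale ga.span_sum rangeI)
  qed
qed

locale modular_p_group =
  fixes p :: nat and k_type :: "'k::field itself" and g_type :: "'g::{finite,group_add} itself"
  assumes p_prime: "prime p"
    and card_group: "\<exists>n. card (UNIV :: 'g set) = p ^ n"
    and char_k: "CHAR('k) = p"

text \<open>Orbits have \<open>p\<close>-power length, so the non-fixed points come in orbits of length divisible by
  \<open>p\<close>.\<close>

lemma p_group_fixed_points:
  fixes act :: "'g::{finite,group_add} \<Rightarrow> 'x \<Rightarrow> 'x"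
  assumes p: "prime p" and card: "card (UNIV :: 'g set) = p ^ n"
    and fin: "finite X" and dvd: "p dvd card X"
    and closed: "\<And>g x. x \<in> X \<Longrightarrow> act g x \<in> X"
    and act_0: "\<And>x. x \<in> X \<Longrightarrow> act 0 x = x"
    and act_add: "\<And>g h x. x \<in> X \<Longrightarrow> act (g + h) x = act g (act h x)"
  shows "p dvd card {x \<in> X. \<forall>g. act g x = x}"
proof -
  define F where "F = {x \<in> X. \<forall>g. act g x = x}"
  define orb where "orb x = range (\<lambda>g. act g x)" for x
  have inv: "act (- g) (act g x) = x" if "x \<in> X" for g x
    using act_add[OF that, of "- g" g] act_0[OF that] by simp
  have orb_dvd: "card (orb x) dvd p ^ n" if x: "x \<in> X" for x
  proof -
    define St where "St = {g. act g x = x}"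
    have fib: "card {g. act g x = y} = card St" if y: "y \<in> orb x" for y
    proof -
      obtain h where y: "y = act h x" using y by (auto simp: orb_def)
      have "{g. act g x = y} = (+) h ` St"
      proof (intro equalityI subsetI)
        fix g assume "g \<in> {g. act g x = y}"
        then have "act (- h + g) x = x" using x by (simp only: act_add[OF x]) (simp add: y inv[OF x])
        then show "g \<in> (+) h ` St"
          by (intro image_eqI[of _ _ "- h + g"]) (auto simp: St_def add.assoc[symmetric])
      qed (auto simp: St_def y act_add[OF x])
      then show ?thesis by (simp add: card_image)
    qed
    have "card (UNIV :: 'g set) = (\<Sum>y\<in>orb x. card {g. act g x = y})"
    proof -
      have "(UNIV :: 'g set) = (\<Union>y\<in>orb x. {g. act g x = y})" by (auto simp: orb_def)
      then have "card (UNIV :: 'g set) = card (\<Union>y\<in>orb x. {g. act g x = y})" by simp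
      also have "\<dots> = (\<Sum>y\<in>orb x. card {g. act g x = y})"
        by (rule card_UN_disjoint) (auto simp: orb_def)
      finally show ?thesis .
    qed
    also have "\<dots> = card (orb x) * card St" using fib by simp
    finally show ?thesis using card by (metis dvd_triv_left)
  qed
  define r where "r = {(x, y). x \<in> X - F \<and> y \<in> X - F \<and> (\<exists>g. y = act g x)}"
  have notF: "act g x \<in> X - F" if "x \<in> X - F" for g x
  proof -
    have "x \<in> F" if "act g x \<in> F"
    proof -
      have a: "act h (act g x) = act g x" for h using that by (auto simp: F_def)
      have "act g x = x" using a[of "- g"] inv[of x g] \<open>x \<in> X - F\<close> by simp
      then show ?thesis using that by simp
    qed
    then show ?thesis using that closed by auto
  qed
  have equiv: "equiv (X - F) r"
  proof (rule equivI)
    show "refl_on (X - F) r" using act_0 by (auto simp: refl_on_def r_def intro!: exI[of _ 0])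
    show "sym r"
    proof (rule symI)
      fix x y assume "(x, y) \<in> r"
      then obtain g where "x \<in> X - F" "y \<in> X - F" "y = act g x" by (auto simp: r_def)
      then show "(y, x) \<in> r" using inv[of x g] by (auto simp: r_def intro!: exI[of _ "- g"])
    qed
    show "trans r"
    proof (rule transI)
      fix x y z assume "(x, y) \<in> r" "(y, z) \<in> r"
      then obtain g h where "x \<in> X - F" "z \<in> X - F" "y = act g x" "z = act h y"
        by (auto simp: r_def)
      then show "(x, z) \<in> r" using act_add[of x h g] by (auto simp: r_def intro!: exI[of _ "h + g"])
    qed
  qed (auto simp: r_def)
  have "p dvd card (X - F)"
  proof (rule equiv_imp_dvd_card[OF _ equiv])
    fix C assume "C \<in> (X - F) // r"
    then obtain x where x: "x \<in> X - F" and "C = r `` {x}" by (auto elim: quotientE)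
    then have C: "C = orb x" using notF by (auto simp: r_def orb_def)
    obtain m where m: "card (orb x) = p ^ m"
      using orb_dvd[of x] x p by (auto simp: divides_primepow_nat)
    have "m \<noteq> 0"
    proof
      assume "m = 0"
      then obtain z where z: "orb x = {z}" using m by (auto simp: card_1_singleton_iff)
      have "act g x = x" for g
        using z act_0[of x] x unfolding orb_def by (metis Diff_iff rangeI singletonD)
      then show False using x by (auto simp: F_def)
    qed
    then show "p dvd card C" using m C by (simp add: dvd_power)
  qed (use fin in auto)
  moreover have "card X = card F + card (X - F)"
    using fin by (subst card_Diff_subset) (auto simp: F_def card_mono)
  ultimately show ?thesis using dvd by (metis F_def dvd_add_left_iff)
qed

context modular_p_group begin

abbreviation gk :: "'g \<Rightarrow> ('g \<Rightarrow>\<^sub>0 'k)" where "gk \<equiv> gel"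

definition prime_coeffs :: "('g \<Rightarrow>\<^sub>0 'k) set"
  where "prime_coeffs = {x. \<forall>g. Poly_Mapping.lookup x g \<in> range of_nat}"

lemma of_nat_p: "(of_nat p :: 'k) = 0"
  using char_k by (metis of_nat_CHAR)

lemma of_nat_mod_p: "(of_nat (n mod p) :: 'k) = of_nat n"
proof -
  have "(of_nat n :: 'k) = of_nat (n mod p + p * (n div p))" by simp
  also have "\<dots> = of_nat (n mod p) + of_nat p * of_nat (n div p)" by (simp only: of_nat_add of_nat_mult)
  finally show ?thesis by (simp add: of_nat_p)
qed

lemma of_nat_inj_below_p:
  assumes "a < p" "b < p" "(of_nat a :: 'k) = of_nat b" shows "a = b"
proof -
  have "\<not> a < b" if "(of_nat a :: 'k) = of_nat b" "b < p" for a b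
  proof
    assume "a < b"
    then have "p dvd b - a" using that of_nat_eq_iff_char_dvd[where ?'a='k] char_k by blast
    then show False using that \<open>a < b\<close> by (auto dest!: dvd_imp_le)
  qed
  then show ?thesis using assms by (metis linorder_neqE_nat)
qed

lemma range_of_nat_eq: "(range of_nat :: 'k set) = of_nat ` {..<p}"
proof -
  have "of_nat n \<in> (of_nat ` {..<p} :: 'k set)" for n
    using p_prime by (intro image_eqI[of _ _ "n mod p"]) (auto simp: of_nat_mod_p prime_gt_0_nat)
  then show ?thesis by auto
qed

lemma card_prime_coeffs: "card prime_coeffs = p ^ card (UNIV :: 'g set)" "finite prime_coeffs"
proof -
  have cr: "card (range of_nat :: 'k set) = p" "finite (range of_nat :: 'k set)"
    using of_nat_inj_below_p by (auto simp: range_of_nat_eq inj_on_def card_image)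
  have "bij_betw Poly_Mapping.lookup prime_coeffs (Pi\<^sub>E (UNIV :: 'g set) (\<lambda>_. range of_nat :: 'k set))"
    unfolding bij_betw_def
  proof
    show "inj_on Poly_Mapping.lookup prime_coeffs" by (auto intro: inj_onI poly_mapping_eqI)
    show "Poly_Mapping.lookup ` prime_coeffs = Pi\<^sub>E (UNIV :: 'g set) (\<lambda>_. range of_nat :: 'k set)"
    proof (intro equalityI subsetI)
      fix f assume "f \<in> Pi\<^sub>E (UNIV :: 'g set) (\<lambda>_. range of_nat :: 'k set)"
      then show "f \<in> Poly_Mapping.lookup ` prime_coeffs"
        by (intro image_eqI[of _ _ "Poly_Mapping.Abs_poly_mapping f"])
          (auto simp: prime_coeffs_def PiE_def Pi_def)
    qed (auto simp: prime_coeffs_def)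
  qed
  from bij_betw_same_card[OF this] bij_betw_finite[OF this] cr
  show "card prime_coeffs = p ^ card (UNIV :: 'g set)" "finite prime_coeffs"
    by (simp_all add: card_PiE finite_PiE)
qed

lemma prime_coeffs_diff: "x \<in> prime_coeffs \<Longrightarrow> y \<in> prime_coeffs \<Longrightarrow> x - y \<in> prime_coeffs"
proof -
  have "a - b \<in> range of_nat" if "a \<in> range of_nat" "b \<in> range of_nat" for a b :: 'k
  proof -
    obtain m n where "a = of_nat m" "b = of_nat n" using \<open>a \<in> _\<close> \<open>b \<in> _\<close> by auto
    then have "a - b = of_nat m + (of_nat p - 1) * of_nat n" by (simp add: of_nat_p)
    also have "\<dots> = of_nat (m + (p - 1) * n)"
      using p_prime prime_ge_1_nat[of p] of_nat_diff[of 1 p, where 'a='k] by simp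
    finally show ?thesis by (metis rangeI)
  qed
  then show "x \<in> prime_coeffs \<Longrightarrow> y \<in> prime_coeffs \<Longrightarrow> x - y \<in> prime_coeffs"
    by (auto simp: prime_coeffs_def lookup_minus)
qed

lemma prime_coeffs_gel: "x \<in> prime_coeffs \<Longrightarrow> gk g * x \<in> prime_coeffs"
  by (simp add: prime_coeffs_def lookup_gel_mult)

definition gprod :: "'g list \<Rightarrow> ('g \<Rightarrow>\<^sub>0 'k)"
  where "gprod gs = prod_list (map (\<lambda>g. gk g - 1) gs)"

text \<open>The elements of \<open>F\<^sub>pG\<close> killed by a power of the augmentation ideal form a \<open>G\<close>-stable additive
  subgroup.  If it were proper, the number of its cosets would be a power of \<open>p\<close> other than 1, so
  \<open>G\<close> would fix a nontrivial coset; but the elements of such a coset are killed by the next power.\<close>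

lemma gprod_eventually_0: "\<exists>m. \<forall>gs. length gs = m \<longrightarrow> gprod gs = 0"
proof -
  define K where "K m = {x \<in> prime_coeffs. \<forall>gs. length gs = m \<longrightarrow> gprod gs * x = 0}" for m
  define N where "N = (\<Union>m. K m)"
  have K_Suc: "K m \<subseteq> K (Suc m)" for m
  proof
    fix x assume x: "x \<in> K m"
    have "gprod gs * x = 0" if "length gs = Suc m" for gs
      using that x by (cases gs) (auto simp: gprod_def K_def mult.assoc)
    then show "x \<in> K (Suc m)" using x by (auto simp: K_def)
  qed
  then have K_mono: "K m \<subseteq> K n" if "m \<le> n" for m n
    using that by (rule lift_Suc_mono_le)
  have N_diff: "x - y \<in> N" if "x \<in> N" "y \<in> N" for x y
  proof -
    obtain m n where "x \<in> K m" "y \<in> K n" using \<open>x \<in> N\<close> \<open>y \<in> N\<close> by (auto simp: N_def)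
    then have "x \<in> K (max m n)" "y \<in> K (max m n)" using K_mono by (meson max.cobounded1 max.cobounded2 subsetD)+
    then have "x - y \<in> K (max m n)" by (auto simp: K_def right_diff_distrib prime_coeffs_diff)
    then show ?thesis by (auto simp: N_def)
  qed
  have zero: "0 \<in> N" by (auto simp: N_def K_def prime_coeffs_def intro!: image_eqI[of _ _ 0])
  have N_add: "x + y \<in> N" if "x \<in> N" "y \<in> N" for x y
    using N_diff[OF that(1) N_diff[OF zero that(2)]] by simp
  have sub: "N \<subseteq> prime_coeffs" by (auto simp: N_def K_def)
  have fin: "finite N" using sub card_prime_coeffs(2) finite_subset by blast
  have stab: "(gk g - 1) * x \<in> N" if x: "x \<in> N" for g x
  proof -
    obtain m where m: "x \<in> K m" using x by (auto simp: N_def)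
    have "x \<in> K (Suc m)" using m K_Suc by blast
    then have "gprod gs * ((gk g - 1) * x) = 0" if "length gs = m" for gs
      using that by (auto simp: K_def gprod_def mult.assoc dest!: spec[of _ "gs @ [g]"])
    moreover have "(gk g - 1) * x \<in> prime_coeffs"
      using m by (auto simp: K_def left_diff_distrib intro!: prime_coeffs_diff prime_coeffs_gel)
    ultimately show ?thesis by (auto simp: N_def K_def)
  qed
  have gstab: "gk g * x \<in> N" if x: "x \<in> N" for g x
    using N_add[OF stab[OF x, of g] x] by (simp add: left_diff_distrib)
  have max: "x \<in> N" if x: "x \<in> prime_coeffs" and all: "\<And>g. (gk g - 1) * x \<in> N" for x
  proof -
    have "\<exists>m. (gk g - 1) * x \<in> K m" for g using all[of g] by (auto simp: N_def)
    then obtain f where f: "\<And>g. (gk g - 1) * x \<in> K (f g)" by metis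
    define M where "M = Max (range f)"
    have M: "(gk g - 1) * x \<in> K M" for g using f[of g] K_mono[of "f g" M] by (auto simp: M_def)
    have "gprod gs * x = 0" if len: "length gs = Suc M" for gs
    proof -
      obtain hs g where "gs = hs @ [g]" "length hs = M" using len by (cases gs rule: rev_cases) auto
      then show ?thesis using M[of g] by (auto simp: K_def gprod_def mult.assoc)
    qed
    then show ?thesis using x by (auto simp: N_def K_def)
  qed
  define cos where "cos x = (+) x ` N" for x
  have cos_eq: "cos x = cos y \<longleftrightarrow> y - x \<in> N" for x y
  proof
    assume "cos x = cos y"
    then have "y + 0 \<in> cos x" using zero unfolding cos_def by blast
    then show "y - x \<in> N" by (auto simp: cos_def)
  next
    assume a: "y - x \<in> N"
    have "x + n \<in> cos y" if "n \<in> N" for n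
      unfolding cos_def by (rule image_eqI[of _ _ "n - (y - x)"]) (use N_diff that a in auto)
    moreover have "y + n \<in> cos x" if "n \<in> N" for n
      unfolding cos_def by (rule image_eqI[of _ _ "n + (y - x)"]) (use N_add that a in auto)
    ultimately show "cos x = cos y" by (auto simp: cos_def)
  qed
  have "N = prime_coeffs"
  proof (rule ccontr)
    assume neq: "N \<noteq> prime_coeffs"
    define X where "X = cos ` prime_coeffs"
    have finX: "finite X" using card_prime_coeffs(2) by (simp add: X_def)
    have "card prime_coeffs = card (\<Union>X)"
    proof -
      have "\<Union>X = prime_coeffs"
      proof (intro equalityI subsetI)
        fix y assume "y \<in> \<Union>X"
        then obtain x n where "x \<in> prime_coeffs" "n \<in> N" "y = x + n" by (auto simp: X_def cos_def)
        then show "y \<in> prime_coeffs"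
          using prime_coeffs_diff[of x "0 - n"] prime_coeffs_diff[of 0 n] zero sub by auto
      next
        fix y assume "y \<in> prime_coeffs"
        moreover have "y \<in> cos y" unfolding cos_def by (rule image_eqI[OF _ zero]) simp
        ultimately show "y \<in> \<Union>X" by (auto simp: X_def)
      qed
      then show ?thesis by simp
    qed
    also have "\<dots> = card N * card X"
    proof (rule card_partition[symmetric])
      show "finite (\<Union>X)" using finX fin by (auto simp: X_def cos_def)
      show "card c = card N" if "c \<in> X" for c using that by (auto simp: X_def cos_def card_image)
      show "c1 \<inter> c2 = {}" if c: "c1 \<in> X" "c2 \<in> X" "c1 \<noteq> c2" for c1 c2
      proof (rule ccontr)
        assume "c1 \<inter> c2 \<noteq> {}"
        then obtain z where z: "z \<in> c1" "z \<in> c2" by auto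
        obtain x y where xy: "c1 = cos x" "c2 = cos y" using c by (auto simp: X_def)
        moreover obtain m n where "m \<in> N" "n \<in> N" "x + m = y + n"
          using z unfolding xy cos_def by auto
        moreover from this have "y - x = m - n" by (simp add: algebra_simps)
        ultimately show False using c N_diff[of m n] cos_eq[of x y] by simp
      qed
    qed (rule finX)
    finally have "card X dvd p ^ card (UNIV :: 'g set)" using card_prime_coeffs by simp
    then obtain m where m: "card X = p ^ m" using p_prime by (auto simp: divides_primepow_nat)
    obtain x0 where x0: "x0 \<in> prime_coeffs" "x0 \<notin> N" using neq sub by blast
    have "m \<noteq> 0"
    proof
      assume "m = 0"
      then have "\<exists>C. X = {C}" using m by (simp add: card_1_singleton_iff)
      moreover have "cos x0 \<in> X" "cos 0 \<in> X" using x0 zero sub by (auto simp: X_def)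
      ultimately have "cos x0 = cos 0" by auto
      then show False using x0 cos_eq[of 0 x0] by simp
    qed
    then have pX: "p dvd card X" using m by (simp add: dvd_power)
    define act where "act g C = (*) (gk g) ` C" for g and C :: "('g \<Rightarrow>\<^sub>0 'k) set"
    have act_cos: "act g (cos x) = cos (gk g * x)" for g x
    proof (intro equalityI subsetI)
      fix y assume "y \<in> cos (gk g * x)"
      then obtain n where n: "n \<in> N" "y = gk g * x + n" by (auto simp: cos_def)
      then have "y = gk g * (x + gk (- g) * n)"
        by (simp add: distrib_left mult.assoc[symmetric] mult_single)
      then show "y \<in> act g (cos x)" using gstab[OF n(1)] by (auto simp: act_def cos_def)
    qed (use gstab in \<open>auto simp: act_def cos_def distrib_left\<close>)
    define Fx where "Fx = {C \<in> X. \<forall>g. act g C = C}"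
    obtain n where n: "card (UNIV :: 'g set) = p ^ n" using card_group by blast
    have "p dvd card Fx" unfolding Fx_def
    proof (rule p_group_fixed_points[OF p_prime n finX pX])
      fix g h :: 'g and C assume "C \<in> X"
      then obtain x where x: "x \<in> prime_coeffs" "C = cos x" by (auto simp: X_def)
      show "act g C \<in> X" using x prime_coeffs_gel by (simp add: act_cos X_def)
      show "act 0 C = C" by (simp add: act_def)
      show "act (g + h) C = act g (act h C)"
        by (simp add: act_def image_image mult.assoc[symmetric] mult_single)
    qed
    moreover have c0: "cos 0 \<in> Fx" using zero sub by (auto simp: Fx_def X_def act_cos)
    moreover have "finite Fx" using finX by (simp add: Fx_def)
    ultimately have "card Fx \<noteq> 1" "card Fx \<noteq> 0" using p_prime by auto
    then have "Fx \<noteq> {cos 0}" by auto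
    then obtain C where C: "C \<in> Fx" "C \<noteq> cos 0" using c0 by blast
    then obtain x where x: "x \<in> prime_coeffs" "C = cos x" by (auto simp: Fx_def X_def)
    have "(gk g - 1) * x \<in> N" for g
    proof -
      have "cos x = cos (gk g * x)" using C x by (auto simp: Fx_def act_cos)
      then show ?thesis using cos_eq by (simp add: left_diff_distrib)
    qed
    then have "x \<in> N" by (rule max[OF x(1)])
    then show False using C x cos_eq[of 0 x] by simp
  qed
  moreover have "1 \<in> prime_coeffs"
  proof -
    have "of_nat 0 \<in> (range of_nat :: 'k set)" "of_nat 1 \<in> (range of_nat :: 'k set)" by (rule rangeI)+
    then show ?thesis by (auto simp: prime_coeffs_def lookup_one when_def)
  qed
  ultimately obtain m where "1 \<in> K m" by (auto simp: N_def)
  then show ?thesis by (auto simp: K_def)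
qed

end

lemma add_subgroup_add: "add_subgroup S \<Longrightarrow> x \<in> S \<Longrightarrow> y \<in> S \<Longrightarrow> x + y \<in> S"
  unfolding add_subgroup_def by (metis diff_0 diff_minus_eq_add)

lemma add_subgroup_hull_UNIV: "add_subgroup (add_subgroup hull S)"
  by (rule hull_in) (auto simp: add_subgroup_def)

lemma subspace_add_subgroup: "ga.subspace S \<Longrightarrow> add_subgroup S"
  by (auto simp: add_subgroup_def ga.subspace_0 ga.subspace_diff)

lemma geometric_sum_ring: "(\<Sum>i<n. y ^ i) * (1 - y) = 1 - (y :: 'a::ring_1) ^ n"
  by (induction n) (simp_all add: distrib_right, simp add: right_diff_distrib power_commutes)

context modular_p_group begin

abbreviation aug_I :: "('g \<Rightarrow>\<^sub>0 'k) set" where "aug_I \<equiv> aug_ideal"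

lemma aug_products_span:
  assumes "set xs \<subseteq> aug_I"
  shows "prod_list xs \<in> ga.span {gprod gs | gs. length gs = length xs}"
  using assms
proof (induction xs)
  case Nil
  then show ?case by (auto simp: gprod_def intro: ga.span_base)
next
  case (Cons x xs)
  have "x \<in> ga.span (range (\<lambda>g. gk g - 1))" using Cons.prems by (simp flip: aug_ideal_span)
  moreover have "prod_list xs \<in> ga.span {gprod gs | gs. length gs = length xs}" using Cons by simp
  ultimately have "x * prod_list xs \<in> ga.span {gprod gs | gs. length gs = Suc (length xs)}"
  proof (rule span_mult)
    fix s t assume "s \<in> range (\<lambda>g. gk g - 1)" "t \<in> {gprod gs | gs. length gs = length xs}"
    then obtain g gs where "s * t = gprod (g # gs)" "length gs = length xs" by (auto simp: gprod_def)
    then show "s * t \<in> ga.span {gprod gs | gs. length gs = Suc (length xs)}"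
      by (intro ga.span_base) (auto intro!: exI[of _ "g # gs"])
  qed simp
  then show ?case by simp
qed

definition nil_index :: nat
  where "nil_index = (SOME m. \<forall>gs. length gs = m \<longrightarrow> gprod gs = 0)"

lemma aug_products_0:
  assumes "set xs \<subseteq> aug_I" "length xs = nil_index" shows "prod_list xs = 0"
proof -
  have "\<forall>gs. length gs = nil_index \<longrightarrow> gprod gs = 0"
    unfolding nil_index_def using gprod_eventually_0 by (rule someI_ex)
  then have "{gprod gs | gs. length gs = length xs} \<subseteq> {0}" using assms by auto
  then have "ga.span {gprod gs | gs. length gs = length xs} \<subseteq> {0}"
    by (intro ga.span_minimal) auto
  then show ?thesis using aug_products_span[OF assms(1)] by blast
qed

lemma aug_power_0: "x \<in> aug_I \<Longrightarrow> x ^ nil_index = 0"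
  using aug_products_0[of "replicate nil_index x"] by (simp add: set_replicate_conv_if split: if_splits)

text \<open>\<open>kG\<close> is local: an element of augmentation \<open>c \<noteq> 0\<close> is \<open>c (1 - y)\<close> with \<open>y\<close> nilpotent, hence
  invertible by the geometric series.\<close>

lemma proper_left_ideal_aug:
  assumes L: "left_ideal (L :: ('g \<Rightarrow>\<^sub>0 'k) set)" "L \<noteq> UNIV" shows "L \<subseteq> aug_I"
proof
  fix x assume x: "x \<in> L"
  show "x \<in> aug_I"
  proof (rule ccontr)
    assume "x \<notin> aug_I"
    then have c: "aug x \<noteq> 0" by (simp add: aug_ideal_def)
    define y where "y = 1 - ga_scale (inverse (aug x)) x"
    have "y \<in> aug_I" using c by (simp add: aug_ideal_def y_def aug_diff aug_scale)
    then have "1 = 1 - y ^ nil_index" using aug_power_0 by simp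
    also have "\<dots> = (\<Sum>i<nil_index. y ^ i) * (1 - y)" by (rule geometric_sum_ring[symmetric])
    also have "1 - y = ga_scale (inverse (aug x)) 1 * x" by (simp add: y_def ga_scale_mult_left)
    finally have "1 = ((\<Sum>i<nil_index. y ^ i) * ga_scale (inverse (aug x)) 1) * x"
      by (simp add: mult.assoc)
    then have "1 \<in> L" using L x unfolding left_ideal_def by metis
    then have "a \<in> L" for a using L unfolding left_ideal_def by (metis mult.right_neutral)
    then show False using L by auto
  qed
qed

lemma left_ideal_aug: "left_ideal aug_I"
  by (auto simp: left_ideal_def subspace_add_subgroup aug_ideal_subspace aug_ideal_mult_left)

lemma aug_neq_UNIV: "aug_I \<noteq> UNIV"
proof -
  have "1 \<notin> aug_I" by (simp add: aug_ideal_def)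
  then show ?thesis by blast
qed

lemma jacobson_radical_eq: "(jacobson_radical :: ('g \<Rightarrow>\<^sub>0 'k) set) = aug_I"
proof -
  have "maximal_left_ideal M \<longleftrightarrow> M = aug_I" for M :: "('g \<Rightarrow>\<^sub>0 'k) set"
    using proper_left_ideal_aug left_ideal_aug aug_neq_UNIV
    unfolding maximal_left_ideal_def by (metis subset_antisym)
  then show ?thesis by (simp add: jacobson_radical_def)
qed

subsection \<open>Powers of the radical\<close>

abbreviation JP :: "nat \<Rightarrow> ('g \<Rightarrow>\<^sub>0 'k) set" where "JP \<equiv> jacobson_power"

lemma JP_Suc: "JP (Suc r) = add_subgroup hull {x * y | x y. x \<in> JP r \<and> y \<in> aug_I}"
  by (simp add: jacobson_radical_eq)

declare jacobson_power.simps(2) [simp del]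

lemma JP_add_subgroup: "add_subgroup (JP r)"
  by (cases r) (auto simp: add_subgroup_hull_UNIV jacobson_power.simps(2), simp add: add_subgroup_def)

lemma JP_add: "x \<in> JP r \<Longrightarrow> y \<in> JP r \<Longrightarrow> x + y \<in> JP r"
  and JP_diff: "x \<in> JP r \<Longrightarrow> y \<in> JP r \<Longrightarrow> x - y \<in> JP r"
  and JP_0: "0 \<in> JP r"
  using JP_add_subgroup[of r] add_subgroup_add by (auto simp: add_subgroup_def)

lemma JP_SucI: "x \<in> JP r \<Longrightarrow> y \<in> aug_I \<Longrightarrow> x * y \<in> JP (Suc r)"
  unfolding JP_Suc by (rule hull_inc) auto

lemma JP_Suc_subset:
  assumes "\<And>x y. x \<in> JP r \<Longrightarrow> y \<in> aug_I \<Longrightarrow> x * y \<in> W" "add_subgroup W"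
  shows "JP (Suc r) \<subseteq> W"
  unfolding JP_Suc by (rule hull_minimal) (use assms in auto)

lemma JP_mult_right: "x \<in> JP r \<Longrightarrow> x * a \<in> JP r"
proof (cases r)
  case (Suc s)
  have "JP (Suc s) \<subseteq> {x. x * a \<in> JP (Suc s)}"
    by (rule JP_Suc_subset)
      (auto simp: mult.assoc add_subgroup_def left_diff_distrib aug_ideal_mult_right
        intro: JP_SucI JP_diff JP_0)
  then show "x \<in> JP r \<Longrightarrow> x * a \<in> JP r" using Suc by auto
qed simp

lemma JP_mult: "x \<in> JP r \<Longrightarrow> y \<in> JP s \<Longrightarrow> x * y \<in> JP (r + s)"
proof (induction s arbitrary: x y)
  case 0
  then show ?case by (simp add: JP_mult_right)
next
  case (Suc s)
  have "JP (Suc s) \<subseteq> {y. x * y \<in> JP (Suc (r + s))}"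
    using Suc.IH[OF Suc.prems(1)]
    by (intro JP_Suc_subset)
      (auto simp: mult.assoc[symmetric] add_subgroup_def right_diff_distrib
        intro: JP_SucI JP_diff JP_0)
  then show ?case using Suc.prems by auto
qed

lemma JP_mult_left: "x \<in> JP r \<Longrightarrow> a * x \<in> JP r"
  using JP_mult[of a 0 x r] by simp

lemma JP_subspace: "ga.subspace (JP r)"
  by (auto simp: ga.subspace_def JP_0 JP_add ga_scale_eq_mult JP_mult_left)

lemma JP_Suc_le: "JP (Suc r) \<subseteq> JP r"
  by (rule JP_Suc_subset) (auto intro: JP_mult_right JP_add_subgroup)

lemma JP_anti: "r \<le> s \<Longrightarrow> JP s \<subseteq> JP r"
  using JP_Suc_le by (rule lift_Suc_antimono_le)

lemma JP_1: "JP (Suc 0) = aug_I"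
proof
  show "JP (Suc 0) \<subseteq> aug_I"
    by (rule JP_Suc_subset)
      (auto intro: aug_ideal_mult_left subspace_add_subgroup aug_ideal_subspace)
  show "aug_I \<subseteq> JP (Suc 0)" using JP_SucI[of 1 0] by auto
qed

lemma JP_eventually_0: "JP nil_index = {0}"
proof -
  have gen: "JP r \<subseteq> ga.span {a * prod_list xs | a xs. set xs \<subseteq> aug_I \<and> length xs = r}" (is "_ \<subseteq> ?S r") for r
  proof (induction r)
    case 0
    have "x \<in> ?S 0" for x by (rule ga.span_base) auto
    then show ?case by auto
  next
    case (Suc r)
    show ?case
    proof (rule JP_Suc_subset)
      fix x y assume "x \<in> JP r" and y: "y \<in> aug_I"
      then have "x \<in> ?S r" using Suc by auto
      moreover have "y \<in> ga.span {y}" by (rule ga.span_base) simp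
      ultimately show "x * y \<in> ?S (Suc r)"
      proof (rule span_mult)
        fix s t assume "s \<in> {a * prod_list xs | a xs. set xs \<subseteq> aug_I \<and> length xs = r}" "t \<in> {y}"
        then obtain a xs where xs: "s * t = a * prod_list (xs @ [y])" "set xs \<subseteq> aug_I" "length xs = r"
          by (auto simp: mult.assoc)
        have "set (xs @ [y]) \<subseteq> aug_I \<and> length (xs @ [y]) = Suc r" using xs y by simp
        then show "s * t \<in> ?S (Suc r)" using xs(1) by (intro ga.span_base) blast
      qed simp
    qed (simp add: subspace_add_subgroup)
  qed
  have "ga.span {a * prod_list xs | a xs. set xs \<subseteq> aug_I \<and> length xs = nil_index} \<subseteq> {0}"
    by (rule ga.span_minimal) (auto simp: aug_products_0)
  then show ?thesis using gen[of nil_index] JP_0 by auto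
qed

subsection \<open>The socle\<close>

definition norm_elt :: "'g \<Rightarrow>\<^sub>0 'k"
  where "norm_elt = (\<Sum>g\<in>UNIV. gk g)"

lemma lookup_norm_elt [simp]: "Poly_Mapping.lookup norm_elt g = 1"
  by (simp add: norm_elt_def lookup_sum lookup_single when_def)

lemma aug_annihilated:
  assumes "\<And>g. (gk g - 1) * x = 0" shows "\<exists>c. x = ga_scale c norm_elt"
proof -
  have "Poly_Mapping.lookup x h = Poly_Mapping.lookup x 0" for h
    using assms[of h] lookup_gel_mult[of h x h] by (simp add: left_diff_distrib)
  then have "x = ga_scale (Poly_Mapping.lookup x 0) norm_elt" by (intro poly_mapping_eqI) simp
  then show ?thesis by blast
qed

lemma norm_elt_mult: "a * norm_elt = ga_scale (aug a) norm_elt"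
proof -
  have "gk g * norm_elt = norm_elt" for g by (rule poly_mapping_eqI) (simp add: lookup_gel_mult)
  then show ?thesis
    by (subst ga_expand[of a])
      (simp add: sum_distrib_right ga_scale_mult_left ga.scale_sum_left aug_def del: ga_scale_single)
qed

text \<open>Multiplying a nonzero element of a left ideal by as many elements of the augmentation ideal as
  possible without reaching 0 ends at a nonzero multiple of the sum over the group.\<close>

lemma left_ideal_norm_elt:
  assumes L: "left_ideal L" "x \<in> L" "x \<noteq> 0" shows "norm_elt \<in> L"
proof -
  define P where "P m \<longleftrightarrow> (\<exists>gs. length gs = m \<and> gprod gs * x \<noteq> 0)" for m
  have "P 0" using L by (auto simp: P_def gprod_def)
  moreover have "gprod gs = 0" if "length gs = nil_index" for gs
    unfolding gprod_def by (rule aug_products_0) (use that gel_minus_1_aug in auto)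
  then have "\<not> P nil_index" by (auto simp: P_def)
  ultimately obtain m where m: "P m" "\<not> P (Suc m)"
    by (metis nat_induct)
  then obtain gs where gs: "length gs = m" "gprod gs * x \<noteq> 0" by (auto simp: P_def)
  have "(gk g - 1) * (gprod gs * x) = 0" for g
    using m(2) gs(1) by (auto simp: P_def gprod_def mult.assoc dest!: spec[of _ "g # gs"])
  then obtain c where c: "gprod gs * x = ga_scale c norm_elt" using aug_annihilated by blast
  then have "c \<noteq> 0" using gs by auto
  then have "norm_elt = (Poly_Mapping.single 0 (inverse c) * gprod gs) * x"
    using c by (simp add: ga_scale_eq_mult[symmetric] ga_scale_mult_left)
  then show ?thesis using L unfolding left_ideal_def by metis
qed

lemma socle_subset: "(socle :: ('g \<Rightarrow>\<^sub>0 'k) set) \<subseteq> range (\<lambda>c. ga_scale c norm_elt)"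
  unfolding socle_def
proof (rule hull_minimal)
  let ?L = "range (\<lambda>c. ga_scale c norm_elt)"
  show L: "left_ideal ?L"
    by (auto simp: left_ideal_def add_subgroup_def ga_scale_mult_right norm_elt_mult
        ga.scale_left_diff_distrib[symmetric] simp del: ga.scale_left_diff_distrib intro: image_eqI[of _ _ 0])
  show "\<Union> {I. minimal_left_ideal I} \<subseteq> ?L"
  proof
    fix x :: "'g \<Rightarrow>\<^sub>0 'k" assume "x \<in> \<Union> {I. minimal_left_ideal I}"
    then obtain I where I: "minimal_left_ideal I" "x \<in> I" by auto
    then have li: "left_ideal I" "I \<noteq> {0}" by (auto simp: minimal_left_ideal_def)
    then have "0 \<in> I" by (auto simp: left_ideal_def add_subgroup_def)
    then obtain y where "y \<in> I" "y \<noteq> 0" using li by blast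
    then have n: "norm_elt \<in> I" using left_ideal_norm_elt li by blast
    have "left_ideal (I \<inter> ?L)" using li L unfolding left_ideal_def add_subgroup_def by blast
    moreover have "norm_elt \<in> I \<inter> ?L" using n by (auto intro: image_eqI[of _ _ 1])
    moreover have "norm_elt \<noteq> 0" by (metis lookup_norm_elt lookup_zero zero_neq_one)
    ultimately have "I \<inter> ?L = I" using I unfolding minimal_left_ideal_def by blast
    then show "x \<in> ?L" using I by blast
  qed
qed

end

section \<open>Jacobson's formula\<close>

definition sbinom :: "nat \<Rightarrow> nat \<Rightarrow> int"
  where "sbinom m j = (- 1) ^ (m + j) * int (m choose j)"

lemma sbinom_simps:
  "sbinom (Suc m) (Suc j) = sbinom m j - sbinom m (Suc j)"
  "sbinom (Suc m) 0 = - sbinom m 0" "sbinom m (Suc m) = 0" "sbinom m m = 1"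
  by (simp_all add: sbinom_def algebra_simps power_mult_distrib flip: mult_2)

text \<open>Left and right multiplication by \<open>z\<close> commute, so \<open>ad(z)\<^sup>m\<close> expands binomially.\<close>

lemma ad_funpow:
  fixes z x :: "'a::ring_1"
  shows "((\<lambda>y. z * y - y * z) ^^ m) x = (\<Sum>j\<le>m. of_int (sbinom m j) * (z ^ j * x * z ^ (m - j)))"
proof (induction m)
  case 0
  then show ?case by (simp add: sbinom_def)
next
  case (Suc m)
  let ?t = "\<lambda>m j. z ^ j * x * z ^ (m - j)"
  have cz: "z * (of_int c * y) = of_int c * (z * y)" for c y
    by (metis mult.assoc mult_of_int_commute)
  have "((\<lambda>y. z * y - y * z) ^^ Suc m) x
      = z * (\<Sum>j\<le>m. of_int (sbinom m j) * ?t m j) - (\<Sum>j\<le>m. of_int (sbinom m j) * ?t m j) * z"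
    using Suc by simp
  also have "z * (\<Sum>j\<le>m. of_int (sbinom m j) * ?t m j)
      = (\<Sum>j\<le>m. of_int (sbinom m j) * ?t (Suc m) (Suc j))"
    by (simp add: sum_distrib_left cz mult.assoc)
  also have "(\<Sum>j\<le>m. of_int (sbinom m j) * ?t m j) * z
      = (\<Sum>j\<le>Suc m. of_int (sbinom m j) * ?t (Suc m) j)"
    by (auto simp: sum_distrib_right mult.assoc Suc_diff_le power_Suc2 sbinom_simps
        simp del: power_Suc intro!: sum.cong)
  also have "\<dots> = of_int (sbinom m 0) * ?t (Suc m) 0
      + (\<Sum>j\<le>m. of_int (sbinom m (Suc j)) * ?t (Suc m) (Suc j))"
    by (rule sum.atMost_Suc_shift)
  also have "(\<Sum>j\<le>m. of_int (sbinom m j) * ?t (Suc m) (Suc j)) - \<dots>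
      = of_int (sbinom (Suc m) 0) * ?t (Suc m) 0
        + (\<Sum>j\<le>m. of_int (sbinom (Suc m) (Suc j)) * ?t (Suc m) (Suc j))"
    by (simp only: sbinom_simps of_int_diff left_diff_distrib sum_subtractf) (simp add: algebra_simps)
  also have "\<dots> = (\<Sum>j\<le>Suc m. of_int (sbinom (Suc m) j) * ?t (Suc m) j)"
    by (rule sum.atMost_Suc_shift[symmetric])
  finally show ?case .
qed

text \<open>In characteristic \<open>p\<close> the binomial coefficients of \<open>p - 1\<close> alternate between 1 and \<open>-1\<close>, because
  consecutive ones add up to a multiple of \<open>p\<close>.\<close>

lemma sbinom_char_p:
  fixes p :: nat
  assumes p: "prime p" and char: "of_nat p = (0 :: 'a::ring_1)" and "j \<le> p - 1"
  shows "of_int (sbinom (p - 1) j) = (1 :: 'a)"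
  using assms(3)
proof (induction j rule: inc_induct)
  case base
  then show ?case by (simp add: sbinom_simps)
next
  case (step j)
  then have "p dvd p choose Suc j" using p by (intro dvd_choose_prime) auto
  then have "(of_nat (p choose Suc j) :: 'a) = 0" using char by (auto elim!: dvdE)
  then have "(of_int (sbinom p (Suc j)) :: 'a) = 0" by (simp add: sbinom_def)
  moreover have "sbinom p (Suc j) = sbinom (p - 1) j - sbinom (p - 1) (Suc j)"
    using prime_gt_0_nat[OF p] by (cases p) (simp_all add: sbinom_simps)
  ultimately show ?case using step.IH by simp
qed

lemma ad_funpow_char_p:
  fixes z x :: "'a::ring_1"
  assumes "prime p" "of_nat p = (0 :: 'a)"
  shows "((\<lambda>y. z * y - y * z) ^^ (p - 1)) x = (\<Sum>j<p. z ^ j * x * z ^ (p - 1 - j))"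
proof -
  have "{..<p} = {..p - 1}" using prime_gt_0_nat[OF assms(1)] by auto
  then show ?thesis unfolding ad_funpow by (intro sum.cong) (simp_all add: sbinom_char_p[OF assms, simplified])
qed

text \<open>Polynomials in a commuting variable \<open>t\<close> over a noncommutative ring are \<^typ>\<open>nat \<Rightarrow>\<^sub>0 'a\<close>; the
  Euler operator \<open>t d/dt\<close> is a derivation.\<close>

definition euler :: "(nat \<Rightarrow>\<^sub>0 'a::ring_1) \<Rightarrow> (nat \<Rightarrow>\<^sub>0 'a)"
  where "euler f = (\<Sum>i\<in>Poly_Mapping.keys f. Poly_Mapping.single i (of_nat i * Poly_Mapping.lookup f i))"

lemma lookup_euler: "Poly_Mapping.lookup (euler f) i = of_nat i * Poly_Mapping.lookup f i"
  by (auto simp: euler_def lookup_sum lookup_single when_def in_keys_iff)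

lemma poly_expand:
  fixes f :: "nat \<Rightarrow>\<^sub>0 'a::ring_1"
  shows "f = (\<Sum>i\<in>Poly_Mapping.keys f. Poly_Mapping.single i (Poly_Mapping.lookup f i))"
  by (rule poly_mapping_eqI) (auto simp: lookup_sum lookup_single when_def in_keys_iff)

lemma lookup_single_mult_nat:
  fixes f :: "nat \<Rightarrow>\<^sub>0 'a::ring_1"
  shows "Poly_Mapping.lookup (Poly_Mapping.single j a * f) i
    = (if j \<le> i then a * Poly_Mapping.lookup f (i - j) else 0)"
    and "Poly_Mapping.lookup (f * Poly_Mapping.single j a) i
    = (if j \<le> i then Poly_Mapping.lookup f (i - j) * a else 0)"
proof -
  have "j + k = i \<longleftrightarrow> j \<le> i \<and> k = i - j" "k + j = i \<longleftrightarrow> j \<le> i \<and> k = i - j" for k by auto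
  then show "Poly_Mapping.lookup (Poly_Mapping.single j a * f) i
      = (if j \<le> i then a * Poly_Mapping.lookup f (i - j) else 0)"
    "Poly_Mapping.lookup (f * Poly_Mapping.single j a) i
      = (if j \<le> i then Poly_Mapping.lookup f (i - j) * a else 0)"
    by (subst poly_expand[of f]; auto simp: sum_distrib_left sum_distrib_right mult_single lookup_sum
        lookup_single when_def in_keys_iff)+
qed

lemma euler_mult_linear:
  fixes x y :: "'a::ring_1" and f
  defines "z \<equiv> Poly_Mapping.single (Suc 0) x + Poly_Mapping.single 0 y"
  shows "euler (z * f) = Poly_Mapping.single (Suc 0) x * f + z * euler f"
proof (rule poly_mapping_eqI)
  fix i
  have c: "of_nat n * (a * b) = a * (of_nat n * b)" for n and a b :: 'a
    by (metis mult.assoc mult_of_nat_commute)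
  show "Poly_Mapping.lookup (euler (z * f)) i
      = Poly_Mapping.lookup (Poly_Mapping.single (Suc 0) x * f + z * euler f) i"
    unfolding z_def
    by (cases i) (simp_all add: lookup_euler lookup_add distrib_right distrib_left
        lookup_single_mult_nat c del: of_nat_Suc, simp add: distrib_right distrib_left c)
qed

lemma euler_power_linear:
  fixes x y :: "'a::ring_1"
  defines "z \<equiv> Poly_Mapping.single (Suc 0) x + Poly_Mapping.single 0 y"
  shows "euler (z ^ m) = (\<Sum>j<m. z ^ j * Poly_Mapping.single (Suc 0) x * z ^ (m - 1 - j))"
proof (induction m)
  case 0
  then show ?case
    by (auto intro!: poly_mapping_eqI simp: lookup_euler lookup_one when_def)
next
  case (Suc m)
  have "euler (z ^ Suc m) = Poly_Mapping.single (Suc 0) x * z ^ m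
      + (\<Sum>j<m. z ^ Suc j * Poly_Mapping.single (Suc 0) x * z ^ (m - 1 - j))"
    using Suc euler_mult_linear[of x y "z ^ m"] by (simp add: z_def[symmetric] sum_distrib_left mult.assoc)
  also have "\<dots> = (\<Sum>j<Suc m. z ^ j * Poly_Mapping.single (Suc 0) x * z ^ (Suc m - 1 - j))"
    by (subst sum.lessThan_Suc_shift) simp
  finally show ?case .
qed

lemma lookup_power_linear:
  fixes x y :: "'a::ring_1"
  defines "z \<equiv> Poly_Mapping.single (Suc 0) x + Poly_Mapping.single 0 y"
  shows "Poly_Mapping.lookup (z ^ m) 0 = y ^ m" "Poly_Mapping.lookup (z ^ m) m = x ^ m"
    "\<And>i. m < i \<Longrightarrow> Poly_Mapping.lookup (z ^ m) i = 0"
    "(\<Sum>i\<le>m. Poly_Mapping.lookup (z ^ m) i) = (x + y) ^ m"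
proof (induction m)
  case (Suc m)
  have z: "Poly_Mapping.lookup (z ^ Suc m) i
      = (if 1 \<le> i then x * Poly_Mapping.lookup (z ^ m) (i - 1) else 0) + y * Poly_Mapping.lookup (z ^ m) i" for i
    by (simp add: z_def lookup_add distrib_right lookup_single_mult_nat)
  show "Poly_Mapping.lookup (z ^ Suc m) 0 = y ^ Suc m" using Suc unfolding z by simp
  show "Poly_Mapping.lookup (z ^ Suc m) (Suc m) = x ^ Suc m" using Suc unfolding z by simp
  show "Poly_Mapping.lookup (z ^ Suc m) i = 0" if "Suc m < i" for i using Suc(3) that unfolding z by simp
  have "(\<Sum>i\<le>Suc m. Poly_Mapping.lookup (z ^ Suc m) i)
      = (\<Sum>i\<le>m. x * Poly_Mapping.lookup (z ^ m) i) + (\<Sum>i\<le>Suc m. y * Poly_Mapping.lookup (z ^ m) i)"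
    unfolding z sum.distrib by (subst sum.atMost_Suc_shift) simp
  also have "\<dots> = (x + y) ^ Suc m"
    using Suc(3)[of "Suc m"] by (simp add: sum_distrib_left[symmetric] Suc(4) distrib_right)
  finally show "(\<Sum>i\<le>Suc m. Poly_Mapping.lookup (z ^ Suc m) i) = (x + y) ^ Suc m" .
qed (auto simp: lookup_one when_def)

text \<open>The coefficient \<open>s\<close> of \<open>t\<^sup>i\<close> in \<open>(t x + y)\<^sup>p\<close> satisfies \<open>i s \<in> Z (r p)\<close>, because applying \<open>t d/dt\<close>
  to the power gives \<open>ad(t x + y)\<^sup>p\<^sup>-\<^sup>1(t x)\<close>.  For \<open>0 < i < p\<close> the factor \<open>i\<close> is cancelled by a multiple of
  it that is 1 modulo \<open>p\<close>.\<close>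

lemma jacobson_formula:
  fixes Z :: "nat \<Rightarrow> 'a::ring_1 set"
  assumes p: "prime p" and char: "of_nat p = (0 :: 'a)" and r: "r \<ge> 1"
    and zero: "\<And>r. r \<ge> 1 \<Longrightarrow> 0 \<in> Z r"
    and add: "\<And>r x y. r \<ge> 1 \<Longrightarrow> x \<in> Z r \<Longrightarrow> y \<in> Z r \<Longrightarrow> x + y \<in> Z r"
    and brk: "\<And>r s x y. r \<ge> 1 \<Longrightarrow> s \<ge> 1 \<Longrightarrow> x \<in> Z r \<Longrightarrow> y \<in> Z s \<Longrightarrow> x * y - y * x \<in> Z (r + s)"
    and x: "x \<in> Z r" and y: "y \<in> Z r"
  shows "(x + y) ^ p - x ^ p - y ^ p \<in> Z (r * p)"
proof -
  define z where "z = Poly_Mapping.single (Suc 0) x + Poly_Mapping.single (0::nat) y"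
  let ?ad = "\<lambda>w. z * w - w * z"
  have ad: "Poly_Mapping.lookup ((?ad ^^ m) (Poly_Mapping.single (Suc 0) x)) i \<in> Z (r * Suc m)" for m i
  proof (induction m arbitrary: i)
    case 0
    then show ?case using x zero r by (simp add: lookup_single when_def)
  next
    case (Suc m)
    define w where "w = (?ad ^^ m) (Poly_Mapping.single (Suc 0) x)"
    have w: "Poly_Mapping.lookup w i \<in> Z (r * Suc m)" for i using Suc unfolding w_def by blast
    have rs: "r + r * Suc m = r * Suc (Suc m)" "r * Suc m \<ge> 1" "r * Suc (Suc m) \<ge> 1" using r by auto
    have 1: "a * Poly_Mapping.lookup w j - Poly_Mapping.lookup w j * a \<in> Z (r * Suc (Suc m))"
      if "a \<in> Z r" for a j
      using brk[OF r rs(2) that w[of j]] rs by simp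
    have "Poly_Mapping.lookup (?ad w) i
      = (if 1 \<le> i then x * Poly_Mapping.lookup w (i - 1) - Poly_Mapping.lookup w (i - 1) * x else 0)
        + (y * Poly_Mapping.lookup w i - Poly_Mapping.lookup w i * y)"
      by (simp add: z_def lookup_add lookup_minus distrib_left distrib_right lookup_single_mult_nat)
    also have "\<dots> \<in> Z (r * Suc (Suc m))"
      using 1[OF x] 1[OF y] zero add rs(3) by auto
    finally show ?case by (simp add: w_def)
  qed
  have pos: "r * p \<ge> 1" using r prime_ge_1_nat[OF p] by simp
  have charB: "of_nat p = (0 :: nat \<Rightarrow>\<^sub>0 'a)"
    using char by (simp flip: single_of_nat)
  have i: "of_nat i * Poly_Mapping.lookup (z ^ p) i \<in> Z (r * p)" for i
  proof -
    have "euler (z ^ p) = (?ad ^^ (p - 1)) (Poly_Mapping.single (Suc 0) x)"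
      unfolding ad_funpow_char_p[OF p charB] unfolding z_def by (rule euler_power_linear)
    then show ?thesis
      using ad[of "p - 1" i] prime_ge_1_nat[OF p] by (simp flip: lookup_euler)
  qed
  have mult: "of_nat n * a \<in> Z (r * p)" if "a \<in> Z (r * p)" for n a
    by (induction n) (auto simp: zero[OF pos] distrib_right intro: add[OF pos] that)
  have mid: "Poly_Mapping.lookup (z ^ p) i \<in> Z (r * p)" if "0 < i" "i < p" for i
  proof -
    have "coprime i p" using that p by (metis coprime_commute prime_imp_coprime nat_dvd_not_less)
    then obtain u where u: "[i * u = 1] (mod p)" using cong_solve_coprime_nat[of i p] by auto
    then have "i * u mod p = 1" using p prime_gt_1_nat[of p] by (simp add: cong_def)
    then have "i * u = 1 + p * (i * u div p)" using mult_div_mod_eq[of p "i * u"] by simp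
    then have "of_nat (u * i) = (1 + of_nat p * of_nat (i * u div p) :: 'a)"
      by (simp add: mult.commute flip: of_nat_mult of_nat_Suc)
    then have "of_nat u * of_nat i = (1 :: 'a)" using char by simp
    then have "Poly_Mapping.lookup (z ^ p) i = of_nat u * (of_nat i * Poly_Mapping.lookup (z ^ p) i)"
      by (simp add: mult.assoc[symmetric])
    then show ?thesis using mult[OF i, of u i] by simp
  qed
  have "(x + y) ^ p = (\<Sum>i\<le>p. Poly_Mapping.lookup (z ^ p) i)"
    by (simp add: lookup_power_linear(4) z_def)
  also have "{..p} = insert 0 (insert p {0<..<p})" using p prime_gt_0_nat[of p] by auto
  also have "(\<Sum>i\<in>\<dots>. Poly_Mapping.lookup (z ^ p) i) = y ^ p + (x ^ p + (\<Sum>i\<in>{0<..<p}. Poly_Mapping.lookup (z ^ p) i))"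
    using p prime_gt_0_nat[of p] by (simp add: lookup_power_linear(1,2) z_def)
  finally have "(x + y) ^ p - x ^ p - y ^ p = (\<Sum>i\<in>{0<..<p}. Poly_Mapping.lookup (z ^ p) i)" by simp
  moreover have "(\<Sum>i\<in>A. Poly_Mapping.lookup (z ^ p) i) \<in> Z (r * p)" if "finite A" "A \<subseteq> {0<..<p}" for A
    using that by (induction A rule: finite_induct) (auto simp: zero[OF pos] intro: add[OF pos] mid)
  ultimately show ?thesis by simp
qed

section \<open>Graded restricted Lie subalgebras and ordered monomials\<close>

text \<open>The quotients \<open>Z r / J\<^sup>r\<^sup>+\<^sup>1\<close> form a restricted Lie subalgebra of the associated graded algebra
  \<open>gr kG\<close> that contains its degree-1 part, by which \<open>gr kG\<close> is generated.  Such a family is lifted to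
  subspaces of \<open>kG\<close> in order to calculate in \<open>kG\<close> modulo higher powers of the radical.\<close>

locale lie_system = modular_p_group p k_type g_type
  for p :: nat and k_type :: "'k::field itself" and g_type :: "'g::{finite,group_add} itself" +
  fixes Z :: "nat \<Rightarrow> ('g \<Rightarrow>\<^sub>0 'k) set"
  assumes Z_subspace: "r \<ge> 1 \<Longrightarrow> ga.subspace (Z r)"
    and Z_subset: "r \<ge> 1 \<Longrightarrow> Z r \<subseteq> JP r"
    and Z_superset: "r \<ge> 1 \<Longrightarrow> JP (Suc r) \<subseteq> Z r"
    and Z_1: "aug_I \<subseteq> Z 1"
    and Z_bracket: "r \<ge> 1 \<Longrightarrow> s \<ge> 1 \<Longrightarrow> x \<in> Z r \<Longrightarrow> y \<in> Z s \<Longrightarrow> x * y - y * x \<in> Z (r + s)"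
    and Z_power: "r \<ge> 1 \<Longrightarrow> x \<in> Z r \<Longrightarrow> x ^ p \<in> Z (r * p)"
begin

text \<open>The first index of a word is its weight, the second its length.\<close>

inductive word :: "nat \<Rightarrow> nat \<Rightarrow> ('g \<Rightarrow>\<^sub>0 'k) \<Rightarrow> bool"
  where
    word_1: "word 0 0 1"
  | word_Cons: "r \<ge> 1 \<Longrightarrow> a \<in> Z r \<Longrightarrow> word w l x \<Longrightarrow> word (r + w) (Suc l) (a * x)"

text \<open>These subspaces form the length filtration in weight \<open>w\<close>.  The bound on the length is strict so that
  \<open>V w 0\<close> is \<open>J\<^sup>w\<^sup>+\<^sup>1\<close>: a congruence modulo shorter words then makes sense for the empty word as well.\<close>

definition V :: "nat \<Rightarrow> nat \<Rightarrow> ('g \<Rightarrow>\<^sub>0 'k) set"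
  where "V w l = ga.span ({x. \<exists>m<l. word w m x} \<union> JP (Suc w))"

lemma V_subspace: "ga.subspace (V w l)"
  by (simp add: V_def)

lemma V_add: "x \<in> V w l \<Longrightarrow> y \<in> V w l \<Longrightarrow> x + y \<in> V w l"
  using V_subspace by (rule ga.subspace_add)

lemma word_JP: "word w l x \<Longrightarrow> x \<in> JP w"
proof (induction rule: word.induct)
  case (word_Cons r a w l x)
  then show ?case using Z_subset JP_mult by blast
qed simp

lemma word_letter: "r \<ge> 1 \<Longrightarrow> a \<in> Z r \<Longrightarrow> word r (Suc 0) a"
  using word_Cons[OF _ _ word_1, of r a] by simp

lemma word_mult: "word w l x \<Longrightarrow> word w' l' y \<Longrightarrow> word (w + w') (l + l') (x * y)"
proof (induction rule: word.induct)
  case (word_Cons r a w l x)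
  then show ?case using word.word_Cons[of r a "w + w'" "l + l'" "x * y"] by (simp add: mult.assoc add.assoc)
qed simp

lemma word_power:
  assumes "r \<ge> 1" "a \<in> Z r" shows "word (r * m) m (a ^ m)"
  by (induction m) (use word_1 word_Cons[OF assms] in simp_all)

lemma word_V: "word w m x \<Longrightarrow> m < l \<Longrightarrow> x \<in> V w l"
  unfolding V_def by (rule ga.span_base) auto

lemma JP_V: "x \<in> JP (Suc w) \<Longrightarrow> x \<in> V w l"
  unfolding V_def by (rule ga.span_base) auto

lemma V_mult_aux:
  assumes "x \<in> V w l" "y \<in> V w' l'" and n: "\<And>m m'. m < l \<Longrightarrow> m' < l' \<Longrightarrow> m + m' < n"
  shows "x * y \<in> V (w + w') n"
  using assms(1,2) unfolding V_def[of w l] V_def[of w' l']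
proof (rule span_mult)
  fix s t
  assume s: "s \<in> {x. \<exists>m<l. word w m x} \<union> JP (Suc w)"
    and t: "t \<in> {x. \<exists>m<l'. word w' m x} \<union> JP (Suc w')"
  have sw: "s \<in> JP w" "t \<in> JP w'" using s t word_JP JP_Suc_le by blast+
  show "s * t \<in> V (w + w') n"
  proof (cases "s \<in> JP (Suc w) \<or> t \<in> JP (Suc w')")
    case True
    then have "s * t \<in> JP (Suc (w + w'))"
      using sw JP_mult[of s "Suc w" t w'] JP_mult[of s w t "Suc w'"] by auto
    then show ?thesis by (rule JP_V)
  next
    case False
    then obtain m m' where "m < l" "m' < l'" "word w m s" "word w' m' t" using s t by auto
    then show ?thesis using word_mult word_V n by blast
  qed
qed (rule V_subspace)

lemma V_mult: "x \<in> V w (Suc l) \<Longrightarrow> y \<in> V w' l' \<Longrightarrow> x * y \<in> V (w + w') (l + l')"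
  by (erule V_mult_aux) auto

lemma V_mult': "x \<in> V w l \<Longrightarrow> y \<in> V w' (Suc l') \<Longrightarrow> x * y \<in> V (w + w') (l + l')"
  by (erule V_mult_aux) auto

text \<open>Two letters are interchanged at the cost of their commutator, which is a single letter of the same
  total weight, so the word becomes shorter.\<close>

lemma letter_commutator:
  assumes a: "r \<ge> 1" "a \<in> Z r" and "word w l y"
  shows "a * y - y * a \<in> V (r + w) (Suc l)"
  using assms(3)
proof (induction rule: word.induct)
  case word_1
  then show ?case by (simp add: ga.subspace_0 V_subspace)
next
  case (word_Cons s b w l y)
  have "word (r + s + w) (Suc l) ((a * b - b * a) * y)"
    using Z_bracket[OF a(1) word_Cons(1) a(2) word_Cons(2)] word_Cons a by (intro word.word_Cons) auto
  then have "(a * b - b * a) * y \<in> V (r + (s + w)) (Suc (Suc l))"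
    using word_V by (simp add: add.assoc)
  moreover have "b * (a * y - y * a) \<in> V (s + (r + w)) (Suc 0 + Suc l)"
    by (rule V_mult[OF word_V[OF word_letter[OF word_Cons(1,2)]] word_Cons.IH]) simp
  ultimately have "(a * b - b * a) * y + b * (a * y - y * a) \<in> V (r + (s + w)) (Suc (Suc l))"
    by (intro V_add) (simp_all add: ac_simps)
  then show ?case by (simp add: algebra_simps)
qed

text \<open>A product of \<open>w\<close> elements of the radical is a word of weight and length \<open>w\<close>, since the letters of weight
  1 are all of the radical.\<close>

lemma JP_subset_V: "JP w \<subseteq> V w (Suc w)"
proof (induction w)
  case 0
  have "x \<in> V 0 (Suc 0)" for x
  proof -
    have "x - ga_scale (aug x) 1 \<in> JP (Suc 0)" by (simp add: JP_1 aug_ideal_def aug_diff aug_scale)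
    then have "x - ga_scale (aug x) 1 \<in> V 0 (Suc 0)" by (rule JP_V)
    moreover have "ga_scale (aug x) 1 \<in> V 0 (Suc 0)"
      using word_V[OF word_1] V_subspace ga.subspace_scale by blast
    ultimately show ?thesis using V_subspace ga.subspace_add[of "V 0 (Suc 0)" "x - ga_scale (aug x) 1"] by force
  qed
  then show ?case by auto
next
  case (Suc w)
  show ?case
  proof (rule JP_Suc_subset)
    fix x y assume "x \<in> JP w" "y \<in> aug_I"
    then have "x \<in> V w (Suc w)" "y \<in> V 1 (Suc 1)"
      using Suc Z_1 word_letter[of 1 y] word_V[of 1 "Suc 0" y] by auto
    from V_mult[OF this] show "x * y \<in> V (Suc w) (Suc (Suc w))" by simp
  qed (simp add: subspace_add_subgroup V_subspace)
qed

lemma word_prod_list: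
  assumes "\<And>j. j \<in> set js \<Longrightarrow> wt j \<ge> 1 \<and> b j \<in> Z (wt j)"
  shows "word (sum_list (map wt js)) (length js) (prod_list (map b js))"
  using assms by (induction js) (auto intro: word_1 word_Cons)

lemma word_prod_powers:
  assumes "\<And>j. j \<in> set js \<Longrightarrow> wt j \<ge> 1 \<and> b j \<in> Z (wt j)"
  shows "word (sum_list (map (\<lambda>j. wt j * e j) js)) (sum_list (map e js))
    (prod_list (map (\<lambda>j. b j ^ e j) js))"
  using assms
proof (induction js)
  case (Cons a js)
  then show ?case using word_mult[OF word_power[of "wt a" "b a" "e a"] Cons.IH] by simp
qed (simp add: word_1)

text \<open>Moving a letter to the front past a word costs only shorter words, and so does any reordering.\<close>

lemma prod_list_perm:
  assumes "\<And>j. j \<in> set js \<Longrightarrow> wt j \<ge> 1 \<and> b j \<in> Z (wt j)" and "mset js = mset js'"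
  shows "prod_list (map b js) - prod_list (map b js') \<in> V (sum_list (map wt js)) (length js)"
  using assms
proof (induction js arbitrary: js')
  case Nil
  then show ?case by (simp add: ga.subspace_0 V_subspace)
next
  case (Cons j js)
  have "j \<in> set js'" using Cons.prems(2) by (metis list.set_intros(1) set_mset_mset)
  then obtain us vs where js': "js' = us @ j # vs" by (meson split_list)
  then have ms: "mset js = mset (us @ vs)" using Cons.prems(2) by simp
  then have set: "set js = set us \<union> set vs" by (metis set_append set_mset_mset)
  have IH: "prod_list (map b js) - prod_list (map b (us @ vs)) \<in> V (sum_list (map wt js)) (length js)"
    by (rule Cons.IH) (use Cons.prems(1) ms in auto)
  have j: "wt j \<ge> 1" "b j \<in> Z (wt j)" using Cons.prems(1) by auto
  have wu: "word (sum_list (map wt us)) (length us) (prod_list (map b us))"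
    and wv: "word (sum_list (map wt vs)) (length vs) (prod_list (map b vs))"
    using Cons.prems(1) set by (auto intro!: word_prod_list)
  have sums: "sum_list (map wt js) = sum_list (map wt us) + sum_list (map wt vs)"
    "length js = length us + length vs"
    using arg_cong[OF ms, of "\<lambda>M. sum_mset (image_mset wt M)"] arg_cong[OF ms, of size]
    by (simp_all add: sum_mset_sum_list flip: mset_map)
  have "b j * (prod_list (map b js) - prod_list (map b (us @ vs)))
      \<in> V (wt j + sum_list (map wt js)) (Suc 0 + length js)"
    by (rule V_mult[OF word_V[OF word_letter[OF j]] IH]) simp
  moreover have "(b j * prod_list (map b us) - prod_list (map b us) * b j) * prod_list (map b vs)
      \<in> V ((wt j + sum_list (map wt us)) + sum_list (map wt vs)) (Suc (length us) + length vs)"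
    by (rule V_mult'[OF letter_commutator[OF j wu] word_V[OF wv]]) simp
  ultimately have "b j * (prod_list (map b js) - prod_list (map b (us @ vs)))
      + (b j * prod_list (map b us) - prod_list (map b us) * b j) * prod_list (map b vs)
      \<in> V (sum_list (map wt (j # js))) (length (j # js))"
    by (intro V_add) (simp_all add: sums ac_simps)
  then show ?case by (simp add: js' algebra_simps)
qed

lemma power_V_short:
  assumes "r \<ge> 1" "a \<in> Z r" "c \<ge> p" shows "a ^ c \<in> V (r * c) c"
proof -
  have "word (r * p + r * (c - p)) (Suc 0 + (c - p)) (a ^ p * a ^ (c - p))"
    using assms Z_power prime_gt_0_nat[OF p_prime]
    by (intro word_mult word_letter word_power) auto
  moreover have "r * p + r * (c - p) = r * c" using assms by (simp add: distrib_left[symmetric])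
  moreover have "a ^ p * a ^ (c - p) = a ^ c" using assms by (simp add: power_add[symmetric])
  ultimately have "word (r * c) (Suc (c - p)) (a ^ c)" by simp
  then show ?thesis by (rule word_V) (use assms prime_gt_1_nat[OF p_prime] in auto)
qed

end

text \<open>The Poincare--Birkhoff--Witt situation: homogeneous elements \<open>b i\<close> that span every \<open>Z r\<close> modulo
  \<open>J\<^sup>r\<^sup>+\<^sup>1\<close>, in a fixed order.  That no monomial is superfluous comes out of counting, once
  the number of ordered monomials is the order of the group.\<close>

locale pbw_basis = lie_system p k_type g_type Z
  for p :: nat and k_type :: "'k::field itself" and g_type :: "'g::{finite,group_add} itself"
    and Z :: "nat \<Rightarrow> ('g \<Rightarrow>\<^sub>0 'k) set" +
  fixes "is" :: "'i list" and wt :: "'i \<Rightarrow> nat" and b :: "'i \<Rightarrow> ('g \<Rightarrow>\<^sub>0 'k)"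
  assumes is_distinct: "distinct is"
    and wt_pos: "i \<in> set is \<Longrightarrow> wt i \<ge> 1"
    and b_Z: "i \<in> set is \<Longrightarrow> b i \<in> Z (wt i)"
    and Z_span: "r \<ge> 1 \<Longrightarrow> Z r \<subseteq> ga.span (b ` {i \<in> set is. wt i = r} \<union> JP (Suc r))"
begin

definition mon :: "('i \<Rightarrow> nat) \<Rightarrow> ('g \<Rightarrow>\<^sub>0 'k)"
  where "mon e = prod_list (map (\<lambda>i. b i ^ e i) is)"

definition mon_wt :: "('i \<Rightarrow> nat) \<Rightarrow> nat"
  where "mon_wt e = sum_list (map (\<lambda>i. wt i * e i) is)"

definition mon_len :: "('i \<Rightarrow> nat) \<Rightarrow> nat"
  where "mon_len e = sum_list (map e is)"

definition exps :: "('i \<Rightarrow> nat) set"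
  where "exps = {e. \<forall>i\<in>set is. e i < p}"

definition M :: "nat \<Rightarrow> nat \<Rightarrow> ('g \<Rightarrow>\<^sub>0 'k) set"
  where "M w l = ga.span (mon ` {e \<in> exps. mon_wt e = w \<and> mon_len e < l} \<union> JP (Suc w))"

lemma M_mono: "l \<le> l' \<Longrightarrow> M w l \<subseteq> M w l'"
  unfolding M_def by (rule ga.span_mono) auto

lemma word_span_letters:
  "word w l x \<Longrightarrow>
    x \<in> ga.span ({prod_list (map b js) | js. set js \<subseteq> set is \<and> length js = l \<and> sum_list (map wt js) = w}
      \<union> JP (Suc w))"
proof (induction rule: word.induct)
  case word_1
  then show ?case by (intro ga.span_base) auto
next
  case (word_Cons r a w l x)
  let ?G = "\<lambda>w l. {prod_list (map b js) | js. set js \<subseteq> set is \<and> length js = l \<and> sum_list (map wt js) = w}"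
  have "a \<in> ga.span (b ` {i \<in> set is. wt i = r} \<union> JP (Suc r))" using word_Cons Z_span by blast
  then show ?case using word_Cons.IH
  proof (rule span_mult)
    fix s t assume s: "s \<in> b ` {i \<in> set is. wt i = r} \<union> JP (Suc r)" and t: "t \<in> ?G w l \<union> JP (Suc w)"
    have sJ: "s \<in> JP r" using s b_Z Z_subset word_Cons(1) JP_Suc_le by fastforce
    have "t \<in> JP w" if "t \<in> ?G w l"
    proof -
      obtain js where js: "t = prod_list (map b js)" "set js \<subseteq> set is" "sum_list (map wt js) = w"
        using \<open>t \<in> ?G w l\<close> by auto
      have "word (sum_list (map wt js)) (length js) (prod_list (map b js))"
        by (rule word_prod_list) (use js wt_pos b_Z in auto)
      then show ?thesis using js word_JP by blast
    qed
    then have tJ: "t \<in> JP w" using t JP_Suc_le by blast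
    show "s * t \<in> ga.span (?G (r + w) (Suc l) \<union> JP (Suc (r + w)))"
    proof (cases "s \<in> JP (Suc r) \<or> t \<in> JP (Suc w)")
      case True
      then have "s * t \<in> JP (Suc (r + w))"
        using sJ tJ JP_mult[of s "Suc r" t w] JP_mult[of s r t "Suc w"] by auto
      then show ?thesis by (intro ga.span_base) auto
    next
      case False
      then obtain i js where "s = b i" "i \<in> set is" "wt i = r" "t = prod_list (map b js)"
          "set js \<subseteq> set is" "length js = l" "sum_list (map wt js) = w"
        using s t by auto
      then have "s * t \<in> ?G (r + w) (Suc l)"
        by (auto intro!: exI[of _ "i # js"])
      then show ?thesis by (intro ga.span_base) auto
    qed
  qed simp
qed

text \<open>Collection: sort the letters of a word, at the cost of shorter words, and replace \<open>p\<close> equal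
  letters by one letter, which is again shorter.\<close>

lemma V_subset_M: "V w l \<subseteq> M w l"
proof (induction l)
  case 0
  then show ?case by (auto simp: V_def M_def intro: ga.span_mono[THEN subsetD])
next
  case (Suc l)
  have VM: "V w l \<subseteq> M w (Suc l)" using Suc M_mono[of l "Suc l"] by auto
  have sub: "ga.subspace (M w (Suc l))" by (simp add: M_def)
  have JM: "JP (Suc w) \<subseteq> M w (Suc l)" unfolding M_def using ga.span_superset by blast
  have js: "prod_list (map b js) \<in> M w (Suc l)"
    if js: "set js \<subseteq> set is" "length js = l" "sum_list (map wt js) = w" for js
  proof -
    define e where "e = count_list js"
    define ks where "ks = concat (map (\<lambda>i. replicate (e i) i) is)"
    have ms: "mset js = mset ks"
    proof (rule multiset_eqI)
      fix i
      have "count (mset (concat (map (\<lambda>i. replicate (e i) i) us))) i = (if i \<in> set us then e i else 0)"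
        if "distinct us" for us using that by (induction us) auto
      moreover have "i \<notin> set is \<Longrightarrow> count_list js i = 0" using js(1) by (auto simp: count_list_0_iff)
      ultimately show "count (mset js) i = count (mset ks) i"
        using is_distinct by (auto simp: ks_def e_def count_mset)
    qed
    have "prod_list (map b (concat (map (\<lambda>i. replicate (e i) i) us))) = prod_list (map (\<lambda>i. b i ^ e i) us)" for us
      by (induction us) auto
    then have mon: "prod_list (map b ks) = mon e" by (simp add: ks_def mon_def)
    have "sum_list (map wt (concat (map (\<lambda>i. replicate (e i) i) us))) = sum_list (map (\<lambda>i. wt i * e i) us)" for us
      by (induction us) (auto simp: sum_list_replicate)
    then have "sum_list (map wt ks) = mon_wt e" by (simp add: ks_def mon_wt_def)
    then have w: "mon_wt e = w"
      using js arg_cong[OF ms, of "\<lambda>M. sum_mset (image_mset wt M)"]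
      by (simp add: sum_mset_sum_list flip: mset_map)
    have "length (concat (map (\<lambda>i. replicate (e i) i) us)) = sum_list (map e us)" for us
      by (induction us) auto
    then have l: "mon_len e = l" using js arg_cong[OF ms, of size] by (simp add: ks_def mon_len_def)
    have "prod_list (map b js) - mon e \<in> V w l"
      using prod_list_perm[of js wt b ks] js wt_pos b_Z ms mon by auto
    moreover have "mon e \<in> M w (Suc l)"
    proof (cases "e \<in> exps")
      case True
      then show ?thesis unfolding M_def using w l by (intro ga.span_base) auto
    next
      case False
      then obtain i where i: "i \<in> set is" "e i \<ge> p" by (auto simp: exps_def not_less)
      then obtain us vs where us: "is = us @ i # vs" by (meson split_list)
      have "word (sum_list (map (\<lambda>j. wt j * e j) us)) (sum_list (map e us)) (prod_list (map (\<lambda>j. b j ^ e j) us))"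
        "word (sum_list (map (\<lambda>j. wt j * e j) vs)) (sum_list (map e vs)) (prod_list (map (\<lambda>j. b j ^ e j) vs))"
        using wt_pos b_Z us by (auto intro!: word_prod_powers)
      note wv = word_V[OF this(1) lessI] word_V[OF this(2) lessI]
      have "b i ^ e i \<in> V (wt i * e i) (e i)" using power_V_short wt_pos b_Z i by blast
      from V_mult'[OF V_mult[OF wv(1) this] wv(2)] have "mon e \<in> V (mon_wt e) (mon_len e)"
        unfolding mon_def mon_wt_def mon_len_def unfolding us by (simp add: mult.assoc add.assoc)
      then show ?thesis using VM w l by auto
    qed
    ultimately show ?thesis using VM sub ga.subspace_add[of "M w (Suc l)" "prod_list (map b js) - mon e"] by fastforce
  qed
  have "x \<in> M w (Suc l)" if "word w m x" "m < Suc l" for m x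
  proof (cases "m < l")
    case True
    then show ?thesis using word_V[OF that(1)] VM by blast
  next
    case False
    then have "word w l x" using that by (simp add: less_Suc_eq)
    then have "x \<in> ga.span ({prod_list (map b js) | js. set js \<subseteq> set is \<and> length js = l \<and> sum_list (map wt js) = w}
      \<union> JP (Suc w))" by (rule word_span_letters)
    also have "\<dots> \<subseteq> M w (Suc l)" by (rule ga.span_minimal) (use js JM sub in auto)
    finally show ?thesis .
  qed
  then show ?case unfolding V_def using JM sub by (intro ga.span_minimal) auto
qed

text \<open>The error terms of higher weight are expanded in turn; this ends because the radical is
  nilpotent.\<close>

lemma JP_span_mon: "JP w \<subseteq> ga.span (mon ` {e \<in> exps. mon_wt e \<ge> w})"
proof (induction "nil_index - w" arbitrary: w)
  case 0
  then show ?case using JP_eventually_0 JP_anti[of nil_index w] ga.span_zero by auto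
next
  case (Suc n)
  have "JP (Suc w) \<subseteq> ga.span (mon ` {e \<in> exps. mon_wt e \<ge> Suc w})" using Suc(1)[of "Suc w"] Suc(2) by simp
  also have "\<dots> \<subseteq> ga.span (mon ` {e \<in> exps. mon_wt e \<ge> w})" by (rule ga.span_mono) auto
  finally have 1: "JP (Suc w) \<subseteq> ga.span (mon ` {e \<in> exps. mon_wt e \<ge> w})" .
  have "JP w \<subseteq> M w (Suc w)" using JP_subset_V V_subset_M by blast
  also have "\<dots> \<subseteq> ga.span (mon ` {e \<in> exps. mon_wt e \<ge> w})"
    unfolding M_def by (rule ga.span_minimal) (use 1 in \<open>auto intro: ga.span_base\<close>)
  finally show ?case .
qed

lemma mon_PiE: "mon ` exps = mon ` (Pi\<^sub>E (set is) (\<lambda>_. {..<p}))"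
proof (intro equalityI subsetI)
  fix x assume "x \<in> mon ` exps"
  then obtain e where e: "e \<in> exps" "x = mon e" by auto
  have "mon (restrict e (set is)) = mon e" unfolding mon_def by (intro arg_cong[of _ _ prod_list] map_cong) auto
  then show "x \<in> mon ` (Pi\<^sub>E (set is) (\<lambda>_. {..<p}))"
    using e by (intro image_eqI[of _ _ "restrict e (set is)"]) (auto simp: exps_def)
qed (auto simp: exps_def PiE_iff)

lemma card_exps: "card (Pi\<^sub>E (set is) (\<lambda>_. {..<p})) = p ^ length is"
  by (simp add: card_PiE distinct_card[OF is_distinct])

lemma mon_span: "ga.span (mon ` exps) = UNIV"
  using JP_span_mon[of 0] by auto

lemma card_le_pbw: "card (UNIV :: 'g set) \<le> p ^ length is"
proof -
  have "card (UNIV :: 'g set) \<le> card (mon ` exps)"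
    unfolding ga_dim_UNIV[where 'k='k, symmetric]
    by (rule ga.dim_le_card) (use mon_span mon_PiE in \<open>auto simp: finite_PiE\<close>)
  also have "\<dots> \<le> p ^ length is" unfolding mon_PiE card_exps[symmetric] by (rule card_image_le) (simp add: finite_PiE)
  finally show ?thesis .
qed

text \<open>If the exponent vectors are as many as the group elements, no monomial can be left out of the
  spanning set.\<close>

lemma top_mon_neq_0:
  assumes card: "card (UNIV :: 'g set) = p ^ length is" shows "mon (\<lambda>_. p - 1) \<noteq> 0"
proof
  let ?P = "Pi\<^sub>E (set is) (\<lambda>_. {..<p})"
  let ?e = "restrict (\<lambda>_. p - 1) (set is)"
  assume 0: "mon (\<lambda>_. p - 1) = 0"
  have e: "?e \<in> ?P" using prime_gt_0_nat[OF p_prime] by auto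
  have fin: "finite ?P" by (simp add: finite_PiE)
  have "mon ?e = mon (\<lambda>_. p - 1)" unfolding mon_def by (intro arg_cong[of _ _ prod_list] map_cong) auto
  then have "mon ` ?P \<subseteq> insert 0 (mon ` (?P - {?e}))" using 0 by auto
  then have "ga.span (mon ` ?P) \<subseteq> ga.span (mon ` (?P - {?e}))"
    by (metis ga.span_insert_0 ga.span_mono)
  then have "UNIV \<subseteq> ga.span (mon ` (?P - {?e}))" using mon_span mon_PiE by simp
  then have "card (UNIV :: 'g set) \<le> card (mon ` (?P - {?e}))"
    unfolding ga_dim_UNIV[where 'k='k, symmetric] by (rule ga.dim_le_card) (simp add: fin)
  also have "\<dots> \<le> card (?P - {?e})" by (rule card_image_le) (simp add: fin)
  also have "\<dots> < card ?P" using e fin by (meson card_Diff1_less)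
  finally show False using card card_exps by simp
qed

definition top_wt :: nat
  where "top_wt = (p - 1) * sum_list (map wt is)"

lemma mon_wt_le_top: "e \<in> exps \<Longrightarrow> mon_wt e \<le> top_wt"
  unfolding mon_wt_def top_wt_def sum_list_const_mult[symmetric]
  by (rule sum_list_mono) (auto simp: exps_def mult.commute)

lemma JP_above_top: "JP (Suc top_wt) = {0}"
proof -
  have "{e \<in> exps. mon_wt e \<ge> Suc top_wt} = {}" using mon_wt_le_top by fastforce
  then have "JP (Suc top_wt) \<subseteq> {0}"
    using JP_span_mon[of "Suc top_wt"] by (simp only: image_empty ga.span_empty)
  then show ?thesis using JP_0 by blast
qed

text \<open>The only monomial of maximal weight is the longest one.\<close>

lemma V_top: "V top_wt (length is * (p - 1)) = {0}"
proof -
  have "mon_len e = length is * (p - 1)" if e: "e \<in> exps" "mon_wt e = top_wt" for e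
  proof -
    have "mon_wt e = (\<Sum>i\<in>set is. wt i * e i)" "top_wt = (\<Sum>i\<in>set is. wt i * (p - 1))"
      using is_distinct by (simp_all add: mon_wt_def top_wt_def sum_list_distinct_conv_sum_set
          sum_distrib_left mult.commute)
    then have eq: "(\<Sum>i\<in>set is. wt i * e i) = (\<Sum>i\<in>set is. wt i * (p - 1))" using e by simp
    have le: "wt i * e i \<le> wt i * (p - 1)" if "i \<in> set is" for i using e that by (auto simp: exps_def)
    have "e i = p - 1" if i: "i \<in> set is" for i
    proof (rule ccontr)
      assume "e i \<noteq> p - 1"
      then have "wt i * e i < wt i * (p - 1)" using e i wt_pos[OF i] by (auto simp: exps_def)
      then have "(\<Sum>i\<in>set is. wt i * e i) < (\<Sum>i\<in>set is. wt i * (p - 1))"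
        using i le by (intro sum_strict_mono_ex1) auto
      then show False using eq by simp
    qed
    then have "map e is = map (\<lambda>_. p - 1) is" by simp
    then have "mon_len e = sum_list (map (\<lambda>_. p - 1) is)" unfolding mon_len_def by (rule arg_cong)
    then show ?thesis by (simp add: sum_list_triv)
  qed
  then have "{e \<in> exps. mon_wt e = top_wt \<and> mon_len e < length is * (p - 1)} = {}" by fastforce
  then have "M top_wt (length is * (p - 1)) \<subseteq> {0}"
    unfolding M_def JP_above_top by (simp only: image_empty Un_empty_left ga.span_insert_0 ga.span_empty)
  then show ?thesis using V_subset_M ga.subspace_0[OF V_subspace] by blast
qed

end

section \<open>Products invariant under transvections\<close>

definition col_mat :: "nat \<Rightarrow> nat \<Rightarrow> (nat \<Rightarrow> 'k::field) \<Rightarrow> 'k mat"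
  where "col_mat d j u = mat d d (\<lambda>(i, m). if m = j then u i else if i = m then 1 else 0)"

lemma col_mat_carrier [simp]: "col_mat d j u \<in> carrier_mat d d"
  by (simp add: col_mat_def)

lemma det_col_mat:
  assumes "j < d" shows "det (col_mat d j u) = u j"
proof -
  have "col_mat d j u = replace_col (1\<^sub>m d) (1\<^sub>m d *\<^sub>v vec d u) j"
    by (rule eq_matI) (auto simp: col_mat_def replace_col_def)
  then show ?thesis
    using cramer_lemma_mat[of "1\<^sub>m d :: 'a mat" d "vec d u" j] assms by simp
qed

definition comb :: "nat \<Rightarrow> (nat \<Rightarrow> ('g::{finite,group_add} \<Rightarrow>\<^sub>0 'k::field)) \<Rightarrow> 'k mat \<Rightarrow> nat \<Rightarrow> ('g \<Rightarrow>\<^sub>0 'k)"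
  where "comb d b A j = (\<Sum>i<d. ga_scale (A $$ (i, j)) (b i))"

lemma comb_mult:
  assumes "A \<in> carrier_mat d d" "B \<in> carrier_mat d d" "j < d"
  shows "comb d b (A * B) j = comb d (comb d b A) B j"
proof -
  have "comb d b (A * B) j = (\<Sum>i<d. \<Sum>k<d. ga_scale (A $$ (i, k) * B $$ (k, j)) (b i))"
    using assms by (simp add: comb_def scalar_prod_def atLeast0LessThan ga.scale_sum_left)
  also have "\<dots> = (\<Sum>k<d. \<Sum>i<d. ga_scale (A $$ (i, k) * B $$ (k, j)) (b i))"
    by (rule sum.swap)
  also have "\<dots> = comb d (comb d b A) B j"
    by (simp add: comb_def ga.scale_sum_right mult.commute)
  finally show ?thesis .
qed

lemma comb_col_mat:
  assumes "j < d" "m < d"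
  shows "comb d b (col_mat d j u) m = (if m = j then \<Sum>i<d. ga_scale (u i) (b i) else b m)"
  using assms by (auto simp: comb_def col_mat_def if_distribR if_distrib[of "\<lambda>c. ga_scale c _"] sum.delta cong: if_cong)

text \<open>A function of \<open>d\<close> vectors that is unchanged by transvections and homogeneous of degree \<open>q\<close> in each
  vector transforms by the \<open>q\<close>-th power of the determinant.  For \<open>q = p - 1\<close> this applies to products
  of \<open>(p - 1)\<close>-st powers.\<close>

locale transvection_invariant =
  fixes d q :: nat and W :: "('g::{finite,group_add} \<Rightarrow>\<^sub>0 'k::field) set"
    and F :: "(nat \<Rightarrow> ('g \<Rightarrow>\<^sub>0 'k)) \<Rightarrow> ('g \<Rightarrow>\<^sub>0 'k)"
  assumes q: "q \<ge> 1" and W: "ga.subspace W"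
    and F_add: "\<And>v i j. \<forall>i<d. v i \<in> W \<Longrightarrow> i < d \<Longrightarrow> j < d \<Longrightarrow> i \<noteq> j \<Longrightarrow> F (v(i := v i + v j)) = F v"
    and F_scale: "\<And>v i c. \<forall>i<d. v i \<in> W \<Longrightarrow> i < d \<Longrightarrow> F (v(i := ga_scale c (v i))) = ga_scale (c ^ q) (F v)"
    and F_cong: "\<And>v v'. \<forall>i<d. v i = v' i \<Longrightarrow> F v = F v'"
begin

lemma comb_W: "\<forall>i<d. b i \<in> W \<Longrightarrow> comb d b A j \<in> W"
  unfolding comb_def using W by (auto intro!: ga.subspace_sum ga.subspace_scale)

text \<open>Rescaling \<open>v j\<close> by \<open>c\<close> multiplies both sides by \<open>c\<^sup>q\<close> and reduces the claim to \<open>c = 1\<close>.\<close>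

lemma F_add_scale:
  assumes v: "\<forall>i<d. v i \<in> W" "i < d" "j < d" "i \<noteq> j"
  shows "F (v(i := v i + ga_scale c (v j))) = F v"
proof (cases "c = 0")
  case False
  let ?v = "v(j := ga_scale c (v j))" and ?w = "v(i := v i + ga_scale c (v j))"
  have W': "\<forall>i<d. ?v i \<in> W" "\<forall>i<d. ?w i \<in> W"
    using v W by (auto simp: ga.subspace_scale ga.subspace_add)
  have "ga_scale (c ^ q) (F ?w) = F (?w(j := ga_scale c (?w j)))"
    by (rule F_scale[OF W'(2) v(3), symmetric])
  also have "?w(j := ga_scale c (?w j)) = ?v(i := ?v i + ?v j)" using v by auto
  also have "F \<dots> = F ?v" by (rule F_add) (use W' v in auto)
  also have "\<dots> = ga_scale (c ^ q) (F v)" by (rule F_scale) (use v in auto)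
  finally have "ga_scale (c ^ q) (F ?w) = ga_scale (c ^ q) (F v)" .
  moreover have "c ^ q \<noteq> 0" using False by simp
  ultimately show ?thesis by (metis ga.scale_cancel_left)
qed simp

lemma F_add_sum:
  assumes v: "\<forall>i<d. v i \<in> W" "i < d" and U: "U \<subseteq> {..<d} - {i}"
  shows "F (v(i := v i + (\<Sum>j\<in>U. ga_scale (c j) (v j)))) = F v"
proof -
  have "finite U" using U finite_subset by auto
  then show ?thesis using U
  proof (induction U rule: finite_induct)
    case (insert j U)
    let ?v = "v(i := v i + (\<Sum>j\<in>U. ga_scale (c j) (v j)))"
    have "\<forall>i<d. ?v i \<in> W"
      using v insert.prems W by (auto intro!: ga.subspace_add ga.subspace_sum ga.subspace_scale)
    then have "F (?v(i := ?v i + ga_scale (c j) (?v j))) = F ?v"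
      by (rule F_add_scale) (use v insert in auto)
    moreover have "?v(i := ?v i + ga_scale (c j) (?v j))
        = v(i := v i + (\<Sum>j\<in>insert j U. ga_scale (c j) (v j)))"
      using insert by (auto simp: fun_eq_iff ac_simps)
    moreover have "F ?v = F v" using insert by blast
    ultimately show ?case by metis
  qed simp
qed

lemma F_zero:
  assumes v: "\<forall>i<d. v i \<in> W" "i < d" "v i = 0" shows "F v = 0"
proof -
  have "F (v(i := ga_scale 0 (v i))) = ga_scale (0 ^ q) (F v)" by (rule F_scale) (use v in auto)
  then show ?thesis using v q by (simp add: fun_upd_idem zero_power)
qed

lemma F_col_mat:
  assumes b: "\<forall>i<d. b i \<in> W" and j: "j < d"
  shows "F (comb d b (col_mat d j u)) = ga_scale (u j ^ q) (F b)"
proof -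
  let ?v = "b(j := ga_scale (u j) (b j))"
  have v: "\<forall>i<d. ?v i \<in> W" using b W by (auto simp: ga.subspace_scale)
  have "F (comb d b (col_mat d j u)) = F (?v(j := ?v j + (\<Sum>i\<in>{..<d} - {j}. ga_scale (u i) (?v i))))"
  proof (rule F_cong, intro allI impI)
    fix m assume m: "m < d"
    have "(\<Sum>i<d. ga_scale (u i) (b i)) = ga_scale (u j) (b j) + (\<Sum>i\<in>{..<d} - {j}. ga_scale (u i) (b i))"
      using j by (simp add: sum.remove)
    then show "comb d b (col_mat d j u) m
        = (?v(j := ?v j + (\<Sum>i\<in>{..<d} - {j}. ga_scale (u i) (?v i)))) m"
      using j m by (simp add: comb_col_mat)
  qed
  also have "\<dots> = F ?v" by (rule F_add_sum[OF v j]) simp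
  also have "\<dots> = ga_scale (u j ^ q) (F b)" by (rule F_scale[OF b j])
  finally show ?thesis .
qed

lemma F_comb_mult:
  assumes "A \<in> carrier_mat d d" "B \<in> carrier_mat d d"
  shows "F (comb d b (A * B)) = F (comb d (comb d b A) B)"
  by (rule F_cong) (use comb_mult[OF assms] in auto)

text \<open>If the columns are dependent, transvections turn one of the vectors into 0.\<close>

lemma F_singular:
  assumes b: "\<forall>i<d. b i \<in> W" and A: "A \<in> carrier_mat d d" and det: "det A = 0"
  shows "F (comb d b A) = 0"
proof -
  obtain x where x: "x \<in> carrier_vec d" "x \<noteq> 0\<^sub>v d" "A *\<^sub>v x = 0\<^sub>v d"
    using det_0_iff_vec_prod_zero_field[OF A] det by auto
  then obtain j where j: "j < d" "x $ j \<noteq> 0" by (metis carrier_vecD eq_vecI index_zero_vec)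
  let ?v = "comb d b A"
  have v: "\<forall>i<d. ?v i \<in> W" using comb_W b by auto
  have "(\<Sum>m<d. ga_scale (x $ m) (?v m)) = (\<Sum>i<d. ga_scale ((A *\<^sub>v x) $ i) (b i))"
  proof -
    have "(\<Sum>m<d. ga_scale (x $ m) (?v m)) = (\<Sum>m<d. \<Sum>i<d. ga_scale (A $$ (i, m) * x $ m) (b i))"
      by (simp add: comb_def ga.scale_sum_right mult.commute)
    also have "\<dots> = (\<Sum>i<d. \<Sum>m<d. ga_scale (A $$ (i, m) * x $ m) (b i))" by (rule sum.swap)
    moreover have "(A *\<^sub>v x) $ i = (\<Sum>m<d. A $$ (i, m) * x $ m)" if "i < d" for i
      using A x(1) that by (auto simp: scalar_prod_def atLeast0LessThan intro!: sum.cong)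
    ultimately show ?thesis by (simp add: ga.scale_sum_left)
  qed
  also have "\<dots> = 0" using x by simp
  finally have "ga_scale (x $ j) (?v j) + (\<Sum>m\<in>{..<d} - {j}. ga_scale (x $ m) (?v m)) = 0"
    using j by (simp add: sum.remove)
  then have "ga_scale (inverse (x $ j)) (ga_scale (x $ j) (?v j) + (\<Sum>m\<in>{..<d} - {j}. ga_scale (x $ m) (?v m))) = 0"
    by simp
  then have z: "?v j + (\<Sum>m\<in>{..<d} - {j}. ga_scale (inverse (x $ j) * x $ m) (?v m)) = 0"
    using j by (simp add: ga.scale_right_distrib ga.scale_sum_right)
  have "F ?v = F (?v(j := ?v j + (\<Sum>m\<in>{..<d} - {j}. ga_scale (inverse (x $ j) * x $ m) (?v m))))"
    by (rule F_add_sum[OF v j(1), symmetric]) simp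
  also have "\<dots> = 0" by (rule F_zero[of _ j]) (use v j W z in \<open>auto simp: ga.subspace_0\<close>)
  finally show ?thesis .
qed

text \<open>Gaussian elimination: a column with nonzero diagonal entry is split off as a factor \<open>col_mat\<close> on the
  left, which amounts to replacing one vector of \<open>b\<close>.\<close>

lemma F_regular:
  assumes "finite S" "\<forall>i<d. b i \<in> W" "A \<in> carrier_mat d d" "det A \<noteq> 0"
    and "\<forall>m<d. m \<notin> S \<longrightarrow> (\<forall>i<d. A $$ (i, m) = (if i = m then 1 else 0))"
    and "S \<subseteq> {..<d}"
  shows "F (comb d b A) = ga_scale (det A ^ q) (F b)"
  using assms
proof (induction S arbitrary: b A rule: finite_induct)
  case empty
  then have "A = 1\<^sub>m d" by (intro eq_matI) auto
  moreover have "F (comb d b (1\<^sub>m d)) = F b"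
    by (rule F_cong) (auto simp: comb_def if_distribR if_distrib[of "\<lambda>c. ga_scale c _"] sum.delta cong: if_cong)
  ultimately show ?case by simp
next
  case (insert j S)
  have j: "j < d" using insert.prems by auto
  have main: "F (comb d b A) = ga_scale (det A ^ q) (F b)"
    if A: "A \<in> carrier_mat d d" "det A \<noteq> 0" "A $$ (j, j) \<noteq> 0"
      "\<forall>m<d. m \<notin> insert j S \<longrightarrow> (\<forall>i<d. A $$ (i, m) = (if i = m then 1 else 0))" for A
  proof -
    define E where "E = col_mat d j (\<lambda>i. A $$ (i, j))"
    define B where "B = mat d d (\<lambda>(i, m). if i = j then A $$ (j, m) / A $$ (j, j)
      else A $$ (i, m) - A $$ (i, j) * (A $$ (j, m) / A $$ (j, j)))"
    have EB: "E \<in> carrier_mat d d" "B \<in> carrier_mat d d" by (simp_all add: E_def B_def)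
    have AEB: "A = E * B"
    proof (rule eq_matI)
      fix i m assume "i < dim_row (E * B)" "m < dim_col (E * B)"
      then have im: "i < d" "m < d" using EB by auto
      then have "(E * B) $$ (i, m) = (\<Sum>k<d. (if k = j then A $$ (i, j) else if i = k then 1 else 0) * B $$ (k, m))"
        using EB by (simp add: scalar_prod_def atLeast0LessThan E_def col_mat_def)
      also have "\<dots> = A $$ (i, j) * B $$ (j, m) + (\<Sum>k\<in>{..<d} - {j}. (if k = i then B $$ (k, m) else 0))"
        unfolding sum.remove[OF finite_lessThan, of j d, unfolded lessThan_iff, OF j]
        by (intro arg_cong2[of _ _ _ _ "(+)"] sum.cong) auto
      also have "\<dots> = A $$ (i, m)" using im EB j A by (auto simp: B_def sum.delta)
      finally show "A $$ (i, m) = (E * B) $$ (i, m)" by simp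
    qed (use A EB in auto)
    have detA: "det A = A $$ (j, j) * det B"
      unfolding AEB[THEN arg_cong[of _ _ det]] det_mult[OF EB] by (simp add: E_def det_col_mat j)
    have bE: "\<forall>i<d. comb d b E i \<in> W" using comb_W insert.prems(1) by auto
    have "F (comb d b A) = F (comb d (comb d b E) B)" unfolding AEB by (rule F_comb_mult[OF EB])
    also have "\<dots> = ga_scale (det B ^ q) (F (comb d b E))"
    proof (rule insert.IH[OF bE EB(2)])
      show "det B \<noteq> 0" using detA A by auto
      show "\<forall>m<d. m \<notin> S \<longrightarrow> (\<forall>i<d. B $$ (i, m) = (if i = m then 1 else 0))"
      proof (intro allI impI)
        fix m i assume "m < d" "m \<notin> S" "i < d"
        then show "B $$ (i, m) = (if i = m then 1 else 0)" using A j by (cases "m = j") (auto simp: B_def)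
      qed
    qed (use insert.prems in auto)
    also have "F (comb d b E) = ga_scale (A $$ (j, j) ^ q) (F b)"
      unfolding E_def by (rule F_col_mat[OF insert.prems(1) j])
    finally show ?thesis by (simp add: detA power_mult_distrib mult.commute)
  qed
  show ?case
  proof (cases "A $$ (j, j) = 0")
    case False
    then show ?thesis using main insert.prems by blast
  next
    case True
    have "\<exists>m<d. A $$ (j, m) \<noteq> 0"
    proof (rule ccontr)
      assume "\<not> (\<exists>m<d. A $$ (j, m) \<noteq> 0)"
      then have "det A = 0" using laplace_expansion_row[OF insert.prems(2) j] by simp
      then show False using insert.prems by simp
    qed
    then obtain m where m: "m < d" "A $$ (j, m) \<noteq> 0" by auto
    have mj: "m \<noteq> j" using m True by auto
    define E where "E = col_mat d j (\<lambda>i. if i = j \<or> i = m then 1 else 0 :: 'k)"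
    have E: "E \<in> carrier_mat d d" by (simp add: E_def)
    have AE: "A * E \<in> carrier_mat d d" using insert.prems E by simp
    have ent: "(A * E) $$ (i, l) = (if l = j then A $$ (i, j) + A $$ (i, m) else A $$ (i, l))"
      if "i < d" "l < d" for i l
    proof -
      have "(A * E) $$ (i, l) = (\<Sum>k<d. A $$ (i, k) * E $$ (k, l))"
        using insert.prems E that by (simp add: scalar_prod_def atLeast0LessThan)
      also have "\<dots> = (if l = j then \<Sum>k<d. A $$ (i, k) * ((if k = j then 1 else 0) + (if k = m then 1 else 0))
          else \<Sum>k<d. A $$ (i, k) * (if k = l then 1 else 0))"
        using that mj by (auto simp: E_def col_mat_def intro!: sum.cong)
      also have "\<dots> = (if l = j then A $$ (i, j) + A $$ (i, m) else A $$ (i, l))"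
        using that j m by (auto simp: distrib_left sum.distrib sum.delta if_distrib[of "\<lambda>c. _ * c"] cong: if_cong)
      finally show ?thesis .
    qed
    have detE: "det (A * E) = det A"
      using det_mult[OF insert.prems(2) E] by (simp add: E_def det_col_mat j)
    have "F (comb d b A) = F (comb d (comb d b A) E)"
      using F_col_mat[of "comb d b A" j "\<lambda>i. if i = j \<or> i = m then 1 else 0"] comb_W insert.prems(1) j
      by (simp add: E_def)
    also have "\<dots> = F (comb d b (A * E))" by (rule F_comb_mult[OF insert.prems(2) E, symmetric])
    also have "\<dots> = ga_scale (det (A * E) ^ q) (F b)"
      by (rule main[OF AE]) (use detE insert.prems ent m j True in auto)
    finally show ?thesis by (simp add: detE)
  qed
qed

lemma F_comb:
  assumes b: "\<forall>i<d. b i \<in> W" and A: "A \<in> carrier_mat d d"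
  shows "F (comb d b A) = ga_scale (det A ^ q) (F b)"
proof (cases "det A = 0")
  case True
  then show ?thesis using F_singular[OF b A] q by (simp add: zero_power)
next
  case False
  show ?thesis by (rule F_regular[of "{..<d}"]) (use b A False in auto)
qed

end

lemma ga_scale_power:
  fixes x :: "'g::{finite,group_add} \<Rightarrow>\<^sub>0 'k::field"
  shows "ga_scale c x ^ m = ga_scale (c ^ m) (x ^ m)"
  by (induction m) (simp_all add: ga_scale_mult_left ga_scale_mult_right)

context lie_system begin

text \<open>In the expansion of \<open>(x + y)\<^sup>m y\<^sup>p\<^sup>-\<^sup>1\<close> every term other than \<open>x\<^sup>m y\<^sup>p\<^sup>-\<^sup>1\<close> contains \<open>p\<close> letters \<open>y\<close>; modulo
  shorter words they can be brought together, and \<open>y\<^sup>p\<close> is a single letter.\<close>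

lemma transvection_V:
  assumes r: "r \<ge> 1" and x: "x \<in> Z r" and y: "y \<in> Z r"
  shows "(x + y) ^ m * y ^ (p - 1) - x ^ m * y ^ (p - 1) \<in> V (r * (m + (p - 1))) (m + (p - 1))"
proof (induction m)
  case 0
  then show ?case by (simp add: ga.subspace_0 V_subspace)
next
  case (Suc m)
  let ?q = "p - 1"
  have xy: "x + y \<in> Z r" using Z_subspace[OF r] x y by (rule ga.subspace_add)
  have 1: "(x + y) * ((x + y) ^ m * y ^ ?q - x ^ m * y ^ ?q) \<in> V (r + r * (m + ?q)) (Suc 0 + (m + ?q))"
    by (rule V_mult[OF word_V[OF word_letter[OF r xy]] Suc]) simp
  have 2: "(y * x ^ m - x ^ m * y) * y ^ ?q \<in> V ((r + r * m) + r * ?q) (Suc m + ?q)"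
    by (rule V_mult'[OF letter_commutator[OF r y word_power[OF r x]] word_V[OF word_power[OF r y]]]) simp
  have "y ^ p \<in> V (r * p) p" by (rule power_V_short[OF r y]) simp
  then have "x ^ m * y ^ p \<in> V (r * m + r * p) (m + p)"
    by (intro V_mult word_V[OF word_power[OF r x]]) auto
  moreover have p: "p = Suc ?q" using prime_gt_0_nat[OF p_prime] by simp
  then have "y ^ p = y * y ^ ?q" by (metis power_Suc)
  ultimately have 3: "x ^ m * (y * y ^ ?q) \<in> V (r * m + r * Suc ?q) (m + Suc ?q)" using p by metis
  have "(x + y) * ((x + y) ^ m * y ^ ?q - x ^ m * y ^ ?q)
      + ((y * x ^ m - x ^ m * y) * y ^ ?q + x ^ m * (y * y ^ ?q)) \<in> V (r * (Suc m + ?q)) (Suc m + ?q)"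
    using 1 2 3 by (intro V_add) (simp_all add: algebra_simps)
  then show ?case by (simp add: algebra_simps)
qed

end

context pbw_basis begin

definition top_prod :: "('i \<Rightarrow> ('g \<Rightarrow>\<^sub>0 'k)) \<Rightarrow> ('g \<Rightarrow>\<^sub>0 'k)"
  where "top_prod v = prod_list (map (\<lambda>i. v i ^ (p - 1)) is)"

lemma mset_concat_map: "mset (concat (map f xs)) = (\<Sum>x\<in>#mset xs. mset (f x))"
  by (induction xs) auto

abbreviation block_letters :: "nat \<Rightarrow> 'i list \<Rightarrow> 'i list"
  where "block_letters q js \<equiv> concat (map (replicate q) js)"

lemma prod_block_letters: "prod_list (map v (block_letters q js)) = prod_list (map (\<lambda>i. v i ^ q) js)"
  by (induction js) auto

lemma wt_block_letters: "sum_list (map wt (block_letters q js)) = q * sum_list (map wt js)"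
  by (induction js) (auto simp: sum_list_replicate distrib_left)

lemma length_block_letters: "length (block_letters q js) = length js * q"
  by (induction js) auto

text \<open>In top weight the shorter words vanish, so words of maximal length may be reordered without any
  error term.\<close>

lemma top_prod_perm:
  assumes v: "\<And>i. i \<in> set is \<Longrightarrow> v i \<in> Z (wt i)" and ms: "mset js = mset is"
  shows "top_prod v = prod_list (map (\<lambda>i. v i ^ (p - 1)) js)"
proof -
  have m: "mset (block_letters (p - 1) is) = mset (block_letters (p - 1) js)"
    using ms by (simp only: mset_concat_map)
  have "prod_list (map v (block_letters (p - 1) is)) - prod_list (map v (block_letters (p - 1) js))
      \<in> V (sum_list (map wt (block_letters (p - 1) is))) (length (block_letters (p - 1) is))"
    by (rule prod_list_perm[OF _ m]) (use v wt_pos in auto)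
  then show ?thesis
    using V_top
    by (simp only: wt_block_letters length_block_letters prod_block_letters top_prod_def top_wt_def) simp
qed

lemma top_prod_cong_JP:
  assumes v: "\<And>i. i \<in> set is \<Longrightarrow> v i \<in> Z (wt i)" "\<And>i. i \<in> set is \<Longrightarrow> v' i \<in> Z (wt i)"
    and diff: "\<And>i. i \<in> set is \<Longrightarrow> v i - v' i \<in> JP (Suc (wt i))"
  shows "top_prod v = top_prod v'"
proof -
  have "prod_list (map v js) - prod_list (map v' js) \<in> JP (Suc (sum_list (map wt js)))" if "set js \<subseteq> set is" for js
    using that
  proof (induction js)
    case (Cons j js)
    have j: "wt j \<ge> 1" "v' j \<in> JP (wt j)" using Cons.prems v(2) wt_pos Z_subset by auto
    have "word (sum_list (map wt js)) (length js) (prod_list (map v js))"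
      by (rule word_prod_list) (use Cons.prems v wt_pos in auto)
    from JP_mult[OF diff[of j] word_JP[OF this]] have "(v j - v' j) * prod_list (map v js) \<in> JP (Suc (wt j) + sum_list (map wt js))"
      using Cons.prems by simp
    moreover have "v' j * (prod_list (map v js) - prod_list (map v' js))
        \<in> JP (wt j + Suc (sum_list (map wt js)))"
      using Cons by (intro JP_mult j) auto
    ultimately have "(v j - v' j) * prod_list (map v js) + v' j * (prod_list (map v js) - prod_list (map v' js))
        \<in> JP (Suc (sum_list (map wt (j # js))))" by (intro JP_add) simp_all
    then show ?case by (simp add: algebra_simps)
  qed (simp add: JP_0)
  moreover have "set (block_letters (p - 1) is) \<subseteq> set is" by auto
  ultimately have "prod_list (map v (block_letters (p - 1) is)) - prod_list (map v' (block_letters (p - 1) is))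
      \<in> JP (Suc (sum_list (map wt (block_letters (p - 1) is))))" by blast
  then have "top_prod v - top_prod v' \<in> JP (Suc top_wt)"
    by (simp only: prod_block_letters wt_block_letters top_prod_def top_wt_def)
  then show ?thesis using JP_above_top by simp
qed

lemma top_prod_scale:
  assumes "i \<in> set is" shows "top_prod (v(i := ga_scale c (v i))) = ga_scale (c ^ (p - 1)) (top_prod v)"
proof -
  obtain us vs where us: "is = us @ i # vs" using assms by (meson split_list)
  then have "i \<notin> set us" "i \<notin> set vs" using is_distinct by auto
  then have eq: "map (\<lambda>k. (v(i := ga_scale c (v i))) k ^ (p - 1)) us = map (\<lambda>k. v k ^ (p - 1)) us"
    "map (\<lambda>k. (v(i := ga_scale c (v i))) k ^ (p - 1)) vs = map (\<lambda>k. v k ^ (p - 1)) vs" by auto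
  show ?thesis unfolding top_prod_def unfolding us map_append list.map eq
    by (simp add: ga_scale_power ga_scale_mult_left ga_scale_mult_right)
qed

lemma top_prod_add:
  assumes v: "\<And>i. i \<in> set is \<Longrightarrow> v i \<in> Z (wt i)"
    and ij: "i \<in> set is" "j \<in> set is" "i \<noteq> j" "wt i = wt j"
  shows "top_prod (v(i := v i + v j)) = top_prod v"
proof -
  let ?v = "v(i := v i + v j)" and ?q = "p - 1"
  obtain us vs where us: "is = us @ i # vs" using ij(1) by (meson split_list)
  then have "j \<in> set (us @ vs)" using ij by auto
  then obtain us' vs' where us': "us @ vs = us' @ j # vs'" by (meson split_list)
  define rs where "rs = us' @ vs'"
  have ms: "mset (i # j # rs) = mset is"
    using arg_cong[OF us', of mset] by (simp add: rs_def us)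
  then have "distinct (i # j # rs)" "set (i # j # rs) = set is"
    using is_distinct by (metis mset_eq_imp_distinct_iff, metis set_mset_mset)
  then have rs: "set rs \<subseteq> set is" "i \<notin> set rs" by auto
  have r: "wt i \<ge> 1" "v i \<in> Z (wt i)" "v j \<in> Z (wt i)"
    using ij v wt_pos by (blast, blast, metis)
  have v': "?v k \<in> Z (wt k)" if "k \<in> set is" for k
    using v[OF that] ga.subspace_add[OF Z_subspace[OF r(1)] r(2,3)] by simp
  let ?R = "prod_list (map (\<lambda>k. v k ^ ?q) rs)"
  have R: "map (\<lambda>k. ?v k ^ ?q) rs = map (\<lambda>k. v k ^ ?q) rs" using rs by auto
  have "word (sum_list (map wt (block_letters (p - 1) rs))) (length (block_letters (p - 1) rs)) (prod_list (map v (block_letters (p - 1) rs)))"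
    by (rule word_prod_list) (use v wt_pos rs in auto)
  then have "?R \<in> V (?q * sum_list (map wt rs)) (Suc (length rs * ?q))"
    unfolding wt_block_letters length_block_letters prod_block_letters by (rule word_V) simp
  from V_mult'[OF transvection_V[OF r, of ?q] this]
  have "((v i + v j) ^ ?q * v j ^ ?q - v i ^ ?q * v j ^ ?q) * ?R
      \<in> V (wt i * (?q + ?q) + ?q * sum_list (map wt rs)) (?q + ?q + length rs * ?q)" .
  also have "wt i * (?q + ?q) + ?q * sum_list (map wt rs) = ?q * sum_list (map wt (i # j # rs))"
    using ij by (simp add: algebra_simps)
  also have "sum_list (map wt (i # j # rs)) = sum_list (map wt is)"
    using ms by (metis mset_map sum_mset_sum_list)
  also have "?q + ?q + length rs * ?q = length (i # j # rs) * ?q" by simp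
  also have "length (i # j # rs) = length is" using ms by (metis size_mset)
  finally have "(v i + v j) ^ ?q * v j ^ ?q * ?R = v i ^ ?q * v j ^ ?q * ?R"
    using V_top by (simp add: top_wt_def left_diff_distrib)
  then show ?thesis
    using top_prod_perm[of ?v, OF v' ms] top_prod_perm[of v, OF v ms] ij
    unfolding list.map R by (simp add: mult.assoc)
qed

end

section \<open>The restricted Lie algebra of the dimension subgroups\<close>

text \<open>This is Jacobson's formula in a commutative situation, where all Lie terms vanish.\<close>

lemma power_add_commute_char_p:
  fixes x y :: "'a::ring_1"
  assumes "prime p" "of_nat p = (0 :: 'a)" "x * y = y * x"
  shows "(x + y) ^ p = x ^ p + y ^ p"
proof -
  define cm where "cm a b \<longleftrightarrow> a * b = b * a" for a b :: 'a
  have cm: "cm a 0" "cm 0 a" "cm a a" "cm a b \<Longrightarrow> cm b a" "cm a b \<Longrightarrow> cm a c \<Longrightarrow> cm a (b + c)" for a b c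
    by (simp_all add: cm_def distrib_left distrib_right)
  \<comment> \<open>The double commutant of \<open>x\<close> and \<open>y\<close> is commutative.\<close>
  define D where "D = {a. cm a x \<and> cm a y \<and> (\<forall>c. cm c x \<and> cm c y \<longrightarrow> cm c a)}"
  define Z where "Z r = (if r = 1 then D else {0})" for r :: nat
  have D: "0 \<in> D" "x \<in> D" "y \<in> D" "a \<in> D \<Longrightarrow> b \<in> D \<Longrightarrow> a + b \<in> D"
    "a \<in> D \<Longrightarrow> b \<in> D \<Longrightarrow> cm a b" for a b
  proof -
    have xy: "cm x y" using assms(3) by (simp only: cm_def)
    show "0 \<in> D" "x \<in> D" "y \<in> D" unfolding D_def using cm(1-4) xy by blast+
    show "a + b \<in> D" if "a \<in> D" "b \<in> D"
    proof -
      have "cm (a + b) z" if "cm a z" "cm b z" for z using that cm(4,5) by blast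
      then show ?thesis using that cm(5) unfolding D_def by blast
    qed
    show "cm a b" if "a \<in> D" "b \<in> D" using that unfolding D_def by blast
  qed
  have "(x + y) ^ p - x ^ p - y ^ p \<in> Z (1 * p)"
  proof (rule jacobson_formula[where Z = Z, OF assms(1,2)])
    show "x \<in> Z 1" "y \<in> Z 1" using D by (auto simp: Z_def)
    fix r :: nat and a b
    show "0 \<in> Z r" using D by (auto simp: Z_def)
    show "a + b \<in> Z r" if "a \<in> Z r" "b \<in> Z r" using that D by (auto simp: Z_def split: if_splits)
    fix s :: nat
    assume "r \<ge> 1" "s \<ge> 1" and ab: "a \<in> Z r" "b \<in> Z s"
    have "a * b = b * a" using ab D(5)[of a b] by (auto simp: Z_def cm_def split: if_splits)
    then show "a * b - b * a \<in> Z (r + s)" using D by (simp add: Z_def)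
  qed simp
  moreover have "1 * p \<noteq> 1" using prime_gt_1_nat[OF assms(1)] by simp
  ultimately show ?thesis unfolding Z_def by (auto simp: algebra_simps)
qed

lemma independent_sum_in_span:
  fixes B C :: "('g::{finite,group_add} \<Rightarrow>\<^sub>0 'k::field) set"
  assumes "ga.independent B" "C \<subseteq> B"
    and s: "(\<Sum>x\<in>B - C. ga_scale (c x) x) \<in> ga.span C" and x: "x \<in> B - C"
  shows "c x = 0"
proof (rule ccontr)
  assume "c x \<noteq> 0"
  have fin: "finite B" using assms(1) ga.independent_bound_general by blast
  have "ga_scale (c x) x = (\<Sum>y\<in>B - C. ga_scale (c y) y) - (\<Sum>y\<in>B - C - {x}. ga_scale (c y) y)"
    using fin x by (simp add: sum.remove)
  also have "\<dots> \<in> ga.span (B - {x})"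
  proof (rule ga.span_diff)
    show "(\<Sum>y\<in>B - C. ga_scale (c y) y) \<in> ga.span (B - {x})"
      using s ga.span_mono[of C "B - {x}"] assms(2) x by blast
    show "(\<Sum>y\<in>B - C - {x}. ga_scale (c y) y) \<in> ga.span (B - {x})"
      by (intro ga.span_sum ga.span_scale ga.span_base) auto
  qed
  finally have "ga_scale (inverse (c x)) (ga_scale (c x) x) \<in> ga.span (B - {x})" by (rule ga.span_scale)
  then have "x \<in> ga.span (B - {x})" using \<open>c x \<noteq> 0\<close> by simp
  then show False using assms(1) x ga.dependent_def by blast
qed

lemma
  assumes "ga_automorphism \<alpha>"
  shows aut_bij: "bij \<alpha>" and aut_1: "\<alpha> 1 = 1" and aut_add: "\<alpha> (x + y) = \<alpha> x + \<alpha> y"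
    and aut_mult: "\<alpha> (x * y) = \<alpha> x * \<alpha> y" and aut_scale: "\<alpha> (ga_scale c x) = ga_scale c (\<alpha> x)"
  using assms by (auto simp: ga_automorphism_def)

lemma aut_0: "ga_automorphism \<alpha> \<Longrightarrow> \<alpha> 0 = 0"
  using aut_add[of \<alpha> 0 0] by simp

lemma aut_diff: "ga_automorphism \<alpha> \<Longrightarrow> \<alpha> (x - y) = \<alpha> x - \<alpha> y"
  using aut_add[of \<alpha> "x - y" y] by simp

lemma aut_power: "ga_automorphism \<alpha> \<Longrightarrow> \<alpha> (x ^ n) = \<alpha> x ^ n"
  by (induction n) (auto simp: aut_1 aut_mult)

lemma aut_prod_list: "ga_automorphism \<alpha> \<Longrightarrow> \<alpha> (prod_list xs) = prod_list (map \<alpha> xs)"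
  by (induction xs) (auto simp: aut_1 aut_mult)

lemma aut_inv:
  assumes "ga_automorphism \<alpha>" shows "ga_automorphism (inv_into UNIV \<alpha>)"
proof -
  have b: "inv_into UNIV \<alpha> x = y \<longleftrightarrow> x = \<alpha> y" for x y
    using aut_bij[OF assms] by (metis bij_inv_eq_iff)
  have [simp]: "\<alpha> (inv_into UNIV \<alpha> x) = x" for x using b by metis
  show ?thesis unfolding ga_automorphism_def
    using assms bij_imp_bij_inv[OF aut_bij[OF assms]] by (simp add: b aut_1 aut_add aut_mult aut_scale)
qed

lemma aut_subspace:
  fixes \<alpha> :: "('g::{finite,group_add} \<Rightarrow>\<^sub>0 'k::field) \<Rightarrow> ('g \<Rightarrow>\<^sub>0 'k)"
  assumes "ga_automorphism \<alpha>" "ga.subspace S" shows "ga.subspace (\<alpha> ` S)"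
  unfolding ga.subspace_def
proof (intro conjI ballI allI)
  show "0 \<in> \<alpha> ` S" using assms aut_0[OF assms(1)] ga.subspace_0 by (metis imageI)
  fix x assume "x \<in> \<alpha> ` S"
  then show "ga_scale c x \<in> \<alpha> ` S" for c
    using assms by (auto simp: aut_scale[symmetric] intro: ga.subspace_scale)
  fix y assume "y \<in> \<alpha> ` S"
  with \<open>x \<in> \<alpha> ` S\<close> show "x + y \<in> \<alpha> ` S"
    using assms by (auto simp: aut_add[symmetric] intro: ga.subspace_add)
qed

context modular_p_group begin

lemma of_nat_p_ga: "(of_nat p :: 'g \<Rightarrow>\<^sub>0 'k) = 0"
  using of_nat_p by (simp flip: single_of_nat)

abbreviation F :: "nat \<Rightarrow> 'g set" where "F \<equiv> dim_subgroup k_type"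

lemma mem_F: "g \<in> F r \<longleftrightarrow> gk g - 1 \<in> JP r"
  by (simp add: dim_subgroup_def)

text \<open>The preimage of \<open>Jen\<^sub>r(G)\<close> in \<open>J\<^sup>r\<close>.\<close>

definition Jen_lift :: "nat \<Rightarrow> ('g \<Rightarrow>\<^sub>0 'k) set"
  where "Jen_lift r = ga.span ((\<lambda>g. gk g - 1) ` F r \<union> JP (Suc r))"

lemma Jen_lift_subspace: "ga.subspace (Jen_lift r)"
  by (simp add: Jen_lift_def)

lemma Jen_lift_gel: "g \<in> F r \<Longrightarrow> gk g - 1 \<in> Jen_lift r"
  unfolding Jen_lift_def by (rule ga.span_base) auto

lemma JP_subset_Jen_lift: "JP (Suc r) \<subseteq> Jen_lift r"
  unfolding Jen_lift_def using ga.span_superset by blast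

lemma Jen_lift_subset_JP: "Jen_lift r \<subseteq> JP r"
  unfolding Jen_lift_def by (rule ga.span_minimal) (use JP_Suc_le JP_subspace mem_F in auto)

lemma gel_power: "\<exists>h. gk g ^ m = gk h"
proof (induction m)
  case 0
  then show ?case by (auto intro: exI[of _ 0])
next
  case (Suc m)
  then show ?case by (auto simp: mult_single)
qed

lemma JP_power: "x \<in> JP r \<Longrightarrow> x ^ m \<in> JP (r * m)"
  by (induction m) (auto intro: JP_mult)

text \<open>For \<open>a = u - 1\<close> and \<open>b = v - 1\<close> the Lie bracket is \<open>uv - vu = (c - 1) vu\<close> with the group commutator
  \<open>c\<close>, and \<open>vu\<close> is 1 modulo the radical.\<close>

lemma Jen_lift_commutator:
  assumes "x \<in> Jen_lift r" "y \<in> Jen_lift s" shows "x * y - y * x \<in> Jen_lift (r + s)"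
  using assms unfolding Jen_lift_def[of r] Jen_lift_def[of s]
proof (rule span_commutator)
  fix a b assume a: "a \<in> (\<lambda>g. gk g - 1) ` F r \<union> JP (Suc r)" and b: "b \<in> (\<lambda>g. gk g - 1) ` F s \<union> JP (Suc s)"
  have J: "a \<in> JP r" "b \<in> JP s" using a b mem_F JP_Suc_le by auto
  show "a * b - b * a \<in> Jen_lift (r + s)"
  proof (cases "a \<in> JP (Suc r) \<or> b \<in> JP (Suc s)")
    case True
    then have "a * b \<in> JP (Suc (r + s))" "b * a \<in> JP (Suc (r + s))"
      using J JP_mult[of a "Suc r" b s] JP_mult[of a r b "Suc s"] JP_mult[of b "Suc s" a r] JP_mult[of b s a "Suc r"]
      by (auto simp: add.commute)
    then show ?thesis using JP_diff JP_subset_Jen_lift by blast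
  next
    case False
    then obtain u v where uv: "a = gk u - 1" "b = gk v - 1" using a b by auto
    define c where "c = (u + v) - (v + u)"
    have cuv: "c + (v + u) = u + v" by (simp add: c_def)
    have eq: "a * b - b * a = gk (u + v) - gk (v + u)" by (simp add: uv algebra_simps mult_single)
    also have "\<dots> = (gk c - 1) * gk (v + u)" by (simp add: left_diff_distrib mult_single cuv)
    finally have ab: "a * b - b * a = (gk c - 1) * gk (v + u)" .
    then have "gk c - 1 = (a * b - b * a) * gk (- (v + u))"
      by (simp add: mult.assoc mult_single del: minus_add)
    moreover have "a * b - b * a \<in> JP (r + s)"
      using J JP_mult[of a r b s] JP_mult[of b s a r] by (simp add: JP_diff add.commute)
    ultimately have c: "gk c - 1 \<in> JP (r + s)" using JP_mult_right by simp
    have "(gk c - 1) * (gk (v + u) - 1) \<in> JP (Suc (r + s))"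
      using JP_SucI[OF c gel_minus_1_aug] .
    then have "(gk c - 1) + (gk c - 1) * (gk (v + u) - 1) \<in> Jen_lift (r + s)"
      using c JP_subset_Jen_lift Jen_lift_gel[of c "r + s"] mem_F by (intro ga.subspace_add[OF Jen_lift_subspace]) auto
    moreover have "(gk c - 1) + (gk c - 1) * (gk (v + u) - 1) = (gk c - 1) * gk (v + u)"
      by (simp add: right_diff_distrib del: single_one)
    ultimately show ?thesis using ab by simp
  qed
qed (rule Jen_lift_subspace)

text \<open>The \<open>p\<close>-th power of \<open>g - 1\<close> is \<open>g\<^sup>p - 1\<close>; Jacobson's formula extends the claim to the span.\<close>

lemma Jen_lift_power:
  assumes r: "r \<ge> 1" and "x \<in> Jen_lift r" shows "x ^ p \<in> Jen_lift (r * p)"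
proof -
  have gen: "x ^ p \<in> Jen_lift (r * p)" if x: "x \<in> (\<lambda>g. gk g - 1) ` F r \<union> JP (Suc r)" for x
  proof (cases "x \<in> JP (Suc r)")
    case True
    then have "x ^ p \<in> JP (Suc r * p)" by (rule JP_power)
    moreover have "Suc (r * p) \<le> Suc r * p" using prime_gt_0_nat[OF p_prime] by simp
    ultimately show ?thesis using JP_anti JP_subset_Jen_lift by blast
  next
    case False
    then obtain g where g: "x = gk g - 1" "g \<in> F r" using x by auto
    obtain h where h: "gk g ^ p = gk h" using gel_power by blast
    have "gk h = x ^ p + 1 ^ p"
      using power_add_commute_char_p[OF p_prime of_nat_p_ga, of x 1] g h by simp
    then have "x ^ p = gk h - 1" by simp
    moreover have "x ^ p \<in> JP (r * p)" using g mem_F JP_power by blast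
    ultimately show ?thesis using Jen_lift_gel mem_F by simp
  qed
  have "x \<in> Jen_lift r \<and> x ^ p \<in> Jen_lift (r * p)"
    using assms(2) unfolding Jen_lift_def[of r]
  proof (induction rule: ga.span_induct_alt)
    case base
    then show ?case using prime_gt_0_nat[OF p_prime] by (simp add: zero_power ga.span_zero ga.subspace_0[OF Jen_lift_subspace])
  next
    case (step c x y)
    have cx: "ga_scale c x \<in> Jen_lift r" "y \<in> Jen_lift r"
      unfolding Jen_lift_def by (intro ga.span_scale ga.span_base step(1)) (rule conjunct1[OF step(2)])
    have "(ga_scale c x + y) ^ p - ga_scale c x ^ p - y ^ p \<in> Jen_lift (r * p)"
      by (rule jacobson_formula[where Z = Jen_lift, OF p_prime of_nat_p_ga r _ _ _ cx])
        (auto intro: ga.subspace_0 ga.subspace_add Jen_lift_subspace Jen_lift_commutator)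
    moreover have "ga_scale c x ^ p \<in> Jen_lift (r * p)"
      using gen[OF step(1)] by (simp add: ga_scale_power ga.subspace_scale[OF Jen_lift_subspace])
    moreover have "y ^ p \<in> Jen_lift (r * p)" using step by blast
    ultimately have "((ga_scale c x + y) ^ p - ga_scale c x ^ p - y ^ p) + ga_scale c x ^ p + y ^ p \<in> Jen_lift (r * p)"
      using ga.subspace_add[OF Jen_lift_subspace] by blast
    then have "(ga_scale c x + y) ^ p \<in> Jen_lift (r * p)" by simp
    moreover have "ga_scale c x + y \<in> Jen_lift r" using cx ga.subspace_add[OF Jen_lift_subspace] by blast
    ultimately show ?case by (simp add: Jen_lift_def)
  qed
  then show ?thesis by blast
qed

lemma lie_system_Jen_lift: "lie_system p Jen_lift"
proof
  have "g \<in> F 1" for g by (simp add: mem_F JP_1 gel_minus_1_aug)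
  then show "aug_I \<subseteq> Jen_lift 1" unfolding aug_ideal_span by (intro ga.span_minimal) (auto simp: Jen_lift_subspace intro: Jen_lift_gel)
qed (rule Jen_lift_subspace, rule Jen_lift_subset_JP, rule JP_subset_Jen_lift, erule (1) Jen_lift_commutator, erule (1) Jen_lift_power)

text \<open>The augmentation ideal consists of the nilpotent elements.\<close>

lemma aut_aug:
  assumes "ga_automorphism \<alpha>" "x \<in> aug_I" shows "\<alpha> x \<in> aug_I"
proof -
  have aug_power: "aug (y ^ n) = aug y ^ n" for y :: "'g \<Rightarrow>\<^sub>0 'k" and n
    by (induction n) (auto simp: aug_mult)
  have "\<alpha> x ^ nil_index = 0"
    using aug_power_0[OF assms(2)] aut_power[OF assms(1), of x nil_index] aut_0[OF assms(1)] by simp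
  then have "aug (\<alpha> x) ^ nil_index = 0" using aug_power[of "\<alpha> x" nil_index] by simp
  then show ?thesis by (simp add: aug_ideal_def)
qed

lemma aut_JP_subset:
  assumes "ga_automorphism \<alpha>" shows "\<alpha> ` JP r \<subseteq> JP r"
proof (induction r)
  case (Suc r)
  have "JP (Suc r) \<subseteq> \<alpha> -` JP (Suc r)"
  proof (rule JP_Suc_subset)
    fix x y assume "x \<in> JP r" "y \<in> aug_I"
    then have "\<alpha> x * \<alpha> y \<in> JP (Suc r)" using Suc aut_aug[OF assms] by (intro JP_SucI) auto
    then show "x * y \<in> \<alpha> -` JP (Suc r)" by (simp add: aut_mult[OF assms])
  next
    show "add_subgroup (\<alpha> -` JP (Suc r))"
      unfolding add_subgroup_def by (simp add: aut_0[OF assms] aut_diff[OF assms] JP_0 JP_diff)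
  qed
  then show ?case by auto
qed simp

lemma aut_JP: 
  assumes "ga_automorphism \<alpha>" shows "\<alpha> ` JP r = JP r"
proof
  have "inv_into UNIV \<alpha> ` JP r \<subseteq> JP r" by (rule aut_JP_subset[OF aut_inv[OF assms]])
  then have "\<alpha> ` inv_into UNIV \<alpha> ` JP r \<subseteq> \<alpha> ` JP r" by blast
  then show "JP r \<subseteq> \<alpha> ` JP r" using aut_bij[OF assms] by (simp add: image_f_inv_f bij_is_surj)
qed (rule aut_JP_subset[OF assms])

lemma lie_system_aut:
  fixes Z :: "nat \<Rightarrow> ('g \<Rightarrow>\<^sub>0 'k) set"
  assumes "lie_system p Z" "ga_automorphism \<alpha>"
  shows "lie_system p (\<lambda>r. \<alpha> ` Z r)"
proof -
  interpret lie_system p k_type g_type Z by fact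
  show ?thesis
  proof
    fix r assume r: "(r :: nat) \<ge> 1"
    show "ga.subspace (\<alpha> ` Z r)" by (rule aut_subspace[OF assms(2) Z_subspace[OF r]])
    show "\<alpha> ` Z r \<subseteq> JP r" "JP (Suc r) \<subseteq> \<alpha> ` Z r"
      using Z_subset[OF r] Z_superset[OF r] aut_JP[OF assms(2)] by blast+
    fix x assume "x \<in> \<alpha> ` Z r"
    then show "x ^ p \<in> \<alpha> ` Z (r * p)" using Z_power[OF r] by (auto simp: aut_power[OF assms(2), symmetric])
    fix s y assume s: "(s :: nat) \<ge> 1" and "y \<in> \<alpha> ` Z s"
    with \<open>x \<in> \<alpha> ` Z r\<close> show "x * y - y * x \<in> \<alpha> ` Z (r + s)"
      using Z_bracket[OF r s] by (auto simp: aut_mult[OF assms(2), symmetric] aut_diff[OF assms(2), symmetric])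
  next
    show "aug_I \<subseteq> \<alpha> ` Z 1" using Z_1 aut_JP[OF assms(2), of "Suc 0"] unfolding JP_1 One_nat_def by blast
  qed
qed

lemma lie_system_Int:
  fixes Z Z' :: "nat \<Rightarrow> ('g \<Rightarrow>\<^sub>0 'k) set"
  assumes "lie_system p Z" "lie_system p Z'"
  shows "lie_system p (\<lambda>r. Z r \<inter> Z' r)"
proof -
  interpret Z: lie_system p k_type g_type Z by fact
  interpret Z': lie_system p k_type g_type Z' by fact
  show ?thesis
  proof
    fix r assume r: "(r :: nat) \<ge> 1"
    show "ga.subspace (Z r \<inter> Z' r)" using Z.Z_subspace[OF r] Z'.Z_subspace[OF r] by (rule ga.subspace_inter)
    show "Z r \<inter> Z' r \<subseteq> JP r" "JP (Suc r) \<subseteq> Z r \<inter> Z' r"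
      using Z.Z_subset[OF r] Z.Z_superset[OF r] Z'.Z_superset[OF r] by blast+
    fix x assume x: "x \<in> Z r \<inter> Z' r"
    then show "x ^ p \<in> Z (r * p) \<inter> Z' (r * p)" using Z.Z_power[OF r] Z'.Z_power[OF r] by blast
    fix s y assume s: "(s :: nat) \<ge> 1" and "y \<in> Z s \<inter> Z' s"
    then show "x * y - y * x \<in> Z (r + s) \<inter> Z' (r + s)"
      using x Z.Z_bracket[OF r s] Z'.Z_bracket[OF r s] by blast
  next
    show "aug_I \<subseteq> Z 1 \<inter> Z' 1" using Z.Z_1 Z'.Z_1 by blast
  qed
qed

definition codim :: "(nat \<Rightarrow> ('g \<Rightarrow>\<^sub>0 'k) set) \<Rightarrow> nat \<Rightarrow> nat"
  where "codim Z r = ga.dim (Z r) - ga.dim (JP (Suc r))"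

text \<open>Bases of the quotients \<open>Z r / J\<^sup>r\<^sup>+\<^sup>1\<close> give a system of ordered monomials that spans \<open>kG\<close>.\<close>

lemma card_le_codim:
  fixes Z :: "nat \<Rightarrow> ('g \<Rightarrow>\<^sub>0 'k) set"
  assumes "lie_system p Z"
  shows "card (UNIV :: 'g set) \<le> p ^ (\<Sum>r\<in>{1..nil_index}. codim Z r)"
proof -
  interpret lie_system p k_type g_type Z by fact
  have "\<forall>r. \<exists>C. C \<subseteq> JP (Suc r) \<and> ga.independent C \<and> JP (Suc r) \<subseteq> ga.span C \<and> card C = ga.dim (JP (Suc r))"
    by (rule allI, rule ga.basis_exists) blast
  from choice[OF this] obtain C where "\<forall>r. C r \<subseteq> JP (Suc r) \<and> ga.independent (C r)
      \<and> JP (Suc r) \<subseteq> ga.span (C r) \<and> card (C r) = ga.dim (JP (Suc r))" ..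
  then have C: "C r \<subseteq> JP (Suc r)" "ga.independent (C r)" "JP (Suc r) \<subseteq> ga.span (C r)"
    "card (C r) = ga.dim (JP (Suc r))" for r by auto
  have "\<forall>r. \<exists>B. r \<ge> 1 \<longrightarrow> C r \<subseteq> B \<and> B \<subseteq> Z r \<and> ga.independent B \<and> Z r \<subseteq> ga.span B"
    using ga.maximal_independent_subset_extend C(1,2) Z_superset by (meson subset_trans)
  from choice[OF this] obtain B where
    "\<forall>r. r \<ge> 1 \<longrightarrow> C r \<subseteq> B r \<and> B r \<subseteq> Z r \<and> ga.independent (B r) \<and> Z r \<subseteq> ga.span (B r)" ..
  then have B: "C r \<subseteq> B r" "B r \<subseteq> Z r" "ga.independent (B r)" "Z r \<subseteq> ga.span (B r)"
    if "r \<ge> 1" for r using that by auto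
  have fin: "finite (B r)" if "r \<ge> 1" for r using ga.independent_bound_general B(3)[OF that] by blast
  have cardD: "card (B r - C r) = codim Z r" if r: "r \<ge> 1" for r
  proof -
    have "card (B r) = ga.dim (Z r)" using B[OF r] ga.basis_card_eq_dim by blast
    then show ?thesis
      using fin[OF r] B[OF r] C[of r] by (simp add: codim_def card_Diff_subset finite_subset)
  qed
  define I where "I = Sigma {1..nil_index} (\<lambda>r. B r - C r)"
  have "finite I" using fin by (auto simp: I_def)
  then obtain js where js: "set js = I" "distinct js" using finite_distinct_list by blast
  interpret pbw_basis p k_type g_type Z js fst snd
  proof
    fix r assume r: "(r :: nat) \<ge> 1"
    show "Z r \<subseteq> ga.span (snd ` {i \<in> set js. fst i = r} \<union> JP (Suc r))"
    proof (cases "r \<le> nil_index")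
      case True
      then have "B r - C r \<subseteq> snd ` {i \<in> set js. fst i = r}"
        using r unfolding js I_def by force
      then have "B r \<subseteq> snd ` {i \<in> set js. fst i = r} \<union> JP (Suc r)" using C(1)[of r] by blast
      then show ?thesis using B(4)[OF r] ga.span_mono by blast
    next
      case False
      then have "Z r \<subseteq> {0}" using Z_subset[OF r] JP_anti[of nil_index r] JP_eventually_0 by auto
      then show ?thesis using ga.span_zero by blast
    qed
  next
    fix i assume "i \<in> set js"
    then show "fst i \<ge> 1" "snd i \<in> Z (fst i)" using js(1) B(2)[of "fst i"] by (auto simp: I_def)
  qed (fact js(2))
  have "length js = card I" using js distinct_card by metis
  also have "\<dots> = (\<Sum>r\<in>{1..nil_index}. codim Z r)"
    unfolding I_def using fin cardD by (subst card_SigmaI) auto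
  finally show ?thesis using card_le_pbw by simp
qed

lemma F_0: "0 \<in> F r"
  by (simp add: mem_F JP_0)

lemma F_Suc_le: "F (Suc r) \<subseteq> F r"
proof
  fix g assume "g \<in> F (Suc r)"
  then show "g \<in> F r" unfolding mem_F by (rule subsetD[OF JP_Suc_le])
qed

lemma gel_add_JP:
  assumes "r \<ge> 1" "u \<in> F r" "v \<in> F r"
  shows "(gk (u + v) - 1) - ((gk u - 1) + (gk v - 1)) \<in> JP (Suc r)"
proof -
  have "(gk (u + v) - 1) - ((gk u - 1) + (gk v - 1)) = (gk u - 1) * (gk v - 1)"
    by (simp add: algebra_simps mult_single)
  also have "\<dots> \<in> JP (r + r)" using assms by (intro JP_mult) (auto simp: mem_F)
  also have "\<dots> \<subseteq> JP (Suc r)" using assms by (intro JP_anti) auto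
  finally show ?thesis .
qed

lemma F_add: "r \<ge> 1 \<Longrightarrow> u \<in> F r \<Longrightarrow> v \<in> F r \<Longrightarrow> u + v \<in> F r"
  using gel_add_JP[of r u v] JP_Suc_le[of r] JP_add[of "(gk (u + v) - 1) - ((gk u - 1) + (gk v - 1))" r "(gk u - 1) + (gk v - 1)"]
    JP_add[of "gk u - 1" r "gk v - 1"] by (auto simp: mem_F)

text \<open>Combinations with coefficients in the prime field of elements \<open>g - 1\<close> that are independent modulo the
  next power of the radical are represented by group elements in different cosets.\<close>

lemma card_F_Suc:
  assumes r: "r \<ge> 1" shows "p ^ codim Jen_lift r * card (F (Suc r)) \<le> card (F r)"
proof -
  let ?X = "(\<lambda>g. gk g - 1) ` F r"
  obtain C where C: "C \<subseteq> JP (Suc r)" "ga.independent C" "JP (Suc r) \<subseteq> ga.span C"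
      "card C = ga.dim (JP (Suc r))"
    using ga.basis_exists[of "JP (Suc r)"] by metis
  have spanC: "ga.span C = JP (Suc r)" using C JP_subspace by (simp add: ga.span_minimal subset_antisym)
  obtain B where B: "C \<subseteq> B" "B \<subseteq> C \<union> ?X" "ga.independent B" "C \<union> ?X \<subseteq> ga.span B"
    using ga.maximal_independent_subset_extend[of C "C \<union> ?X"] C by blast
  define D where "D = B - C"
  have fin: "finite B" using ga.independent_bound_general B(3) by blast
  have "ga.span B = Jen_lift r"
  proof
    show "ga.span B \<subseteq> Jen_lift r"
      using B(2) C(1) JP_subset_Jen_lift Jen_lift_gel Jen_lift_subspace by (intro ga.span_minimal) blast+
    have "JP (Suc r) \<subseteq> ga.span B" using ga.span_mono[OF B(1)] spanC by simp
    then show "Jen_lift r \<subseteq> ga.span B" unfolding Jen_lift_def using B(4) by (intro ga.span_minimal) auto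
  qed
  then have cardD: "card D = codim Jen_lift r"
    using B fin C by (simp add: codim_def D_def card_Diff_subset finite_subset flip: ga.dim_span[of B] ga.dim_eq_card_independent)
  define s where "s a = (\<Sum>x\<in>D. ga_scale (of_nat (a x)) x)" for a :: "_ \<Rightarrow> nat"
  have multiple: "\<exists>u\<in>F r. gk u - 1 - ga_scale (of_nat n) (gk g - 1) \<in> JP (Suc r)" if g: "g \<in> F r" for g n
  proof (induction n)
    case 0
    then show ?case using F_0 JP_0 by (intro bexI[of _ 0]) auto
  next
    case (Suc n)
    then obtain u where u: "u \<in> F r" "gk u - 1 - ga_scale (of_nat n) (gk g - 1) \<in> JP (Suc r)" by blast
    have eq: "gk (g + u) - 1 - ga_scale (of_nat (Suc n)) (gk g - 1)
        = ((gk (g + u) - 1) - ((gk g - 1) + (gk u - 1))) + (gk u - 1 - ga_scale (of_nat n) (gk g - 1))"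
      by (simp add: ga.scale_left_distrib)
    show ?case
      by (rule bexI[OF _ F_add[OF r g u(1)]], unfold eq) (rule JP_add[OF gel_add_JP[OF r g u(1)] u(2)])
  qed
  have "\<exists>u\<in>F r. gk u - 1 - (\<Sum>x\<in>E. ga_scale (of_nat (a x)) x) \<in> JP (Suc r)"
    if "finite E" "E \<subseteq> D" for E and a :: "_ \<Rightarrow> nat"
    using that
  proof (induction E rule: finite_induct)
    case empty
    then show ?case using F_0 JP_0 by (intro bexI[of _ 0]) auto
  next
    case (insert x E)
    then obtain u where u: "u \<in> F r" "gk u - 1 - (\<Sum>x\<in>E. ga_scale (of_nat (a x)) x) \<in> JP (Suc r)" by auto
    have "x \<in> ?X" using insert B by (auto simp: D_def)
    then obtain v where v: "v \<in> F r" "gk v - 1 - ga_scale (of_nat (a x)) x \<in> JP (Suc r)" using multiple by blast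
    have eq: "gk (v + u) - 1 - (\<Sum>x\<in>insert x E. ga_scale (of_nat (a x)) x)
        = ((gk (v + u) - 1) - ((gk v - 1) + (gk u - 1)))
          + ((gk v - 1 - ga_scale (of_nat (a x)) x) + (gk u - 1 - (\<Sum>x\<in>E. ga_scale (of_nat (a x)) x)))"
      using insert by simp
    show ?case
      by (rule bexI[OF _ F_add[OF r v(1) u(1)]], unfold eq)
        (rule JP_add[OF gel_add_JP[OF r v(1) u(1)] JP_add[OF v(2) u(2)]])
  qed
  then have "\<forall>a. \<exists>u\<in>F r. gk u - 1 - s a \<in> JP (Suc r)" using fin by (auto simp: s_def D_def)
  then obtain U where U: "U a \<in> F r" "gk (U a) - 1 - s a \<in> JP (Suc r)" for a by metis
  let ?P = "Pi\<^sub>E D (\<lambda>_. {..<p})"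
  have inj: "inj_on (\<lambda>(a, f). U a + f) (?P \<times> F (Suc r))"
  proof (rule inj_onI, clarify)
    fix a f a' f' assume a: "a \<in> ?P" "a' \<in> ?P" and f: "f \<in> F (Suc r)" "f' \<in> F (Suc r)" and eq: "U a + f = U a' + f'"
    have FF: "f \<in> F r" if "f \<in> F (Suc r)" for f using that F_Suc_le by blast
    have 1: "gk (U a + f) - 1 - s a \<in> JP (Suc r)" if "f \<in> F (Suc r)" for a f
    proof -
      have eq: "gk (U a + f) - 1 - s a = ((gk (U a + f) - 1) - ((gk (U a) - 1) + (gk f - 1))) + ((gk (U a) - 1 - s a) + (gk f - 1))"
        by simp
      have "gk f - 1 \<in> JP (Suc r)" using that mem_F by simp
      then show ?thesis
        unfolding eq by (intro JP_add[OF gel_add_JP[OF r U(1)[of a] FF[OF that]] JP_add[OF U(2)[of a]]])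
    qed
    have "s a - s a' \<in> JP (Suc r)" using JP_diff[OF 1[OF f(2), of a'] 1[OF f(1), of a]] eq by simp
    then have "(\<Sum>x\<in>B - C. ga_scale (of_nat (a x) - of_nat (a' x)) x) \<in> ga.span C"
      unfolding spanC s_def D_def by (simp add: ga.scale_left_diff_distrib sum_subtractf)
    from independent_sum_in_span[OF B(3,1) this]
    have "(of_nat (a x) - of_nat (a' x) :: 'k) = 0" if "x \<in> D" for x
      using that by (simp add: D_def)
    then have "a x = a' x" if "x \<in> D" for x
      using of_nat_inj_below_p[of "a x" "a' x"] that a by (auto simp: PiE_iff)
    then have "a = a'" using a by (intro PiE_ext) auto
    then show "a = a' \<and> f = f'" using eq by simp
  qed
  have "(\<lambda>(a, f). U a + f) ` (?P \<times> F (Suc r)) \<subseteq> F r"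
  proof clarify
    fix a f assume "f \<in> F (Suc r)"
    then show "U a + f \<in> F r" by (rule F_add[OF r U(1) subsetD[OF F_Suc_le]])
  qed
  then have "card (?P \<times> F (Suc r)) \<le> card (F r)" by (rule card_inj_on_le[OF inj]) (rule finite)
  moreover have "finite D" using fin by (simp add: D_def)
  then have "card ?P = p ^ codim Jen_lift r" by (simp only: card_PiE prod_constant card_lessThan cardD)
  ultimately show ?thesis by (simp only: card_cartesian_product)
qed

lemma codim_le_card: "p ^ (\<Sum>r\<in>{1..nil_index}. codim Jen_lift r) \<le> card (UNIV :: 'g set)"
proof -
  have "p ^ (\<Sum>r\<in>{1..m}. codim Jen_lift r) * card (F (Suc m)) \<le> card (UNIV :: 'g set)" for m
  proof (induction m)
    case 0
    then show ?case by (simp add: card_mono)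
  next
    case (Suc m)
    have "p ^ (\<Sum>r\<in>{1..Suc m}. codim Jen_lift r) * card (F (Suc (Suc m)))
        = p ^ (\<Sum>r\<in>{1..m}. codim Jen_lift r) * (p ^ codim Jen_lift (Suc m) * card (F (Suc (Suc m))))"
      by (simp add: power_add)
    also have "\<dots> \<le> p ^ (\<Sum>r\<in>{1..m}. codim Jen_lift r) * card (F (Suc m))"
      by (rule mult_le_mono2) (rule card_F_Suc, simp)
    finally show ?case using Suc by simp
  qed
  from this[of nil_index] show ?thesis
  proof (rule order_trans[rotated])
    have "card (F (Suc nil_index)) \<noteq> 0" using F_0[of "Suc nil_index"] by auto
    then have "1 \<le> card (F (Suc nil_index))" by linarith
    from mult_le_mono2[OF this] show "p ^ (\<Sum>r\<in>{1..nil_index}. codim Jen_lift r)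
        \<le> p ^ (\<Sum>r\<in>{1..nil_index}. codim Jen_lift r) * card (F (Suc nil_index))"
      by (simp only: mult_1_right)
  qed
qed

lemma card_eq_codim: "card (UNIV :: 'g set) = p ^ (\<Sum>r\<in>{1..nil_index}. codim Jen_lift r)"
  using codim_le_card card_le_codim[OF lie_system_Jen_lift] by simp

text \<open>The monomials in a basis of \<open>Z\<close> already span \<open>kG\<close>, so by counting \<open>Z\<close> cannot be smaller
  than the Lie algebra of the dimension subgroups.\<close>

lemma lie_subsystem_eq:
  fixes Z :: "nat \<Rightarrow> ('g \<Rightarrow>\<^sub>0 'k) set"
  assumes Z: "lie_system p Z" and sub: "\<And>r. r \<ge> 1 \<Longrightarrow> Z r \<subseteq> Jen_lift r" and r: "r \<ge> 1"
  shows "Z r = Jen_lift r"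
proof (cases "r \<le> nil_index")
  case True
  interpret lie_system p k_type g_type Z by fact
  have le: "codim Z r \<le> codim Jen_lift r" if "r \<ge> 1" for r
    unfolding codim_def using ga.dim_subset[OF sub[OF that]] by simp
  have "codim Z r = codim Jen_lift r"
  proof (rule ccontr)
    assume "codim Z r \<noteq> codim Jen_lift r"
    then have "(\<Sum>r\<in>{1..nil_index}. codim Z r) < (\<Sum>r\<in>{1..nil_index}. codim Jen_lift r)"
      using le r True by (intro sum_strict_mono_ex1) (auto intro!: bexI[of _ r] simp: le_neq_implies_less)
    then have "p ^ (\<Sum>r\<in>{1..nil_index}. codim Z r) < p ^ (\<Sum>r\<in>{1..nil_index}. codim Jen_lift r)"
      using prime_gt_1_nat[OF p_prime] by simp
    then show False using card_le_codim[OF Z] card_eq_codim by simp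
  qed
  moreover have "ga.dim (JP (Suc r)) \<le> ga.dim (Z r)" by (rule ga.dim_subset[OF Z_superset[OF r]])
  ultimately have "ga.dim (Jen_lift r) \<le> ga.dim (Z r)" by (simp add: codim_def)
  then show ?thesis using ga.subspace_dim_equal[OF Z_subspace[OF r] Jen_lift_subspace sub[OF r]] by blast
next
  case False
  then have "Jen_lift r \<subseteq> {0}" using Jen_lift_subset_JP[of r] JP_anti[of nil_index r] JP_eventually_0 by auto
  moreover have "0 \<in> Z r" using lie_system.Z_subspace[OF Z r] by (rule ga.subspace_0)
  ultimately show ?thesis using sub[OF r] by blast
qed

text \<open>The image of the Lie algebra of the dimension subgroups is another Lie system, and their intersection
  is one inside both.\<close>

lemma aut_Jen_lift:
  assumes "ga_automorphism \<alpha>" "r \<ge> 1" shows "\<alpha> ` Jen_lift r = Jen_lift r"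
proof -
  have sub: "Jen_lift r \<subseteq> \<beta> ` Jen_lift r" if "ga_automorphism \<beta>" for \<beta>
    using lie_subsystem_eq[OF lie_system_Int[OF lie_system_Jen_lift lie_system_aut[OF lie_system_Jen_lift that]] _ assms(2)] by auto
  have "\<alpha> ` Jen_lift r \<subseteq> \<alpha> ` inv_into UNIV \<alpha> ` Jen_lift r" using sub[OF aut_inv[OF assms(1)]] by blast
  also have "\<dots> = Jen_lift r" using aut_bij[OF assms(1)] by (simp add: image_f_inv_f bij_is_surj)
  finally show ?thesis using sub[OF assms(1)] by blast
qed

end

section \<open>The dimension subquotients as vector spaces\<close>

context modular_p_group begin

abbreviation jq :: "nat \<Rightarrow> ('k, ('g \<Rightarrow>\<^sub>0 'k) set) module" where "jq \<equiv> jac_quot"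

abbreviation jen :: "nat \<Rightarrow> ('k, ('g \<Rightarrow>\<^sub>0 'k) set) module" where "jen \<equiv> Jen"

definition cl :: "nat \<Rightarrow> ('g \<Rightarrow>\<^sub>0 'k) \<Rightarrow> ('g \<Rightarrow>\<^sub>0 'k) set"
  where "cl r x = x +o JP (Suc r)"

lemma mem_cl: "y \<in> cl r x \<longleftrightarrow> y - x \<in> JP (Suc r)"
  unfolding cl_def elt_set_plus_def by (auto simp: algebra_simps intro!: bexI[of _ "y - x"])

lemma cl_eq: "cl r x = cl r y \<longleftrightarrow> x - y \<in> JP (Suc r)"
proof
  assume "cl r x = cl r y"
  moreover have "x \<in> cl r x" by (simp add: mem_cl JP_0)
  ultimately show "x - y \<in> JP (Suc r)" by (simp add: mem_cl)
next
  assume a: "x - y \<in> JP (Suc r)"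
  have "z - y \<in> JP (Suc r)" if "z - x \<in> JP (Suc r)" for z using JP_add[OF that a] by simp
  moreover have "z - x \<in> JP (Suc r)" if "z - y \<in> JP (Suc r)" for z using JP_diff[OF that a] by simp
  ultimately show "cl r x = cl r y" by (auto simp: mem_cl)
qed

lemma cl_add: "cl r x + cl r y = cl r (x + y)"
proof (intro equalityI subsetI)
  fix z assume "z \<in> cl r x + cl r y"
  then obtain a b where "z = a + b" "a - x \<in> JP (Suc r)" "b - y \<in> JP (Suc r)"
    by (auto simp: set_plus_def mem_cl)
  then show "z \<in> cl r (x + y)" using JP_add[of "a - x" "Suc r" "b - y"] by (simp add: mem_cl algebra_simps)
next
  fix z assume "z \<in> cl r (x + y)"
  then have "z = x + (z - x)" "x \<in> cl r x" "z - x \<in> cl r y" by (simp_all add: mem_cl JP_0 algebra_simps)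
  then show "z \<in> cl r x + cl r y" by (metis set_plus_intro)
qed

lemma cl_0: "cl r 0 = JP (Suc r)"
  by (auto simp: mem_cl)

lemma jq_simps [simp]:
  "carrier (jq r) = cl r ` JP r"
  "cl r x \<oplus>\<^bsub>jq r\<^esub> cl r y = cl r (x + y)"
  "\<zero>\<^bsub>jq r\<^esub> = cl r 0"
  by (auto simp: jac_quot_def cl_add) (auto simp: cl_def cl_0)

lemma jq_smult [simp]: "c \<odot>\<^bsub>jq r\<^esub> cl r x = cl r (ga_scale c x)"
proof -
  have "ga_scale c ` cl r x + JP (Suc r) = cl r (ga_scale c x)"
  proof (intro equalityI subsetI)
    fix z assume "z \<in> ga_scale c ` cl r x + JP (Suc r)"
    then obtain a b where "z = ga_scale c a + b" "a - x \<in> JP (Suc r)" "b \<in> JP (Suc r)"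
      by (auto simp: set_plus_def mem_cl)
    then have "z - ga_scale c x = ga_scale c (a - x) + b" "ga_scale c (a - x) \<in> JP (Suc r)"
      by (simp add: ga.scale_right_diff_distrib, intro ga.subspace_scale[OF JP_subspace])
    then show "z \<in> cl r (ga_scale c x)" using JP_add[OF _ \<open>b \<in> JP (Suc r)\<close>] by (simp add: mem_cl)
  next
    fix z assume z: "z \<in> cl r (ga_scale c x)"
    have "ga_scale c x \<in> ga_scale c ` cl r x" by (rule imageI) (simp add: mem_cl JP_0)
    moreover have "z - ga_scale c x \<in> JP (Suc r)" using z by (simp add: mem_cl)
    ultimately have "ga_scale c x + (z - ga_scale c x) \<in> ga_scale c ` cl r x + JP (Suc r)"
      by (rule set_plus_intro)
    then show "z \<in> ga_scale c ` cl r x + JP (Suc r)" by simp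
  qed
  then show ?thesis by (simp add: jac_quot_def)
qed

lemma jq_vectorspace: "vectorspace class_ring (jq r)"
proof (rule vs_criteria[OF class_field])
  show "\<forall>v\<in>carrier (jq r). \<exists>neg_v\<in>carrier (jq r). v \<oplus>\<^bsub>jq r\<^esub> neg_v = \<zero>\<^bsub>jq r\<^esub>"
  proof
    fix v assume "v \<in> carrier (jq r)"
    then obtain x where x: "v = cl r x" "x \<in> JP r" by auto
    have "- x \<in> JP r" using JP_diff[OF JP_0 x(2)] by simp
    then show "\<exists>neg_v\<in>carrier (jq r). v \<oplus>\<^bsub>jq r\<^esub> neg_v = \<zero>\<^bsub>jq r\<^esub>"
      using x(1) by (intro bexI[of _ "cl r (- x)"]) simp_all
  qed
qed (auto simp: class_ring_simps JP_0 JP_add ga.subspace_scale[OF JP_subspace] ac_simps ga.scale_left_distrib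
    ga.scale_right_distrib)

lemma jq_submodule:
  assumes "ga.subspace S" "S \<subseteq> JP r" shows "LinearCombinations.submodule class_ring (cl r ` S) (jq r)"
  unfolding submodule_def
  using assms jq_vectorspace[of r] unfolding vectorspace_def
  by (auto simp: class_ring_simps ga.subspace_0 ga.subspace_add ga.subspace_scale)

lemma jen_set_span:
  "(jen_set r :: ('g \<Rightarrow>\<^sub>0 'k) set set)
    = LinearCombinations.module.span class_ring (jq r) ((\<lambda>g. cl r (gk g - 1)) ` F r)"
  unfolding jen_set_def
  by (intro arg_cong[of _ _ "LinearCombinations.module.span class_ring (jq r)"])
    (auto simp: cl_def dim_subgroup_def)

lemma jen_set_eq: "jen_set r = cl r ` Jen_lift r"
proof -
  interpret jq: vectorspace "class_ring :: 'k ring" "jq r" by (rule jq_vectorspace)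
  let ?G = "(\<lambda>g. cl r (gk g - 1)) ` F r"
  note js = jen_set_span[of r]
  have G: "?G \<subseteq> carrier (jq r)" by (auto simp: mem_F)
  have sm: "LinearCombinations.submodule class_ring (jq.span ?G) (jq r)" by (rule jq.span_is_submodule[OF G])
  show ?thesis
  proof
    show "jen_set r \<subseteq> cl r ` Jen_lift r" unfolding js
      by (rule jq.span_is_subset[OF _ jq_submodule]) (use Jen_lift_gel Jen_lift_subspace Jen_lift_subset_JP in auto)
    have "cl r y \<in> jq.span ?G" if "y \<in> Jen_lift r" for y
      using that unfolding Jen_lift_def
    proof (induction rule: ga.span_induct_alt)
      case base
      then show ?case using sm by (simp add: submodule_def)
    next
      case (step c x y)
      have "cl r x \<in> jq.span ?G"
      proof (cases "x \<in> JP (Suc r)")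
        case True
        then have "cl r x = \<zero>\<^bsub>jq r\<^esub>" by (simp add: cl_eq)
        then show ?thesis using sm by (simp add: submodule_def)
      next
        case False
        then show ?thesis using step(1) jq.in_own_span[OF G] by auto
      qed
      then have "c \<odot>\<^bsub>jq r\<^esub> cl r x \<in> jq.span ?G" using sm by (auto simp: submodule_def class_ring_simps simp del: jq_smult)
      then have "(c \<odot>\<^bsub>jq r\<^esub> cl r x) \<oplus>\<^bsub>jq r\<^esub> cl r y \<in> jq.span ?G"
        using step(2) sm by (auto simp: submodule_def simp del: jq_smult)
      then show ?case by simp
    qed
    then show "cl r ` Jen_lift r \<subseteq> jen_set r" unfolding js by auto
  qed
qed

lemma Jen_simps [simp]:
  "carrier (jen r) = cl r ` Jen_lift r"
  "cl r x \<oplus>\<^bsub>jen r\<^esub> cl r y = cl r (x + y)"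
  "\<zero>\<^bsub>jen r\<^esub> = cl r 0"
  "c \<odot>\<^bsub>jen r\<^esub> cl r x = cl r (ga_scale c x)"
  using jq_simps[of r] jq_smult by (simp_all add: Jen_def jen_set_eq)

lemma Jen_subspace: "subspace class_ring (carrier (jen r)) (jq r)"
  unfolding subspace_def using jq_vectorspace jq_submodule[OF Jen_lift_subspace Jen_lift_subset_JP] by simp

lemma Jen_vectorspace: "vectorspace class_ring (jen r)"
  using vectorspace.subspace_is_vs[OF jq_vectorspace Jen_subspace, of r] by (simp add: Jen_def jen_set_eq)

lemma Jen_finsum:
  assumes "finite I" "\<And>i. i \<in> I \<Longrightarrow> x i \<in> Jen_lift r"
  shows "(\<Oplus>\<^bsub>jen r\<^esub>i\<in>I. cl r (x i)) = cl r (\<Sum>i\<in>I. x i)"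
proof -
  interpret vectorspace "class_ring :: 'k ring" "jen r" by (rule Jen_vectorspace)
  show ?thesis using assms
  proof (induction I rule: finite_induct)
    case (insert i I)
    have "(\<Oplus>\<^bsub>jen r\<^esub>i\<in>insert i I. cl r (x i)) = cl r (x i) \<oplus>\<^bsub>jen r\<^esub> (\<Oplus>\<^bsub>jen r\<^esub>i\<in>I. cl r (x i))"
      by (rule M.finsum_insert) (use insert in auto)
    then show ?case using insert by simp
  qed simp
qed

lemma cl_aut: "ga_automorphism \<alpha> \<Longrightarrow> \<alpha> ` cl r x = cl r (\<alpha> x)"
  unfolding cl_def elt_set_plus_def using aut_JP[of \<alpha> "Suc r"]
  by (auto simp: aut_add image_iff) (metis aut_add imageE)

lemma jac_quot_map_cl: "ga_automorphism \<alpha> \<Longrightarrow> x \<in> JP r \<Longrightarrow> jac_quot_map \<alpha> r (cl r x) = cl r (\<alpha> x)"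
  by (simp add: jac_quot_map_def cl_aut)

lemma Jen_map_cl:
  assumes "ga_automorphism \<alpha>" "x \<in> Jen_lift r" shows "Jen_map \<alpha> r (cl r x) = cl r (\<alpha> x)"
  using assms Jen_lift_subset_JP by (auto simp: Jen_map_def jac_quot_map_cl subset_iff)

lemma jac_quot_map_Jen:
  assumes "ga_automorphism \<alpha>" "r \<ge> 1"
  shows "jac_quot_map \<alpha> r ` carrier (jen r) = carrier (jen r)"
proof -
  have "jac_quot_map \<alpha> r ` cl r ` Jen_lift r = cl r ` \<alpha> ` Jen_lift r"
    unfolding image_image by (rule image_cong) (use assms Jen_lift_subset_JP in \<open>auto simp: jac_quot_map_cl subset_iff\<close>)
  then show ?thesis by (simp add: aut_Jen_lift[OF assms])
qed

lemma Jen_map_linear: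
  assumes "ga_automorphism \<alpha>" "r \<ge> 1"
  shows "linear_map class_ring (jen r) (jen r) (Jen_map \<alpha> r)"
proof -
  interpret vectorspace "class_ring :: 'k ring" "jen r" by (rule Jen_vectorspace)
  have \<alpha>Y: "\<alpha> x \<in> Jen_lift r" if "x \<in> Jen_lift r" for x using aut_Jen_lift[OF assms] that by blast
  have "Jen_map \<alpha> r \<in> LinearCombinations.module_hom class_ring (jen r) (jen r)"
    unfolding LinearCombinations.module_hom_def
    using \<alpha>Y Jen_lift_subspace[of r]
    by (auto simp: class_ring_simps Jen_map_cl[OF assms(1)] aut_add[OF assms(1)] aut_scale[OF assms(1)]
        ga.subspace_add ga.subspace_scale)
  then show ?thesis
    unfolding linear_map_def mod_hom_def mod_hom_axioms_def
    using Jen_vectorspace[of r] by (simp add: vectorspace_def)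
qed

lemma Jen_map_bij:
  assumes "ga_automorphism \<alpha>" "r \<ge> 1"
  shows "bij_betw (Jen_map \<alpha> r) (carrier (jen r)) (carrier (jen r))"
proof -
  have "Jen_map \<alpha> r ` carrier (jen r) = carrier (jen r)"
    using jac_quot_map_Jen[OF assms] by (simp add: Jen_map_def)
  moreover have "inj_on (Jen_map \<alpha> r) (carrier (jen r))"
  proof (rule inj_onI)
    fix C D assume CD: "C \<in> carrier (jen r)" "D \<in> carrier (jen r)" and eq: "Jen_map \<alpha> r C = Jen_map \<alpha> r D"
    then obtain x y where xy: "C = cl r x" "D = cl r y" "x \<in> Jen_lift r" "y \<in> Jen_lift r" by auto
    then have "\<alpha> ` C = \<alpha> ` D" using eq by (simp add: Jen_map_cl[OF assms(1)] cl_aut[OF assms(1)])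
    then show "C = D" using aut_bij[OF assms(1)] by (simp add: bij_is_inj inj_image_eq_iff)
  qed
  ultimately show ?thesis by (simp add: bij_betw_def)
qed

lemma independent_mod_le_codim:
  fixes b :: "nat \<Rightarrow> ('g \<Rightarrow>\<^sub>0 'k)"
  assumes b: "\<And>i. i < d \<Longrightarrow> b i \<in> Jen_lift r"
    and indep: "\<And>c. (\<Sum>i<d. ga_scale (c i) (b i)) \<in> JP (Suc r) \<Longrightarrow> \<forall>i<d. c i = 0"
  shows "d \<le> codim Jen_lift r"
proof -
  obtain C where C: "C \<subseteq> JP (Suc r)" "ga.independent C" "JP (Suc r) \<subseteq> ga.span C"
      "card C = ga.dim (JP (Suc r))"
    using ga.basis_exists[of "JP (Suc r)"] by metis
  have fin: "finite C" using ga.independent_bound_general C(2) by blast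
  have spanC: "ga.span C = JP (Suc r)" using C JP_subspace by (simp add: ga.span_minimal subset_antisym)
  have delta: "(\<Sum>k<d. ga_scale (if k = i then 1 else 0) (b k)) = b i" if "i < d" for i
  proof -
    have "(\<Sum>k<d. ga_scale (if k = i then 1 else 0) (b k)) = (\<Sum>k<d. if k = i then b k else 0)"
      by (rule sum.cong) auto
    then show ?thesis using that by simp
  qed
  have inj: "inj_on b {..<d}"
  proof (rule inj_onI, rule ccontr)
    fix i j assume ij: "i \<in> {..<d}" "j \<in> {..<d}" "b i = b j" "i \<noteq> j"
    let ?c = "\<lambda>k. (if k = i then 1 else 0) - (if k = j then 1 else 0) :: 'k"
    have "(\<Sum>k<d. ga_scale (?c k) (b k)) = b i - b j"
      unfolding ga.scale_left_diff_distrib sum_subtractf using ij by (simp only: delta lessThan_iff)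
    then have "(\<Sum>k<d. ga_scale (?c k) (b k)) \<in> JP (Suc r)" using ij(3) JP_0 by simp
    from indep[OF this] have "?c i = 0" using ij(1) by blast
    then show False using ij(4) by simp
  qed
  have disj: "C \<inter> b ` {..<d} = {}"
  proof (rule ccontr)
    assume "C \<inter> b ` {..<d} \<noteq> {}"
    then obtain j where j: "j < d" "b j \<in> C" by auto
    let ?c = "\<lambda>k. (if k = j then 1 else 0) :: 'k"
    have "(\<Sum>k<d. ga_scale (?c k) (b k)) \<in> JP (Suc r)" unfolding delta[OF j(1)] using j(2) C(1) by blast
    from indep[OF this] have "?c j = 0" using j(1) by blast
    then show False by simp
  qed
  have "ga.independent (C \<union> b ` {..<d})"
  proof
    assume "ga.dependent (C \<union> b ` {..<d})"
    then obtain u where u: "\<exists>v\<in>C \<union> b ` {..<d}. u v \<noteq> 0" "(\<Sum>v\<in>C \<union> b ` {..<d}. ga_scale (u v) v) = 0"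
      using fin by (auto simp: ga.dependent_finite)
    have "(\<Sum>v\<in>C \<union> b ` {..<d}. ga_scale (u v) v)
        = (\<Sum>v\<in>C. ga_scale (u v) v) + (\<Sum>i<d. ga_scale (u (b i)) (b i))"
      using fin disj inj by (simp add: sum.union_disjoint sum.reindex)
    then have s: "(\<Sum>i<d. ga_scale (u (b i)) (b i)) = - (\<Sum>v\<in>C. ga_scale (u v) v)"
      using u(2) by (simp add: eq_neg_iff_add_eq_0 add.commute)
    also have "\<dots> \<in> JP (Suc r)"
      unfolding spanC[symmetric] by (intro ga.span_neg ga.span_sum ga.span_scale ga.span_base)
    finally have "(\<Sum>i<d. ga_scale (u (b i)) (b i)) \<in> JP (Suc r)" .
    from indep[OF this] have ub: "u (b i) = 0" if "i < d" for i using that by blast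
    then have "(\<Sum>v\<in>C. ga_scale (u v) v) = 0" using s by simp
    then have "u v = 0" if "v \<in> C" for v using C(2) fin that by (auto simp: ga.dependent_finite)
    then show False using u(1) ub by auto
  qed
  moreover have "C \<union> b ` {..<d} \<subseteq> Jen_lift r" using C(1) JP_subset_Jen_lift b by auto
  ultimately have "card (C \<union> b ` {..<d}) \<le> ga.dim (Jen_lift r)" by (intro ga.independent_card_le_dim)
  moreover have "card (C \<union> b ` {..<d}) = card C + d"
    using fin disj inj by (simp add: card_Un_disjoint card_image)
  ultimately show ?thesis using C(4) by (simp add: codim_def)
qed

lemma lincomb_list:
  assumes "distinct bs" "\<And>i. i < length bs \<Longrightarrow> bs ! i = cl r (b i) \<and> b i \<in> Jen_lift r"
  shows "LinearCombinations.module.lincomb (jen r) a (set bs) = cl r (\<Sum>i<length bs. ga_scale (a (bs ! i)) (b i))"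
proof -
  interpret vectorspace "class_ring :: 'k ring" "jen r" by (rule Jen_vectorspace)
  have inj: "inj_on ((!) bs) {..<length bs}" using assms(1) by (simp add: inj_on_nth)
  have set: "set bs = (!) bs ` {..<length bs}" by (auto simp: set_conv_nth)
  have "lincomb a (set bs) = (\<Oplus>\<^bsub>jen r\<^esub>i\<in>{..<length bs}. a (bs ! i) \<odot>\<^bsub>jen r\<^esub> (bs ! i))"
    unfolding lincomb_def unfolding set
    by (rule M.finsum_reindex[OF _ inj]) (use assms(2) ga.subspace_scale[OF Jen_lift_subspace] in auto)
  also have "\<dots> = (\<Oplus>\<^bsub>jen r\<^esub>i\<in>{..<length bs}. cl r (ga_scale (a (bs ! i)) (b i)))"
    by (rule M.finsum_cong') (use assms(2) ga.subspace_scale[OF Jen_lift_subspace] in auto)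
  also have "\<dots> = cl r (\<Sum>i<length bs. ga_scale (a (bs ! i)) (b i))"
    by (rule Jen_finsum) (use assms(2) ga.subspace_scale[OF Jen_lift_subspace] in auto)
  finally show ?thesis .
qed

text \<open>The basis and the matrix behind \<open>endo_det\<close>, lifted from \<open>Jen\<^sub>r(G)\<close> to \<open>kG\<close>.\<close>

lemma endo_det_representation:
  assumes \<alpha>: "ga_automorphism \<alpha>" and r: "r \<ge> 1"
  obtains d b A where "A \<in> carrier_mat d d" "endo_det (jen r) (Jen_map \<alpha> r) = det A" "d \<le> codim Jen_lift r"
    "\<And>i. i < d \<Longrightarrow> b i \<in> Jen_lift r" "Jen_lift r \<subseteq> ga.span (b ` {..<d} \<union> JP (Suc r))"
    "\<And>j. j < d \<Longrightarrow> \<alpha> (b j) - comb d b A j \<in> JP (Suc r)"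
proof -
  interpret jq: vectorspace "class_ring :: 'k ring" "jq r" by (rule jq_vectorspace)
  interpret je: vectorspace "class_ring :: 'k ring" "jen r" by (rule Jen_vectorspace)
  let ?T = "Jen_map \<alpha> r"
  let ?P = "\<lambda>d. \<exists>bs A. distinct bs \<and> je.basis (set bs) \<and> represents_endo (jen r) bs ?T A \<and> d = det A"
  have lift: "\<exists>b. \<forall>i<length bs. bs ! i = cl r (b i) \<and> b i \<in> Jen_lift r" if "je.basis (set bs)" for bs
  proof -
    have "\<forall>i. \<exists>x. i < length bs \<longrightarrow> bs ! i = cl r x \<and> x \<in> Jen_lift r"
      using that nth_mem[of _ bs] unfolding je.basis_def Jen_simps by (metis imageE subsetD)
    then show ?thesis by metis
  qed
  have "\<exists>d. ?P d"
  proof -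
    let ?G = "(\<lambda>g. cl r (gk g - 1)) ` F r"
    have G: "?G \<subseteq> cl r ` Jen_lift r" using Jen_lift_gel by auto
    have "je.span ?G = jq.span ?G"
      using jq.span_li_not_depend(1)[OF G jq_submodule[OF Jen_lift_subspace Jen_lift_subset_JP]] by (simp add: Jen_def jen_set_eq)
    then have "je.span ?G = carrier (jen r)" using jen_set_span[of r] by (simp add: jen_set_eq)
    then have "je.fin_dim" unfolding je.fin_dim_def using G by (intro exI[of _ ?G]) auto
    then obtain \<beta> where \<beta>: "finite \<beta>" "je.basis \<beta>" using je.finite_basis_exists by blast
    obtain bs where bs: "set bs = \<beta>" "distinct bs" using finite_distinct_list[OF \<beta>(1)] by blast
    obtain b where b: "\<forall>i<length bs. bs ! i = cl r (b i) \<and> b i \<in> Jen_lift r" using lift bs \<beta> by blast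
    have "\<exists>a. je.lincomb a (set bs) = ?T (bs ! j)" if "j < length bs" for j
    proof -
      have "bs ! j \<in> carrier (jen r)" using b that by auto
      then have "?T (bs ! j) \<in> carrier (jen r)" using Jen_map_bij[OF \<alpha> r] bij_betwE by blast
      then have "?T (bs ! j) \<in> je.span (set bs)" using \<beta>(2) bs by (simp add: je.basis_def)
      then show ?thesis
        using je.finite_in_span[of "set bs" "?T (bs ! j)"] \<beta>(2) bs unfolding je.basis_def by blast
    qed
    then obtain a where a: "\<And>j. j < length bs \<Longrightarrow> je.lincomb (a j) (set bs) = ?T (bs ! j)" by metis
    let ?n = "length bs"
    let ?A = "mat ?n ?n (\<lambda>(i, j). a j (bs ! i))"
    have "represents_endo (jen r) bs ?T ?A"
      unfolding represents_endo_def
    proof (intro conjI allI impI)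
      fix j assume j: "j < ?n"
      have "?T (bs ! j) = cl r (\<Sum>i<?n. ga_scale (a j (bs ! i)) (b i))"
        using a[OF j] lincomb_list[OF bs(2), of r b "a j"] b by simp
      also have "\<dots> = (\<Oplus>\<^bsub>jen r\<^esub>i\<in>{..<?n}. cl r (ga_scale (a j (bs ! i)) (b i)))"
        by (rule Jen_finsum[symmetric]) (use b ga.subspace_scale[OF Jen_lift_subspace] in auto)
      also have "\<dots> = (\<Oplus>\<^bsub>jen r\<^esub>i\<in>{..<?n}. ?A $$ (i, j) \<odot>\<^bsub>jen r\<^esub> (bs ! i))"
        by (rule je.M.finsum_cong') (use b j ga.subspace_scale[OF Jen_lift_subspace] in auto)
      finally show "?T (bs ! j) = (\<Oplus>\<^bsub>jen r\<^esub>i\<in>{..<?n}. ?A $$ (i, j) \<odot>\<^bsub>jen r\<^esub> (bs ! i))" .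
    qed simp
    then show ?thesis using bs \<beta> by blast
  qed
  then have "?P (endo_det (jen r) ?T)" unfolding endo_det_def by (rule someI_ex)
  then obtain bs A where bs: "distinct bs" "je.basis (set bs)" "represents_endo (jen r) bs ?T A"
    and det: "endo_det (jen r) ?T = det A" by blast
  obtain b where b: "\<forall>i<length bs. bs ! i = cl r (b i) \<and> b i \<in> Jen_lift r" using lift bs by blast
  let ?n = "length bs"
  have A: "A \<in> carrier_mat ?n ?n" using bs(3) by (simp add: represents_endo_def)
  have lc: "je.lincomb a (set bs) = cl r (\<Sum>i<?n. ga_scale (a (bs ! i)) (b i))" for a
    by (rule lincomb_list[OF bs(1)]) (use b in auto)
  have le: "?n \<le> codim Jen_lift r"
  proof (rule independent_mod_le_codim)
    fix c assume c: "(\<Sum>i<?n. ga_scale (c i) (b i)) \<in> JP (Suc r)"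
    define f where "f v = c (THE i. i < ?n \<and> bs ! i = v)" for v
    have f: "f (bs ! i) = c i" if "i < ?n" for i
      unfolding f_def using that bs(1) by (intro arg_cong[of _ _ c] the_equality) (auto simp: nth_eq_iff_index_eq)
    have "je.lincomb f (set bs) = cl r (\<Sum>i<?n. ga_scale (c i) (b i))" unfolding lc using f by simp
    also have "\<dots> = \<zero>\<^bsub>jen r\<^esub>" using c by (simp add: cl_eq)
    finally have lc0: "je.lincomb f (set bs) = \<zero>\<^bsub>jen r\<^esub>" .
    have "\<not> je.lin_dep (set bs)" using bs(2) by (simp add: je.basis_def)
    from je.not_lindepD[OF this _ order_refl _ lc0] have "f v = 0" if "v \<in> set bs" for v
      using that by (auto simp: class_ring_simps)
    then show "\<forall>i<?n. c i = 0" using f nth_mem by metis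
  qed (use b in blast)
  have span: "Jen_lift r \<subseteq> ga.span (b ` {..<?n} \<union> JP (Suc r))"
  proof
    fix y assume "y \<in> Jen_lift r"
    then have "cl r y \<in> je.span (set bs)" using bs(2) unfolding je.basis_def Jen_simps by blast
    then obtain a where "je.lincomb a (set bs) = cl r y"
      using je.finite_in_span[of "set bs" "cl r y"] bs(2) unfolding je.basis_def by blast
    then have "y - (\<Sum>i<?n. ga_scale (a (bs ! i)) (b i)) \<in> JP (Suc r)" using lc[of a] cl_eq by metis
    then have "y - (\<Sum>i<?n. ga_scale (a (bs ! i)) (b i)) \<in> ga.span (b ` {..<?n} \<union> JP (Suc r))"
      by (intro ga.span_base) simp
    moreover have "(\<Sum>i<?n. ga_scale (a (bs ! i)) (b i)) \<in> ga.span (b ` {..<?n} \<union> JP (Suc r))"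
      by (intro ga.span_sum ga.span_scale ga.span_base) auto
    ultimately have "(y - (\<Sum>i<?n. ga_scale (a (bs ! i)) (b i))) + (\<Sum>i<?n. ga_scale (a (bs ! i)) (b i))
        \<in> ga.span (b ` {..<?n} \<union> JP (Suc r))" by (rule ga.span_add)
    then show "y \<in> ga.span (b ` {..<?n} \<union> JP (Suc r))" by simp
  qed
  have "\<alpha> (b j) - comb ?n b A j \<in> JP (Suc r)" if j: "j < ?n" for j
  proof -
    have "cl r (\<alpha> (b j)) = ?T (bs ! j)" using b j Jen_map_cl[OF \<alpha>] by simp
    also have "\<dots> = (\<Oplus>\<^bsub>jen r\<^esub>i\<in>{..<?n}. A $$ (i, j) \<odot>\<^bsub>jen r\<^esub> (bs ! i))"
      using bs(3) j by (simp add: represents_endo_def)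
    also have "\<dots> = (\<Oplus>\<^bsub>jen r\<^esub>i\<in>{..<?n}. cl r (ga_scale (A $$ (i, j)) (b i)))"
      by (rule je.M.finsum_cong') (use b j ga.subspace_scale[OF Jen_lift_subspace] in auto)
    also have "\<dots> = cl r (comb ?n b A j)" unfolding comb_def
      by (rule Jen_finsum) (use b ga.subspace_scale[OF Jen_lift_subspace] in auto)
    finally show ?thesis by (simp add: cl_eq)
  qed
  then show ?thesis using that[OF A det le _ span] b by blast
qed

end

section \<open>The action on the socle\<close>

context pbw_basis begin

lemma top_prod_cong: "(\<And>i. i \<in> set is \<Longrightarrow> v i = v' i) \<Longrightarrow> top_prod v = top_prod v'"
  unfolding top_prod_def by (intro arg_cong[of _ _ prod_list] map_cong) auto

text \<open>A product of top weight is annihilated by the radical.\<close>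

lemma top_prod_norm_elt: "\<exists>c. top_prod b = ga_scale c norm_elt"
proof (rule aug_annihilated)
  fix g
  have "word (sum_list (map wt (block_letters (p - 1) is))) (length (block_letters (p - 1) is))
      (prod_list (map b (block_letters (p - 1) is)))"
    by (rule word_prod_list) (use wt_pos b_Z in auto)
  then have "top_prod b \<in> JP top_wt"
    unfolding prod_block_letters wt_block_letters top_prod_def[symmetric] top_wt_def[symmetric] by (rule word_JP)
  then have "(gk g - 1) * top_prod b \<in> JP (Suc 0 + top_wt)"
    by (intro JP_mult) (simp_all add: JP_1 gel_minus_1_aug)
  then show "(gk g - 1) * top_prod b = 0" by (simp add: JP_above_top)
qed

end

context modular_p_group begin

text \<open>The vectors of one weight after the other are replaced by their images.\<close>

lemma top_prod_blocks:
  fixes b :: "nat \<Rightarrow> nat \<Rightarrow> ('g \<Rightarrow>\<^sub>0 'k)"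
  assumes "pbw_basis p Z js fst (\<lambda>(r, i). b r i)" and js: "set js = Sigma {1..R} (\<lambda>r. {..<d r})"
    and A: "\<And>r. r \<ge> 1 \<Longrightarrow> A r \<in> carrier_mat (d r) (d r)"
    and b: "\<And>r i. r \<ge> 1 \<Longrightarrow> i < d r \<Longrightarrow> b r i \<in> Z r"
  shows "pbw_basis.top_prod p js (\<lambda>(r, j). comb (d r) (b r) (A r) j)
    = ga_scale ((\<Prod>r\<in>{1..R}. det (A r)) ^ (p - 1)) (pbw_basis.top_prod p js (\<lambda>(r, i). b r i))"
proof -
  interpret pbw_basis p k_type g_type Z js fst "\<lambda>(r, i). b r i" by fact
  define w where "w m = (\<lambda>(r, j). if r \<le> m then comb (d r) (b r) (A r) j else b r j)" for m
  have combZ: "comb (d r) (b r) (A r) j \<in> Z r" if "r \<ge> 1" for r j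
    unfolding comb_def
    by (intro ga.subspace_sum[OF Z_subspace[OF that]] ga.subspace_scale[OF Z_subspace[OF that]])
      (use b that in auto)
  have wZ: "w m (r, j) \<in> Z r" if "r \<ge> 1" "j < d r" for m r j
    using combZ b that by (simp add: w_def)
  have "top_prod (w m) = ga_scale ((\<Prod>r\<in>{1..m}. det (A r)) ^ (p - 1)) (top_prod (\<lambda>(r, i). b r i))"
    if "m \<le> R" for m
    using that
  proof (induction m)
    case 0
    have "top_prod (w 0) = top_prod (\<lambda>(r, i). b r i)"
      by (rule top_prod_cong) (auto simp: w_def js)
    then show ?case by simp
  next
    case (Suc m)
    let ?s = "Suc m"
    have s: "?s \<ge> 1" by simp
    define G where "G u = top_prod (\<lambda>(r, i). if r = ?s then u i else w m (r, i))" for u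
    have mem: "(?s, i) \<in> set js" if "i < d ?s" for i using that Suc.prems by (simp add: js)
    have upd: "(\<lambda>(r, j). if r = ?s then (u(i := x)) j else w m (r, j))
        = (\<lambda>(r, j). if r = ?s then u j else w m (r, j))((?s, i) := x)" for u i x
      by (auto simp: fun_eq_iff)
    interpret transvection_invariant "d ?s" "p - 1" "Z ?s" G
    proof
      show "1 \<le> p - 1" using prime_gt_1_nat[OF p_prime] by simp
      show "ga.subspace (Z ?s)" by (rule Z_subspace[OF s])
    next
      fix u :: "nat \<Rightarrow> ('g \<Rightarrow>\<^sub>0 'k)" and i j
      assume u: "\<forall>i<d ?s. u i \<in> Z ?s" and i: "i < d ?s" and j: "j < d ?s" "i \<noteq> j"
      let ?v = "\<lambda>(r, j). if r = ?s then u j else w m (r, j)"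
      have v: "?v k \<in> Z (fst k)" if "k \<in> set js" for k using that u wZ by (auto simp: js split: if_splits)
      have "top_prod (?v((?s, i) := ?v (?s, i) + ?v (?s, j))) = top_prod ?v"
        by (rule top_prod_add[OF v]) (use mem i j in auto)
      then show "G (u(i := u i + u j)) = G u" unfolding G_def upd by simp
    next
      fix u :: "nat \<Rightarrow> ('g \<Rightarrow>\<^sub>0 'k)" and i c
      assume i: "i < d ?s"
      let ?v = "\<lambda>(r, j). if r = ?s then u j else w m (r, j)"
      have "top_prod (?v((?s, i) := ga_scale c (?v (?s, i)))) = ga_scale (c ^ (p - 1)) (top_prod ?v)"
        by (rule top_prod_scale[OF mem[OF i]])
      then show "G (u(i := ga_scale c (u i))) = ga_scale (c ^ (p - 1)) (G u)" unfolding G_def upd by simp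
    next
      fix u u' :: "nat \<Rightarrow> ('g \<Rightarrow>\<^sub>0 'k)"
      assume "\<forall>i<d ?s. u i = u' i"
      then show "G u = G u'" unfolding G_def by (intro top_prod_cong) (auto simp: js)
    qed
    have "top_prod (w ?s) = G (comb (d ?s) (b ?s) (A ?s))"
      unfolding G_def by (intro top_prod_cong) (auto simp: w_def)
    also have "\<dots> = ga_scale (det (A ?s) ^ (p - 1)) (G (b ?s))"
      by (rule F_comb) (use b s A in auto)
    also have "G (b ?s) = top_prod (w m)"
      unfolding G_def by (intro top_prod_cong) (auto simp: w_def)
    also have "\<dots> = ga_scale ((\<Prod>r\<in>{1..m}. det (A r)) ^ (p - 1)) (top_prod (\<lambda>(r, i). b r i))"
      using Suc by simp
    finally show ?case by (simp add: power_mult_distrib mult.commute)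
  qed
  from this[OF order_refl] have "top_prod (w R)
      = ga_scale ((\<Prod>r\<in>{1..R}. det (A r)) ^ (p - 1)) (top_prod (\<lambda>(r, i). b r i))" .
  moreover have "top_prod (w R) = top_prod (\<lambda>(r, j). comb (d r) (b r) (A r) j)"
    by (rule top_prod_cong) (auto simp: w_def js)
  ultimately show ?thesis by simp
qed

lemma socle_action:
  assumes \<alpha>: "ga_automorphism \<alpha>"
  shows "\<alpha> norm_elt = ga_scale (Jen_det_prod \<alpha> ^ (p - 1)) norm_elt" "Jen_det_prod \<alpha> \<noteq> 0"
proof -
  define R where "R = nil_index"
  let ?prop = "\<lambda>r d b A. A \<in> carrier_mat d d \<and> endo_det (jen r) (Jen_map \<alpha> r) = det A \<and> d \<le> codim Jen_lift r \<and>
    (\<forall>i<d. b i \<in> Jen_lift r) \<and> Jen_lift r \<subseteq> ga.span (b ` {..<d} \<union> JP (Suc r)) \<and>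
    (\<forall>j<d. \<alpha> (b j) - comb d b A j \<in> JP (Suc r))"
  have "\<exists>d b A. r \<ge> 1 \<longrightarrow> ?prop r d b A" for r
  proof (cases "r \<ge> 1")
    case True
    then show ?thesis by (rule endo_det_representation[OF \<alpha>]) blast
  qed blast
  then obtain d b A where "\<And>r. r \<ge> 1 \<longrightarrow> ?prop r (d r) (b r) (A r)" by metis
  then have A: "A r \<in> carrier_mat (d r) (d r)" and det: "endo_det (jen r) (Jen_map \<alpha> r) = det (A r)"
    and d: "d r \<le> codim Jen_lift r" and b: "\<And>i. i < d r \<Longrightarrow> b r i \<in> Jen_lift r"
    and span: "Jen_lift r \<subseteq> ga.span (b r ` {..<d r} \<union> JP (Suc r))"
    and \<alpha>b: "\<And>j. j < d r \<Longrightarrow> \<alpha> (b r j) - comb (d r) (b r) (A r) j \<in> JP (Suc r)"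
    if "r \<ge> 1" for r using that by blast+
  have Y0: "Jen_lift r \<subseteq> {0}" if "r > R" for r
    using Jen_lift_subset_JP[of r] JP_anti[of nil_index r] JP_eventually_0 that by (auto simp: R_def)
  define I where "I = Sigma {1..R} (\<lambda>r. {..<d r})"
  have "finite I" by (simp add: I_def)
  then obtain js where js: "set js = I" "distinct js" using finite_distinct_list by blast
  interpret lie_system p k_type g_type Jen_lift by (rule lie_system_Jen_lift)
  let ?b = "\<lambda>(r, i). b r i"
  have pbw: "pbw_basis p Jen_lift js fst ?b"
  proof
    fix r :: nat assume r: "r \<ge> 1"
    show "Jen_lift r \<subseteq> ga.span (?b ` {i \<in> set js. fst i = r} \<union> JP (Suc r))"
    proof (cases "r \<le> R")
      case True
      have "b r ` {..<d r} \<subseteq> ?b ` {i \<in> set js. fst i = r}"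
      proof
        fix x assume "x \<in> b r ` {..<d r}"
        then obtain i where "i < d r" "x = ?b (r, i)" by auto
        then show "x \<in> ?b ` {i \<in> set js. fst i = r}"
          using r True by (intro image_eqI[of _ _ "(r, i)"]) (simp_all add: js I_def)
      qed
      then show ?thesis by (intro order_trans[OF span[OF r]] ga.span_mono Un_mono order_refl)
    next
      case False
      then have "Jen_lift r \<subseteq> {0}" by (intro Y0) simp
      also have "{0} \<subseteq> ga.span (?b ` {i \<in> set js. fst i = r} \<union> JP (Suc r))" by (simp add: ga.span_zero)
      finally show ?thesis .
    qed
  next
    fix k assume "k \<in> set js"
    then obtain r j where "k = (r, j)" "r \<ge> 1" "j < d r" by (auto simp: js I_def)
    then show "fst k \<ge> 1" "?b k \<in> Jen_lift (fst k)" using b by simp_all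
  qed (rule js(2))
  then interpret pbw_basis p k_type g_type Jen_lift js fst ?b .
  let ?T = "top_prod ?b" and ?D = "\<Prod>r\<in>{1..R}. det (A r)"
  have len: "length js = (\<Sum>r\<in>{1..R}. d r)"
    using js distinct_card[OF js(2)] by (simp add: I_def)
  have "p ^ length js \<le> p ^ (\<Sum>r\<in>{1..R}. codim Jen_lift r)"
    unfolding len by (rule power_increasing) (use d prime_ge_1_nat[OF p_prime] in \<open>auto intro: sum_mono\<close>)
  then have "card (UNIV :: 'g set) = p ^ length js"
    using card_le_pbw card_eq_codim by (simp add: R_def)
  then have T0: "?T \<noteq> 0" using top_mon_neq_0 by (simp add: top_prod_def mon_def)
  have "\<alpha> ?T = top_prod (\<lambda>(r, i). \<alpha> (b r i))"
    by (simp add: top_prod_def aut_prod_list[OF \<alpha>] aut_power[OF \<alpha>] o_def case_prod_unfold)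
  also have "\<dots> = top_prod (\<lambda>(r, j). comb (d r) (b r) (A r) j)"
  proof (rule top_prod_cong_JP)
    fix k assume "k \<in> set js"
    then obtain r j where k: "k = (r, j)" "r \<ge> 1" "j < d r" by (auto simp: js I_def)
    show "(case k of (r, i) \<Rightarrow> \<alpha> (b r i)) \<in> Jen_lift (fst k)" using aut_Jen_lift[OF \<alpha> k(2)] b[OF k(2,3)] k(1) by auto
    show "(case k of (r, j) \<Rightarrow> comb (d r) (b r) (A r) j) \<in> Jen_lift (fst k)"
      using k b[OF k(2)] by (auto simp: comb_def intro!: ga.subspace_sum ga.subspace_scale Jen_lift_subspace)
    show "(case k of (r, i) \<Rightarrow> \<alpha> (b r i)) - (case k of (r, j) \<Rightarrow> comb (d r) (b r) (A r) j) \<in> JP (Suc (fst k))"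
      using \<alpha>b[OF k(2,3)] k(1) by simp
  qed
  also have "\<dots> = ga_scale (?D ^ (p - 1)) ?T"
    by (rule top_prod_blocks[OF pbw]) (use js A b in \<open>auto simp: I_def\<close>)
  finally have \<alpha>T: "\<alpha> ?T = ga_scale (?D ^ (p - 1)) ?T" .
  have D: "Jen_det_prod \<alpha> = ?D"
  proof -
    have zero: "carrier (jen r) = {\<zero>\<^bsub>jen r\<^esub>}" if "r > R" for r
      using Y0[OF that] ga.subspace_0[OF Jen_lift_subspace[of r]] by auto
    have "det (A r) = 1" if "r \<ge> 1" "carrier (jen r) = {\<zero>\<^bsub>jen r\<^esub>}" for r
    proof -
      have "Jen_lift r \<subseteq> JP (Suc r)"
      proof
        fix y assume "y \<in> Jen_lift r"
        then have "cl r y = cl r 0" using that(2) by auto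
        then show "y \<in> JP (Suc r)" by (simp add: cl_eq)
      qed
      then have "codim Jen_lift r = 0" using ga.dim_subset[of "Jen_lift r" "JP (Suc r)"] by (simp add: codim_def)
      then show ?thesis using d[OF that(1)] A[OF that(1)] by simp
    qed
    then have "(\<Prod>r | 1 \<le> r \<and> carrier (jen r) \<noteq> {\<zero>\<^bsub>jen r\<^esub>}. det (A r)) = ?D"
      using zero by (intro prod.mono_neutral_left) (auto simp: not_le[symmetric] simp del: Jen_simps)
    moreover have "Jen_det_prod \<alpha> = (\<Prod>r | 1 \<le> r \<and> carrier (jen r) \<noteq> {\<zero>\<^bsub>jen r\<^esub>}. det (A r))"
      unfolding Jen_det_prod_def by (rule prod.cong[OF refl]) (simp add: det del: Jen_simps)
    ultimately show ?thesis by simp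
  qed
  obtain c where c: "?T = ga_scale c norm_elt" using top_prod_norm_elt by blast
  then have c0: "c \<noteq> 0" using T0 by auto
  then have n: "norm_elt = ga_scale (inverse c) ?T" using c by simp
  show "\<alpha> norm_elt = ga_scale (Jen_det_prod \<alpha> ^ (p - 1)) norm_elt"
    by (subst (1 2) n) (simp add: aut_scale[OF \<alpha>] \<alpha>T D mult.commute)
  have "\<alpha> ?T \<noteq> 0" using T0 aut_0[OF \<alpha>] aut_bij[OF \<alpha>] by (metis bij_is_inj injD)
  then have "?D ^ (p - 1) \<noteq> 0" using \<alpha>T by auto
  then show "Jen_det_prod \<alpha> \<noteq> 0" using D prime_gt_1_nat[OF p_prime] by (auto simp: zero_power)
qed

end

theorem mainTheorem2:
  fixes p :: nat
    and \<alpha> :: "('g::{finite,group_add} \<Rightarrow>\<^sub>0 'k::field) \<Rightarrow> ('g \<Rightarrow>\<^sub>0 'k)"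
  assumes "prime p"
    and "\<exists>n. card (UNIV :: 'g set) = p ^ n"
    and "CHAR('k) = p"
    and "ga_automorphism \<alpha>"
  shows "(\<forall>r\<ge>1.
            subspace class_ring (carrier (Jen r)) (jac_quot r :: ('k, ('g \<Rightarrow>\<^sub>0 'k) set) module) \<and>
            jac_quot_map \<alpha> r ` carrier (Jen r) = carrier (Jen r) \<and>
            linear_map class_ring (Jen r) (Jen r) (Jen_map \<alpha> r) \<and>
            bij_betw (Jen_map \<alpha> r) (carrier (Jen r)) (carrier (Jen r))) \<and>
         (let l = Jen_det_prod \<alpha> ^ (p - 1) in
            (\<forall>x\<in>socle. \<alpha> x = ga_scale l x) \<and>
            l \<in> {\<mu> ^ (p - 1) | \<mu>. \<mu> \<noteq> 0})"
proof -
  interpret modular_p_group p "TYPE('k)" "TYPE('g)" by standard (use assms in auto)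
  note \<alpha> = assms(4)
  let ?l = "Jen_det_prod \<alpha> ^ (p - 1)"
  have "\<alpha> x = ga_scale ?l x" if x: "x \<in> socle" for x
  proof -
    obtain c where "x = ga_scale c norm_elt" using x socle_subset by blast
    then show ?thesis by (simp add: aut_scale[OF \<alpha>] socle_action(1)[OF \<alpha>] mult.commute)
  qed
  moreover have "?l \<in> {\<mu> ^ (p - 1) | \<mu>. \<mu> \<noteq> 0}"
    by (rule CollectI, rule exI[of _ "Jen_det_prod \<alpha>"]) (simp add: socle_action(2)[OF \<alpha>])
  ultimately show ?thesis
    unfolding Let_def
    by (intro conjI allI impI ballI)
      (rule Jen_subspace, rule jac_quot_map_Jen[OF \<alpha>], assumption, rule Jen_map_linear[OF \<alpha>], assumption,
        rule Jen_map_bij[OF \<alpha>], assumption, assumption, assumption)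
qed

end
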